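(* Let $f:[1,\infty)\to(0,\infty)$ be a nondecreasing function such that $\limsup_{n\to\infty} f(b_n)/f(n)<\infty$ whenever $\limsup_{n\to\infty} b_n/n<\infty$. Let $\{a_n\}$ be a sequence of positive integers with $a_n\to\infty$, and let $T_n=S_{n+a_n}-S_n$. (1) Let $0<\lambda\le\infty$. Assume $\limsup_{n\to\infty} a_n/\tau_1(n)<\infty$ in the case $\lambda=\infty$, and $\limsup_{n\to\infty}a_n/n<\infty$ in the case $0<\lambda<\infty$. Then, with probability one, $$\limsup_{n\to\infty}\frac{|T_n|}{B_n (f(n))^{1/\alpha_1}}=0 \iff \int_1^\infty \frac{dx}{x f(x)}<\infty,\qquad \limsup_{n\to\infty}\frac{|T_n|}{B_n (f(n))^{1/\alpha_1}}=\infty \iff \int_1^\infty \frac{dx}{x f(x)}=\infty .$$ (2) Let $\lambda=0$. Assume $\limsup_{n\to\infty}a_n/n<\infty$ and that for some $\mu>\frac{\alpha_2-\alpha_1}{\alpha_2}$ one has $\tau_1(n)<n^{\alpha_1/\alpha_2}(\log n)^{-\mu}$ for all sufficiently large $n$. Then, with probability one, $$\limsup_{n\to\infty}\frac{|T_n|}{B_n (f(n))^{1/\alpha_2}}=0 \iff \int_1^\infty \frac{dx}{x f(x)}<\infty,\qquad \limsup_{n\to\infty}\frac{|T_n|}{B_n (f(n))^{1/\alpha_2}}=\infty \iff \int_1^\infty \frac{dx}{x f(x)}=\infty .$$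
   Context: Let $0<\alpha_1<\alpha_2<2$. $\{X_n\}_{n\ge1}$ are independent random variables; $X_n$ has distribution function $F_n\in\{G_1,G_2\}$. For $j=1,2$, $G_j$ is in the domain of normal attraction of the (symmetric, non-normal) stable law with characteristic function $\varphi_j(t)=\exp(-\lambda_j|t|^{\alpha_j})$, $\lambda_j>0$, called the stable $(\alpha_j)$ law; in particular, for $x>0$, $1-G_j(x)=\frac{c_{j1}+\theta_j(x)}{x^{\alpha_j}}$ and $G_j(-x)=\frac{c_{j2}+\beta_j(-x)}{x^{\alpha_j}}$ with $c_{j1},c_{j2}>0$ and $\theta_j(x),\beta_j(-x)\to0$ as $x\to\infty$. $S_n=\sum_{k=1}^n X_k$. $\tau_j(n)$ is the number of $k\le n$ with $F_k=G_j$, so $\tau_1(n)+\tau_2(n)=n$; it is assumed that $\tau_j(n)\to\infty$ for $j=1,2$. Let $U_{\tau_1(n)}$ and $V_{\tau_2(n)}$ be the sums of those $X_k$, $k\le n$, with distribution function $G_1$ and $G_2$ respectively. With $B_j(m)=m^{1/\alpha_j}$, $(U_{\tau_1(n)}-d_1(\tau_1(n)))/B_1(\tau_1(n))$ and $(V_{\tau_2(n)}-d_2(\tau_2(n)))/B_2(\tau_2(n))$ converge in distribution to the stable $(\alpha_1)$ and stable $(\alpha_2)$ laws; the centering convention is that $d_1=d_2=0$ if $\alpha_1\ne1,\alpha_2\neq 1$, while $d_j(n)\sim n\log n$ if $\alpha_j=1$ (here $f_n\sim g_n$ means that $f_n/g_n$ converges to a constant in $(0,\infty)$). It is assumed that $(S_n-A_n)/B_n$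 converges in distribution to a proper random variable for suitable $A_n\in\mathbb{R}$, $B_n>0$; equivalently $\frac{(\tau_1(n))^{\alpha_2}}{(\tau_2(n))^{\alpha_1}}\to\lambda$ for some $\lambda\in[0,\infty]$. The limit law is stable $(\alpha_2)$ if $\lambda=0$, a composition (convolution) of the two stable laws if $0<\lambda<\infty$, and stable $(\alpha_1)$ if $\lambda=\infty$. The normalization is $B_n=(\tau_1(n))^{1/\alpha_1}$ if $\lambda=\infty$ and $B_n=(\tau_2(n))^{1/\alpha_2}$ (of exact order $n^{1/\alpha_2}$) if $0\le\lambda<\infty$. *)

theory Defs
  imports "HOL-Probability.Probability"
begin

definition is_symmetric_stable :: "real measure \<Rightarrow> real \<Rightarrow> real \<Rightarrow> bool" where
  "is_symmetric_stable Z \<alpha> l \<longleftrightarrow>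
     real_distribution Z \<and> (\<forall>t. char Z t = complex_of_real (exp (- l * \<bar>t\<bar> powr \<alpha>)))"

text \<open>
  A law \<open>G\<close> is in the domain of normal attraction of the symmetric stable law
  with parameters \<open>\<alpha>\<close>, \<open>l\<close>, with centering constants \<open>d\<close>: the sums of \<open>n\<close> independent
  copies, realised on the \<open>n\<close>-fold product of \<open>G\<close>, converge in distribution when centered by
  \<open>d n\<close> and normed by \<open>n powr (1 / \<alpha>)\<close>. A constant factor in the norming
  can be absorbed in \<open>l\<close>.
\<close>
definition normal_attraction :: "real measure \<Rightarrow> (nat \<Rightarrow> real) \<Rightarrow> real \<Rightarrow> real \<Rightarrow> bool" where
  "normal_attraction G d \<alpha> l \<longleftrightarrow>
     real_distribution G \<and>
     (\<exists>Z. is_symmetric_stable Z \<alpha> l \<and>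
       weak_conv_m
         (\<lambda>n. distr (PiM {1..n} (\<lambda>_. G)) borel
                (\<lambda>x. ((\<Sum>i=1..n. x i) - d n) / real n powr (1 / \<alpha>))) Z)"

text \<open>
  No centering unless \<open>\<alpha> = 1\<close>. For \<open>\<alpha> = 1\<close> the centering is at most of order \<open>n ln n\<close>;
  the limit \<open>c = 0\<close> has to be admitted, because the stable limit here is symmetric, which
  balances the two tails and leaves no positive multiple of \<open>n ln n\<close> (the Cauchy law needs
  no centering at all).
\<close>
definition centering_convention :: "real \<Rightarrow> (nat \<Rightarrow> real) \<Rightarrow> bool" where
  "centering_convention \<alpha> d \<longleftrightarrow>
     (\<alpha> \<noteq> 1 \<longrightarrow> (\<forall>n. d n = 0)) \<and>
     (\<alpha> = 1 \<longrightarrow> (\<exists>c\<ge>0. (\<lambda>n. d n / (real n * ln (real n))) \<longlonglongrightarrow> c))"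

definition law_count :: "'a measure \<Rightarrow> (nat \<Rightarrow> 'a \<Rightarrow> real) \<Rightarrow> real measure \<Rightarrow> nat \<Rightarrow> nat" where
  "law_count M X G n = card {k \<in> {1..n}. distr M borel (X k) = G}"

definition partial_sum :: "(nat \<Rightarrow> 'a \<Rightarrow> real) \<Rightarrow> nat \<Rightarrow> 'a \<Rightarrow> real" where
  "partial_sum X n \<omega> = (\<Sum>k=1..n. X k \<omega>)"

end

theory Submission
  imports Defs
begin

text \<open>
  The proof rests on one observation: for summands with tails of order \<open>x powr - \<alpha>\<close> and a
  norming sequence \<open>b\<close>, everything is decided by the series of \<open>b k powr - \<alpha>\<close>, taken over the
  indices \<open>k\<close> of each type with that type's own exponent \<open>\<alpha>\<close>. This term is of the order of
  the probability that a single summand exceeds \<open>b k\<close>, and it also bounds, up to a constant, the second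
  moment of the summand truncated at \<open>b k\<close>, divided by \<open>(b k)\<^sup>2\<close>.

  \<^item> If both series converge, Borel--Cantelli removes the large summands, the truncated and
    centered summands divided by \<open>b k\<close> form an almost surely convergent series, and the Kronecker
    lemma gives \<open>S n / b n \<longlonglongrightarrow> 0\<close> (lemma \<open>sum_over_norming_tendsto_0\<close>). Since \<open>b (n + a n)\<close> is at
    most a constant times \<open>b n\<close>, the windows are negligible too (\<open>limsup_window_zero\<close>).

  \<^item> If one of them diverges, some summand exceeds every multiple of \<open>b k\<close> infinitely often. Every
    index \<open>k\<close> lies in a window, namely in the one that starts at \<open>k - 1\<close>; a first-passage argument
    shows that the rest of this window does not cancel the large summand, and the zero-one law turns
    a positive probability into probability one (\<open>frequently_large_window\<close>, \<open>limsup_window_top\<close>).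

  Two things remain. The first is to extract the two-sided tail bounds from the mere weak convergence
  of the normed sums. Along \<open>s \<longlonglongrightarrow> 0\<close> with about \<open>s powr - \<alpha>\<close> summands, the convergence of the
  characteristic functions yields that \<open>1 - \<bar>\<phi> s\<bar>\<^sup>2\<close>, with \<open>\<phi>\<close> the characteristic function of a
  single summand, is of exact order \<open>s powr \<alpha>\<close>
  (\<open>char_modulus_bounds\<close>), which controls the tails of the symmetrised law from both sides.
  Truncated means are small relative to the norming as well: this follows from the tails when
  \<open>\<alpha> < 1\<close>, from the mean being zero when \<open>\<alpha> > 1\<close>, and for \<open>\<alpha> = 1\<close> from the fact that
  convergence of the integral forces \<open>f n / ln n\<close> to tend to infinity, which beats the logarithmic
  growth of the truncated means (\<open>normal_attraction_bounds\<close>, \<open>summable_imp_tendsto_infinity\<close>).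

  The second is to compare the series with the integral. Along the indices of one type the reciprocal
  counts add up to a harmonic number of the count, so summation by parts replaces the sparse series
  of \<open>1 / (\<tau> k * f k)\<close> by the series of \<open>1 / (k * f k)\<close>, provided the count grows at least like
  a power (\<open>summable_over_count\<close>, \<open>not_summable_over_count\<close>). When \<open>\<lambda> = 0\<close> the first type is so
  sparse that its series converges as soon as the integral does (\<open>sparse_type_sums\<close>).
\<close>

section \<open>Characteristic functions of normed sums\<close>

text \<open>
  Pointwise convergence of the characteristic functions is not enough below, since the argument
  varies with \<open>n\<close>. Realising the laws by an almost surely convergent sequence (Skorohod) makes the
  moving argument harmless.
\<close>
lemma char_tendsto_along:
  fixes P :: "nat \<Rightarrow> real measure"
  assumes P: "\<And>n. real_distribution (P n)" and Z: "real_distribution Z"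
    and conv: "weak_conv_m P Z" and t: "t \<longlonglongrightarrow> t0"
  shows "(\<lambda>n. char (P n) (t n)) \<longlonglongrightarrow> char Z t0"
proof -
  obtain Om :: "real measure" and Y :: "nat \<Rightarrow> real \<Rightarrow> real" and Y0 :: "real \<Rightarrow> real" where
    Om: "prob_space Om" and Y [measurable]: "\<And>n. Y n \<in> borel_measurable Om"
    and dY: "\<And>n. distr Om borel (Y n) = P n"
    and Y0 [measurable]: "Y0 \<in> borel_measurable Om" and dY0: "distr Om borel Y0 = Z"
    and lim: "\<And>x. x \<in> space Om \<Longrightarrow> (\<lambda>n. Y n x) \<longlonglongrightarrow> Y0 x"
    using Skorohod[OF P Z conv] unfolding measurable_lborel1 measurable_lborel2 by blast
  interpret Om: prob_space Om by fact
  have 1: "char (P n) (t n) = (CLINT x|Om. iexp (t n * Y n x))" for n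
    unfolding char_def dY[symmetric] by (subst integral_distr) auto
  have 2: "char Z t0 = (CLINT x|Om. iexp (t0 * Y0 x))"
    unfolding char_def dY0[symmetric] by (subst integral_distr) auto
  show ?thesis unfolding 1 2
  proof (rule integral_dominated_convergence[where w="\<lambda>_. 1"])
    show "AE x in Om. (\<lambda>n. iexp (t n * Y n x)) \<longlonglongrightarrow> iexp (t0 * Y0 x)"
      by (intro AE_I2 tendsto_intros t lim)
  qed auto
qed

lemma weak_conv_m_compose:
  assumes "weak_conv_m P Z" and "filterlim k at_top sequentially"
  shows "weak_conv_m (\<lambda>n. P (k n)) Z"
  using assms unfolding weak_conv_m_def weak_conv_def
  by (auto intro: filterlim_compose)

context
  fixes G :: "real measure" and d :: "nat \<Rightarrow> real" and \<alpha> l :: real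
  assumes attr: "normal_attraction G d \<alpha> l" and \<alpha>: "0 < \<alpha>" "\<alpha> < 2" and l: "0 < l"
begin

interpretation G: real_distribution G
  using attr by (simp add: normal_attraction_def)

abbreviation (input) normed_sum_law :: "nat \<Rightarrow> real measure" where
  "normed_sum_law n \<equiv> distr (PiM {1..n} (\<lambda>_. G)) borel
                (\<lambda>x. ((\<Sum>i=1..n. x i) - d n) / real n powr (1 / \<alpha>))"

lemma real_distribution_normed_sum: "real_distribution (normed_sum_law n)"
proof -
  interpret product_prob_space "\<lambda>_. G" "{1..n}" ..
  interpret P: prob_space "PiM {1..n} (\<lambda>_. G)" by (rule prob_space_PiM) (rule G.prob_space_axioms)
  show ?thesis by (rule P.real_distribution_distr) measurable
qed

lemma char_normed_sum:
  "char (normed_sum_law n) t =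
    iexp (- t * d n / real n powr (1 / \<alpha>)) * char G (t / real n powr (1 / \<alpha>)) ^ n"
proof -
  interpret product_prob_space "\<lambda>_::nat. G" "{1..n}" ..
  let ?r = "real n powr (1 / \<alpha>)"
  have "char (normed_sum_law n) t = (CLINT x|PiM {1..n} (\<lambda>_. G). iexp (t * (((\<Sum>i=1..n. x i) - d n) / ?r)))"
    unfolding char_def by (subst integral_distr) (auto simp del: of_real_mult)
  also have "\<dots> = (CLINT x|PiM {1..n} (\<lambda>_. G). iexp (- t * d n / ?r) * (\<Prod>i=1..n. iexp ((t / ?r) * x i)))"
  proof (rule Bochner_Integration.integral_cong[OF refl])
    fix x :: "nat \<Rightarrow> real"
    have "(\<Prod>i=1..n. iexp ((t / ?r) * x i)) = iexp ((t / ?r) * (\<Sum>i=1..n. x i))"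
      by (simp add: exp_sum[symmetric] sum_distrib_left sum_divide_distrib)
    moreover have "t * (((\<Sum>i=1..n. x i) - d n) / ?r) = - t * d n / ?r + (t / ?r) * (\<Sum>i=1..n. x i)"
      by (simp add: diff_divide_distrib algebra_simps)
    ultimately show "iexp (t * (((\<Sum>i=1..n. x i) - d n) / ?r)) = iexp (- t * d n / ?r) * (\<Prod>i=1..n. iexp ((t / ?r) * x i))"
      by (simp only: of_real_add distrib_left exp_add)
  qed
  also have "\<dots> = iexp (- t * d n / ?r) * (CLINT x|PiM {1..n} (\<lambda>_. G). (\<Prod>i=1..n. iexp ((t / ?r) * x i)))"
    by (rule integral_mult_right_zero)
  also have "(CLINT x|PiM {1..n} (\<lambda>_. G). (\<Prod>i=1..n. iexp ((t / ?r) * x i))) = (\<Prod>i=1..n. char G (t / ?r))"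
    unfolding char_def by (intro product_integral_prod G.integrable_iexp) auto
  finally show ?thesis by simp
qed

text \<open>
  Both the number of summands and the argument may vary: \<open>k n\<close> summands are evaluated at \<open>t n\<close>.
\<close>
lemma char_normed_sum_tendsto:
  assumes k: "filterlim k at_top sequentially" and t: "t \<longlonglongrightarrow> t0"
  shows "(\<lambda>n. iexp (- t n * d (k n) / real (k n) powr (1 / \<alpha>)) * char G (t n / real (k n) powr (1 / \<alpha>)) ^ k n)
           \<longlonglongrightarrow> complex_of_real (exp (- l * \<bar>t0\<bar> powr \<alpha>))"
proof -
  obtain Z where Z: "is_symmetric_stable Z \<alpha> l" and conv: "weak_conv_m normed_sum_law Z"
    using attr by (auto simp: normal_attraction_def)
  have "(\<lambda>n. char (normed_sum_law (k n)) (t n)) \<longlonglongrightarrow> char Z t0"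
    using Z by (intro char_tendsto_along real_distribution_normed_sum weak_conv_m_compose[OF conv k] t)
      (auto simp: is_symmetric_stable_def)
  then show ?thesis using Z unfolding char_normed_sum is_symmetric_stable_def by simp
qed

lemma filterlim_ceiling_powr:
  "filterlim (\<lambda>s::real. nat \<lceil>s powr - \<alpha>\<rceil>) at_top (at_right 0)"
proof -
  have top: "filterlim (\<lambda>s::real. s powr - \<alpha>) at_top (at_right 0)"
    using \<alpha> by real_asymp
  show ?thesis unfolding filterlim_at_top
  proof
    fix Z :: nat
    have "\<forall>\<^sub>F s in at_right 0. real Z \<le> s powr - \<alpha>"
      using top unfolding filterlim_at_top by blast
    then show "\<forall>\<^sub>F s in at_right 0. Z \<le> nat \<lceil>s powr - \<alpha>\<rceil>"
      by eventually_elim linarith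
  qed
qed

text \<open>
  The number of summands is matched to the argument, so that the convergence of the normed sums
  describes \<open>char G s\<close> for every small \<open>s\<close> and not only along the sequence \<open>n powr (- 1 / \<alpha>)\<close>.
  Taking absolute values removes the centering.
\<close>
lemma char_power_tendsto:
  "((\<lambda>s. cmod (char G s) ^ nat \<lceil>s powr - \<alpha>\<rceil>) \<longlongrightarrow> exp (- l)) (at_right 0)"
  unfolding tendsto_at_iff_sequentially
proof (intro allI impI)
  fix s :: "nat \<Rightarrow> real"
  assume pos: "\<forall>i. s i \<in> {0<..} - {0}" and s: "s \<longlonglongrightarrow> 0"
  define k where "k = (\<lambda>i. nat \<lceil>s i powr - \<alpha>\<rceil>)"
  have spos: "s i > 0" for i using pos by auto
  have s': "filterlim s (at_right 0) sequentially"
    using s spos by (auto simp: filterlim_at intro!: always_eventually less_imp_neq[THEN not_sym])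
  have k: "filterlim k at_top sequentially"
    unfolding k_def by (rule filterlim_compose[OF filterlim_ceiling_powr s'])
  have kpos: "k i > 0" for i using spos[of i] by (simp add: k_def)
  have tl: "((\<lambda>s::real. s * real (nat \<lceil>s powr - \<alpha>\<rceil>) powr (1 / \<alpha>)) \<longlongrightarrow> 1) (at_right 0)"
  proof (rule tendsto_sandwich)
    show "\<forall>\<^sub>F s::real in at_right 0. s * (s powr - \<alpha>) powr (1 / \<alpha>) \<le> s * real (nat \<lceil>s powr - \<alpha>\<rceil>) powr (1 / \<alpha>)"
      using \<alpha> by (intro eventually_mono[OF eventually_at_right_less[of "0::real"]] mult_left_mono powr_mono2) (auto simp: real_nat_ceiling_ge)
    show "\<forall>\<^sub>F s::real in at_right 0. s * real (nat \<lceil>s powr - \<alpha>\<rceil>) powr (1 / \<alpha>) \<le> s * (s powr - \<alpha> + 1) powr (1 / \<alpha>)"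
      using \<alpha> by (intro eventually_mono[OF eventually_at_right_less[of "0::real"]] mult_left_mono powr_mono2) (auto intro: less_le_trans[OF _ powr_ge_zero])
    show "((\<lambda>s::real. s * (s powr - \<alpha>) powr (1 / \<alpha>)) \<longlongrightarrow> 1) (at_right 0)"
      using \<alpha> by real_asymp
    show "((\<lambda>s::real. s * (s powr - \<alpha> + 1) powr (1 / \<alpha>)) \<longlongrightarrow> 1) (at_right 0)"
      using \<alpha> by real_asymp
  qed
  define t where "t = (\<lambda>i. s i * real (k i) powr (1 / \<alpha>))"
  have t: "t \<longlonglongrightarrow> 1" unfolding t_def k_def by (rule filterlim_compose[OF tl s'])
  have st: "t i / real (k i) powr (1 / \<alpha>) = s i" for i using kpos[of i] by (simp add: t_def)
  from tendsto_norm[OF char_normed_sum_tendsto[OF k t]]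
  have "(\<lambda>i. cmod (char G (s i)) ^ k i) \<longlonglongrightarrow> exp (- l)"
    unfolding st norm_mult norm_power norm_exp_i_times by simp
  then show "((\<lambda>s. cmod (char G s) ^ nat \<lceil>s powr - \<alpha>\<rceil>) \<circ> s) \<longlonglongrightarrow> exp (- l)"
    by (simp add: o_def k_def)
qed

text \<open>
  If \<open>v = \<bar>char G s\<bar>\<^sup>2\<close> and \<open>n\<close> is about \<open>s powr - \<alpha>\<close>, then \<open>v ^ n\<close> is close to \<open>exp (- 2 * l)\<close>;
  hence \<open>1 - v\<close> is of order \<open>1 / n\<close>, that is, of order \<open>s powr \<alpha>\<close>.
\<close>
lemma char_modulus_bounds:
  obtains c s0 where "0 < c" "0 < s0"
    "\<And>s. 0 < s \<Longrightarrow> s \<le> s0 \<Longrightarrow> c * s powr \<alpha> \<le> 1 - (cmod (char G s))\<^sup>2"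
    "\<And>s. 0 < s \<Longrightarrow> s \<le> s0 \<Longrightarrow> 1 - (cmod (char G s))\<^sup>2 \<le> 4 * l * s powr \<alpha>"
proof -
  have lim: "((\<lambda>s. (cmod (char G s) ^ nat \<lceil>s powr - \<alpha>\<rceil>)\<^sup>2) \<longlongrightarrow> (exp (- l))\<^sup>2) (at_right 0)"
    by (intro tendsto_power char_power_tendsto)
  have e2: "(exp (- l))\<^sup>2 = exp (- 2 * l)" by (simp flip: exp_of_nat_mult)
  have "\<forall>\<^sub>F s in at_right 0. (cmod (char G s) ^ nat \<lceil>s powr - \<alpha>\<rceil>)\<^sup>2 < exp (- l)"
    using l by (intro order_tendstoD[OF lim]) (simp add: e2)
  moreover have "\<forall>\<^sub>F s in at_right 0. exp (- 4 * l) < (cmod (char G s) ^ nat \<lceil>s powr - \<alpha>\<rceil>)\<^sup>2"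
    using l by (intro order_tendstoD[OF lim]) (simp add: e2)
  ultimately have "\<forall>\<^sub>F s in at_right 0. (cmod (char G s) ^ nat \<lceil>s powr - \<alpha>\<rceil>)\<^sup>2 < exp (- l)
      \<and> exp (- 4 * l) < (cmod (char G s) ^ nat \<lceil>s powr - \<alpha>\<rceil>)\<^sup>2"
    by eventually_elim auto
  then obtain b where b: "b > 0" and
    H: "\<And>s. 0 < s \<Longrightarrow> s < b \<Longrightarrow> (cmod (char G s) ^ nat \<lceil>s powr - \<alpha>\<rceil>)\<^sup>2 < exp (- l)
      \<and> exp (- 4 * l) < (cmod (char G s) ^ nat \<lceil>s powr - \<alpha>\<rceil>)\<^sup>2"
    unfolding eventually_at_right[OF zero_less_one] by auto
  define s0 where "s0 = min (b / 2) 1"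
  define c where "c = (1 - exp (- l)) / 2"
  show ?thesis
  proof
    show "0 < c" using l by (simp add: c_def)
    show "0 < s0" using b by (simp add: s0_def)
  next
    fix s :: real assume s: "0 < s" "s \<le> s0"
    define n where "n = nat \<lceil>s powr - \<alpha>\<rceil>"
    define v where "v = (cmod (char G s))\<^sup>2"
    have s1: "s \<le> 1" "s < b" using s b by (auto simp: s0_def)
    have sp: "s powr - \<alpha> \<ge> 1" using s s1 \<alpha> by (simp add: powr_minus one_le_inverse_iff powr_le1)
    have n1: "n > 0" using s by (simp add: n_def)
    have nl: "s powr - \<alpha> \<le> real n" unfolding n_def by (simp add: real_nat_ceiling_ge)
    have nu: "real n \<le> 2 * s powr - \<alpha>"
      using sp unfolding n_def by linarith
    have ps: "s powr - \<alpha> = 1 / s powr \<alpha>" using s by (simp add: powr_minus field_simps)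
    have spp: "s powr \<alpha> > 0" using s by simp
    have v01: "0 \<le> v" "v \<le> 1"
      using G.cmod_char_le_1[of s] by (auto simp: v_def power_le_one)
    have vn: "v ^ n < exp (- l)" "exp (- 4 * l) < v ^ n"
      using H[OF s(1) s1(2)] by (auto simp: v_def n_def power_mult[symmetric] mult.commute)
    have "1 + real n * (v - 1) \<le> (1 + (v - 1)) ^ n"
      using v01 by (intro Bernoulli_inequality) auto
    then have "1 - exp (- l) \<le> real n * (1 - v)" using vn by (simp add: algebra_simps)
    also have "\<dots> \<le> 2 * s powr - \<alpha> * (1 - v)" using nu v01 by (intro mult_right_mono) auto
    finally have "1 - exp (- l) \<le> 2 / s powr \<alpha> * (1 - v)" by (simp add: ps)
    then show "c * s powr \<alpha> \<le> 1 - (cmod (char G s))\<^sup>2"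
      using spp by (simp add: c_def v_def[symmetric] field_simps)
    have "exp (- 4 * l / n) \<le> v"
    proof (rule ccontr)
      assume "\<not> exp (- 4 * l / n) \<le> v"
      then have "v ^ n \<le> exp (- 4 * l / n) ^ n" using v01 by (intro power_mono) auto
      also have "\<dots> = exp (- 4 * l)" using n1 by (simp flip: exp_of_nat_mult)
      finally show False using vn by simp
    qed
    moreover have "1 + (- 4 * l / n) \<le> exp (- 4 * l / n)" by (rule exp_ge_add_one_self)
    ultimately have "1 - v \<le> 4 * l * (1 / n)" by simp
    also have "\<dots> \<le> 4 * l * s powr \<alpha>"
      using l nl n1 spp by (intro mult_left_mono) (auto simp: ps field_simps)
    finally show "1 - (cmod (char G s))\<^sup>2 \<le> 4 * l * s powr \<alpha>" by (simp add: v_def)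
  qed
qed

end

section \<open>Tails, symmetrisation and truncated moments\<close>

abbreviation (input) abs_tail :: "real measure \<Rightarrow> real \<Rightarrow> real" where
  "abs_tail G x \<equiv> measure G {y. x \<le> \<bar>y\<bar>}"

abbreviation (input) truncated_mean :: "real measure \<Rightarrow> real \<Rightarrow> real" where
  "truncated_mean G b \<equiv> \<integral>y. y * indicator {y. \<bar>y\<bar> \<le> b} y \<partial>G"

abbreviation (input) truncated_second_moment :: "real measure \<Rightarrow> real \<Rightarrow> real" where
  "truncated_second_moment G b \<equiv> \<integral>y. y\<^sup>2 * indicator {y. \<bar>y\<bar> \<le> b} y \<partial>G"

lemma set_nn_integral_has_integral:
  fixes f :: "real \<Rightarrow> real"
  assumes "\<And>x. x \<in> A \<Longrightarrow> 0 \<le> f x" and "(f has_integral I) A"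
  shows "(\<integral>\<^sup>+x\<in>A. ennreal (f x) \<partial>lborel) = ennreal I"
proof -
  have "(\<integral>\<^sup>+x\<in>A. ennreal (f x) \<partial>lborel) = (\<integral>\<^sup>+x. ennreal (indicator A x * f x) \<partial>lborel)"
    by (intro nn_integral_cong) (auto split: split_indicator)
  then show ?thesis using nn_integral_has_integral_lebesgue[OF assms] by simp
qed

lemma (in pair_prob_space) prob_Times:
  assumes "A \<in> sets M1" "B \<in> sets M2"
  shows "measure (M1 \<Otimes>\<^sub>M M2) (A \<times> B) = measure M1 A * measure M2 B"
  using assms by (simp add: measure_def M2.emeasure_pair_measure_Times enn2real_mult)

text \<open>
  Integrating \<open>1 - cos (s * y)\<close> over \<open>0 \<le> s \<le> u\<close> gives \<open>u - sin (u * y) / y\<close>, which is at least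
  \<open>u / 2\<close> as soon as \<open>\<bar>y\<bar> \<ge> 2 / u\<close>.
\<close>
lemma (in real_distribution) tail_le_char_bound:
  assumes u: "0 < u" and K: "\<And>s. 0 < s \<Longrightarrow> s \<le> u \<Longrightarrow> 1 - Re (char M s) \<le> K"
  shows "abs_tail M (2 / u) \<le> 2 * K"
proof -
  interpret pair_sigma_finite M lborel ..
  have re: "1 - Re (char M s) = (\<integral>y. 1 - cos (s * y) \<partial>M)" for s
  proof -
    have ic: "complex_integrable M (\<lambda>y. iexp (s * y))" by (intro integrable_iexp) auto
    have "Re (char M s) = (\<integral>y. Re (iexp (s * y)) \<partial>M)"
      unfolding char_def by (rule integral_Re[symmetric, OF ic])
    moreover have "integrable M (\<lambda>y. cos (s * y))"
      by (rule integrable_const_bound[where B=1]) auto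
    ultimately show ?thesis using prob_space by (simp add: Re_exp)
  qed
  have nn: "(\<integral>\<^sup>+y. ennreal (1 - cos (s * y)) \<partial>M) = ennreal (1 - Re (char M s))" for s
    unfolding re by (intro nn_integral_eq_integral integrable_const_bound[where B=2])
      (auto intro: order_trans[OF abs_triangle_ineq4] add_mono[of _ 1 _ 1, simplified])
  have K0: "0 \<le> K"
  proof -
    have "Re (char M u) \<le> 1" using complex_Re_le_cmod[of "char M u"] cmod_char_le_1[of u] by linarith
    then show ?thesis using K[of u] u by auto
  qed
  have K': "1 - Re (char M s) \<le> K" if "s \<in> {0..u}" for s
    using K[of s] that K0 by (cases "s = 0") (auto simp: char_zero)
  have inner: "ennreal (u / 2) * indicator {y. 2 / u \<le> \<bar>y\<bar>} y \<le> (\<integral>\<^sup>+s. ennreal (1 - cos (s * y)) * indicator {0..u} s \<partial>lborel)" for y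
  proof (cases "2 / u \<le> \<bar>y\<bar>")
    case True
    then have y0: "y \<noteq> 0" using u by auto
    have "(\<integral>\<^sup>+s. ennreal (1 - cos (s * y)) * indicator {0..u} s \<partial>lborel) = ennreal ((u - sin (u * y) / y) - (0 - sin (0 * y) / y))"
      using u y0 by (intro nn_integral_FTC_Icc) (auto intro!: derivative_eq_intros)
    also have "\<dots> \<ge> ennreal (u / 2)"
    proof (intro ennreal_leI)
      have "sin (u * y) / y \<le> \<bar>sin (u * y)\<bar> / \<bar>y\<bar>" by (metis abs_divide abs_ge_self)
      also have "\<dots> \<le> 1 / \<bar>y\<bar>" by (intro divide_right_mono) auto
      also have "\<dots> \<le> u / 2" using True u y0 by (simp add: field_simps)
      finally show "u / 2 \<le> (u - sin (u * y) / y) - (0 - sin (0 * y) / y)" by simp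
    qed
    finally show ?thesis using True by simp
  qed simp
  have "ennreal (u / 2 * abs_tail M (2 / u)) = (\<integral>\<^sup>+y. ennreal (u / 2) * indicator {y. 2 / u \<le> \<bar>y\<bar>} y \<partial>M)"
    using u by (subst nn_integral_cmult_indicator) (auto simp: emeasure_eq_measure ennreal_mult[symmetric])
  also have "\<dots> \<le> (\<integral>\<^sup>+y. (\<integral>\<^sup>+s. ennreal (1 - cos (s * y)) * indicator {0..u} s \<partial>lborel) \<partial>M)"
    by (intro nn_integral_mono inner)
  also have "\<dots> = (\<integral>\<^sup>+s. (\<integral>\<^sup>+y. ennreal (1 - cos (s * y)) * indicator {0..u} s \<partial>M) \<partial>lborel)"
    by (rule Fubini'[symmetric]) measurable
  also have "\<dots> \<le> (\<integral>\<^sup>+s. ennreal K * indicator {0..u} s \<partial>lborel)"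
    by (intro nn_integral_mono) (auto simp: nn_integral_multc nn intro!: ennreal_leI K' split: split_indicator)
  also have "\<dots> = ennreal (K * u)"
    using u K0 by (subst nn_integral_cmult_indicator) (auto simp: ennreal_mult)
  finally have "u / 2 * abs_tail M (2 / u) \<le> K * u"
    using K0 u by (subst (asm) ennreal_le_iff) auto
  then show ?thesis using u by (simp add: field_simps)
qed

text \<open>
  The law of the difference of two independent copies. Its characteristic function is the squared
  modulus of the original one, so it does not see the centering.
\<close>
definition symmetrisation :: "real measure \<Rightarrow> real measure" where
  "symmetrisation G = distr (G \<Otimes>\<^sub>M G) borel (\<lambda>(x, y). x - y)"

context real_distribution
begin

lemma real_distribution_symmetrisation: "real_distribution (symmetrisation M)"
proof -
  interpret P: pair_prob_space M M ..
  show ?thesis unfolding symmetrisation_def by (rule P.real_distribution_distr) measurable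
qed

lemma char_symmetrisation: "char (symmetrisation M) t = complex_of_real ((cmod (char M t))\<^sup>2)"
proof -
  interpret P: pair_prob_space M M ..
  have int: "complex_integrable (M \<Otimes>\<^sub>M M) (\<lambda>(x, y). iexp (t * x) * iexp (- (t * y)))"
    by (rule P.integrable_const_bound[where B=1]) (auto simp: norm_mult simp del: of_real_mult of_real_minus)
  have "char (symmetrisation M) t = (CLINT z|M \<Otimes>\<^sub>M M. (case z of (x, y) \<Rightarrow> iexp (t * x) * iexp (- (t * y))))"
    unfolding char_def symmetrisation_def
    by (subst integral_distr) (auto intro!: Bochner_Integration.integral_cong simp: exp_add[symmetric] algebra_simps)
  also have "\<dots> = (CLINT x|M. (CLINT y|M. iexp (t * x) * iexp (- (t * y))))"
    using P.integral_fst'[OF int] by simp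
  also have "\<dots> = char M t * (CLINT y|M. iexp (- (t * y)))"
    unfolding char_def by (simp del: of_real_mult of_real_minus)
  also have "(CLINT y|M. iexp (- (t * y))) = (CLINT y|M. cnj (iexp (t * y)))"
    by (simp add: exp_cnj del: integral_cnj)
  also have "\<dots> = cnj (char M t)"
    unfolding char_def by simp
  finally show ?thesis using complex_norm_square[of "char M t"] by simp
qed

text \<open>
  A difference of size \<open>t\<close> needs one of its terms to be of size \<open>t / 2\<close>.
\<close>
lemma tail_symmetrisation_le:
  "abs_tail (symmetrisation M) t \<le> 2 * abs_tail M (t / 2)"
proof -
  interpret P: pair_prob_space M M ..
  have "abs_tail (symmetrisation M) t = measure (M \<Otimes>\<^sub>M M) {z \<in> space (M \<Otimes>\<^sub>M M). t \<le> \<bar>fst z - snd z\<bar>}"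
    unfolding symmetrisation_def by (subst measure_distr) (auto intro!: arg_cong2[where f=measure] simp: vimage_def)
  also have "\<dots> \<le> measure (M \<Otimes>\<^sub>M M) ({y. t / 2 \<le> \<bar>y\<bar>} \<times> UNIV \<union> UNIV \<times> {y. t / 2 \<le> \<bar>y\<bar>})"
  proof (rule P.finite_measure_mono)
    show "{z \<in> space (M \<Otimes>\<^sub>M M). t \<le> \<bar>fst z - snd z\<bar>} \<subseteq> {y. t / 2 \<le> \<bar>y\<bar>} \<times> UNIV \<union> UNIV \<times> {y. t / 2 \<le> \<bar>y\<bar>}"
      using abs_triangle_ineq4 by (auto simp: abs_if split: if_splits)
  qed auto
  also have "\<dots> \<le> measure (M \<Otimes>\<^sub>M M) ({y. t / 2 \<le> \<bar>y\<bar>} \<times> UNIV) + measure (M \<Otimes>\<^sub>M M) (UNIV \<times> {y. t / 2 \<le> \<bar>y\<bar>})"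
    by (rule measure_Un_le) auto
  also have "\<dots> = 2 * abs_tail M (t / 2)"
    using prob_space by (simp add: P.prob_Times)
  finally show ?thesis .
qed

text \<open>
  The difference is large when the first term is large and the second one is moderate.
\<close>
lemma tail_symmetrisation_ge:
  "abs_tail M (2 * t) * measure M {y. \<bar>y\<bar> \<le> t} \<le> abs_tail (symmetrisation M) t"
proof -
  interpret P: pair_prob_space M M ..
  have "abs_tail M (2 * t) * measure M {y. \<bar>y\<bar> \<le> t} = measure (M \<Otimes>\<^sub>M M) ({y. 2 * t \<le> \<bar>y\<bar>} \<times> {y. \<bar>y\<bar> \<le> t})"
    by (subst P.prob_Times) auto
  also have "\<dots> \<le> measure (M \<Otimes>\<^sub>M M) {z \<in> space (M \<Otimes>\<^sub>M M). t \<le> \<bar>fst z - snd z\<bar>}"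
  proof (rule P.finite_measure_mono)
    show "{z \<in> space (M \<Otimes>\<^sub>M M). t \<le> \<bar>fst z - snd z\<bar>} \<in> sets (M \<Otimes>\<^sub>M M)" by measurable
  qed (auto simp: space_pair_measure)
  also have "\<dots> = abs_tail (symmetrisation M) t"
    unfolding symmetrisation_def by (subst measure_distr) (auto intro!: arg_cong2[where f=measure] simp: vimage_def)
  finally show ?thesis .
qed

lemma eventually_central_mass: "\<forall>\<^sub>F t in at_top. 1 / 2 \<le> measure M {y. \<bar>y\<bar> \<le> t}"
proof -
  have "(\<lambda>n. measure M {y. \<bar>y\<bar> \<le> real n}) \<longlonglongrightarrow> measure M (\<Union>n. {y. \<bar>y\<bar> \<le> real n})"
    by (rule finite_Lim_measure_incseq) (auto simp: incseq_def)
  also have "(\<Union>n. {y::real. \<bar>y\<bar> \<le> real n}) = UNIV" using real_arch_simple by auto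
  finally have "(\<lambda>n. measure M {y. \<bar>y\<bar> \<le> real n}) \<longlonglongrightarrow> 1" using prob_space by simp
  then have "\<forall>\<^sub>F n in sequentially. 1 / 2 < measure M {y. \<bar>y\<bar> \<le> real n}"
    by (rule order_tendstoD) simp
  then obtain n where n: "1 / 2 < measure M {y. \<bar>y\<bar> \<le> real n}"
    by (auto simp: eventually_sequentially)
  show ?thesis
  proof (rule eventually_mono[OF eventually_ge_at_top[of "real n"]])
    fix t assume "real n \<le> t"
    then have "measure M {y. \<bar>y\<bar> \<le> real n} \<le> measure M {y. \<bar>y\<bar> \<le> t}"
      by (intro finite_measure_mono) auto
    then show "1 / 2 \<le> measure M {y. \<bar>y\<bar> \<le> t}" using n by simp
  qed
qed

text \<open>
  The layer-cake formula: \<open>\<bar>y\<bar> powr p\<close> is the integral of \<open>p * u powr (p - 1)\<close> over \<open>u \<le> \<bar>y\<bar>\<close>,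
  so the truncated moment is at most the integral over \<open>u \<le> b\<close> of this weight times the tail at
  \<open>u\<close>.
\<close>
lemma truncated_moment_le:
  assumes C: "0 \<le> C" and tail: "\<And>x. 0 < x \<Longrightarrow> abs_tail M x \<le> C * x powr - \<alpha>"
    and p: "0 < p" "\<alpha> < p" and b: "0 < b"
  shows "(\<integral>y. \<bar>y\<bar> powr p * indicator {y. \<bar>y\<bar> \<le> b} y \<partial>M) \<le> p * C / (p - \<alpha>) * b powr (p - \<alpha>)"
proof -
  interpret P: pair_sigma_finite M lborel ..
  have layer: "ennreal (\<bar>y\<bar> powr p) = (\<integral>\<^sup>+u. ennreal (p * u powr (p - 1)) * indicator {0..\<bar>y\<bar>} u \<partial>lborel)" for y :: real
  proof -
    have "((\<lambda>u. p * u powr (p - 1)) has_integral p * (\<bar>y\<bar> powr (p - 1 + 1) / (p - 1 + 1))) {0..\<bar>y\<bar>}"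
      using p by (intro has_integral_mult_right has_integral_powr_from_0) auto
    then show ?thesis using p
      by (subst set_nn_integral_has_integral) auto
  qed
  have "ennreal (\<integral>y. \<bar>y\<bar> powr p * indicator {y. \<bar>y\<bar> \<le> b} y \<partial>M) = (\<integral>\<^sup>+y. ennreal (\<bar>y\<bar> powr p * indicator {y. \<bar>y\<bar> \<le> b} y) \<partial>M)"
    using p b by (intro nn_integral_eq_integral[symmetric] integrable_const_bound[where B="b powr p"])
      (auto split: split_indicator intro!: powr_mono2)
  also have "\<dots> \<le> (\<integral>\<^sup>+y. (\<integral>\<^sup>+u. ennreal (p * u powr (p - 1)) * indicator {0..b} u * indicator {y. u \<le> \<bar>y\<bar>} y \<partial>lborel) \<partial>M)"
  proof (intro nn_integral_mono)
    fix y
    show "ennreal (\<bar>y\<bar> powr p * indicator {y. \<bar>y\<bar> \<le> b} y) \<le> (\<integral>\<^sup>+u. ennreal (p * u powr (p - 1)) * indicator {0..b} u * indicator {y. u \<le> \<bar>y\<bar>} y \<partial>lborel)"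
      by (cases "\<bar>y\<bar> \<le> b") (auto simp: layer intro!: nn_integral_mono split: split_indicator)
  qed
  also have "\<dots> = (\<integral>\<^sup>+u. (\<integral>\<^sup>+y. ennreal (p * u powr (p - 1)) * indicator {0..b} u * indicator {y. u \<le> \<bar>y\<bar>} y \<partial>M) \<partial>lborel)"
    by (rule P.Fubini'[symmetric]) measurable
  also have "\<dots> = (\<integral>\<^sup>+u. ennreal (p * u powr (p - 1)) * indicator {0..b} u * emeasure M {y. u \<le> \<bar>y\<bar>} \<partial>lborel)"
  proof (intro nn_integral_cong)
    fix u :: real
    show "(\<integral>\<^sup>+y. ennreal (p * u powr (p - 1)) * indicator {0..b} u * indicator {y. u \<le> \<bar>y\<bar>} y \<partial>M)
      = ennreal (p * u powr (p - 1)) * indicator {0..b} u * emeasure M {y. u \<le> \<bar>y\<bar>}"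
      by (simp add: nn_integral_cmult_indicator)
  qed
  also have "\<dots> \<le> (\<integral>\<^sup>+u. ennreal (p * C * u powr (p - 1 - \<alpha>)) * indicator {0..b} u \<partial>lborel)"
  proof (intro nn_integral_mono)
    fix u :: real
    show "ennreal (p * u powr (p - 1)) * indicator {0..b} u * emeasure M {y. u \<le> \<bar>y\<bar>} \<le> ennreal (p * C * u powr (p - 1 - \<alpha>)) * indicator {0..b} u"
    proof (cases "0 < u \<and> u \<le> b")
      case True
      have "ennreal (p * u powr (p - 1)) * emeasure M {y. u \<le> \<bar>y\<bar>} = ennreal (p * u powr (p - 1) * abs_tail M u)"
        using p by (simp add: emeasure_eq_measure ennreal_mult)
      also have "\<dots> \<le> ennreal (p * u powr (p - 1) * (C * u powr - \<alpha>))"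
        using p True by (intro ennreal_leI mult_left_mono tail) auto
      also have "p * u powr (p - 1) * (C * u powr - \<alpha>) = p * C * u powr (p - 1 - \<alpha>)"
        by (simp add: powr_add[symmetric])
      finally show ?thesis using True by simp
    qed (auto split: split_indicator)
  qed
  also have "\<dots> = ennreal (p * C * (b powr (p - 1 - \<alpha> + 1) / (p - 1 - \<alpha> + 1)))"
  proof -
    have "((\<lambda>u. p * C * u powr (p - 1 - \<alpha>)) has_integral p * C * (b powr (p - 1 - \<alpha> + 1) / (p - 1 - \<alpha> + 1))) {0..b}"
      using p b by (intro has_integral_mult_right has_integral_powr_from_0) auto
    then show ?thesis using p C
      by (subst set_nn_integral_has_integral) auto
  qed
  also have "p * C * (b powr (p - 1 - \<alpha> + 1) / (p - 1 - \<alpha> + 1)) = p * C / (p - \<alpha>) * b powr (p - \<alpha>)"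
    by (simp add: algebra_simps)
  finally show ?thesis
    using p C by (subst (asm) ennreal_le_iff) auto
qed

text \<open>
  The same layer-cake argument with weight one: a point with \<open>\<bar>y\<bar> \<ge> b\<close> lies beyond \<open>max b u\<close>
  for every \<open>u \<le> \<bar>y\<bar>\<close>.
\<close>
lemma tail_moment_le:
  assumes C: "0 \<le> C" and tail: "\<And>x. 0 < x \<Longrightarrow> abs_tail M x \<le> C * x powr - \<alpha>"
    and \<alpha>: "1 < \<alpha>" and b: "0 < b"
  shows "(\<integral>\<^sup>+y. ennreal (\<bar>y\<bar> * indicator {y. b \<le> \<bar>y\<bar>} y) \<partial>M) \<le> ennreal (\<alpha> * C / (\<alpha> - 1) * b powr (1 - \<alpha>))"
proof -
  interpret P: pair_sigma_finite M lborel ..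
  have "(\<integral>\<^sup>+y. ennreal (\<bar>y\<bar> * indicator {y. b \<le> \<bar>y\<bar>} y) \<partial>M) \<le> (\<integral>\<^sup>+y. (\<integral>\<^sup>+u. indicator {0..} u * indicator {y. max b u \<le> \<bar>y\<bar>} y \<partial>lborel) \<partial>M)"
  proof (intro nn_integral_mono)
    fix y
    have "(\<integral>\<^sup>+u. indicator {0..\<bar>y\<bar>} u \<partial>lborel) = ennreal \<bar>y\<bar>" by simp
    then show "ennreal (\<bar>y\<bar> * indicator {y. b \<le> \<bar>y\<bar>} y) \<le> (\<integral>\<^sup>+u. indicator {0..} u * indicator {y. max b u \<le> \<bar>y\<bar>} y \<partial>lborel)"
      by (cases "b \<le> \<bar>y\<bar>") (auto simp del: nn_integral_indicator intro!: nn_integral_mono split: split_indicator elim!: subst)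
  qed
  also have "\<dots> = (\<integral>\<^sup>+u. (\<integral>\<^sup>+y. indicator {0..} u * indicator {y. max b u \<le> \<bar>y\<bar>} y \<partial>M) \<partial>lborel)"
    by (rule P.Fubini'[symmetric]) measurable
  also have "\<dots> = (\<integral>\<^sup>+u. indicator {0..} u * emeasure M {y. max b u \<le> \<bar>y\<bar>} \<partial>lborel)"
  proof (intro nn_integral_cong)
    fix u :: real
    show "(\<integral>\<^sup>+y. indicator {0..} u * indicator {y. max b u \<le> \<bar>y\<bar>} y \<partial>M)
      = indicator {0..} u * emeasure M {y. max b u \<le> \<bar>y\<bar>}"
      by (simp add: nn_integral_cmult_indicator del: max.bounded_iff)
  qed
  also have "\<dots> \<le> (\<integral>\<^sup>+u. ennreal (C * b powr - \<alpha>) * indicator {0..b} u + ennreal (C * u powr - \<alpha>) * indicator {b..} u \<partial>lborel)"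
  proof (intro nn_integral_mono)
    fix u :: real
    have "emeasure M {y. max b u \<le> \<bar>y\<bar>} \<le> ennreal (C * (max b u) powr - \<alpha>)"
      unfolding emeasure_eq_measure using b by (intro ennreal_leI tail) auto
    then show "indicator {0..} u * emeasure M {y. max b u \<le> \<bar>y\<bar>} \<le> ennreal (C * b powr - \<alpha>) * indicator {0..b} u + ennreal (C * u powr - \<alpha>) * indicator {b..} u"
      using b by (cases "u \<le> b") (auto split: split_indicator simp: max_def intro: order_trans)
  qed
  also have "\<dots> = (\<integral>\<^sup>+u. ennreal (C * b powr - \<alpha>) * indicator {0..b} u \<partial>lborel) + (\<integral>\<^sup>+u. ennreal (C * u powr - \<alpha>) * indicator {b..} u \<partial>lborel)"
    by (rule nn_integral_add) auto
  also have "(\<integral>\<^sup>+u. ennreal (C * b powr - \<alpha>) * indicator {0..b} u \<partial>lborel) = ennreal (C * b powr - \<alpha> * b)"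
    using b C by (subst nn_integral_cmult_indicator) (auto simp: ennreal_mult)
  also have "(\<integral>\<^sup>+u. ennreal (C * u powr - \<alpha>) * indicator {b..} u \<partial>lborel) = ennreal (C * (- (b powr (- \<alpha> + 1)) / (- \<alpha> + 1)))"
  proof -
    have "((\<lambda>u. C * u powr - \<alpha>) has_integral C * (- (b powr (- \<alpha> + 1)) / (- \<alpha> + 1))) {b..}"
      using \<alpha> b by (intro has_integral_mult_right has_integral_powr_to_inf) auto
    then show ?thesis using C
      by (subst set_nn_integral_has_integral) auto
  qed
  also have "ennreal (C * b powr - \<alpha> * b) + ennreal (C * (- (b powr (- \<alpha> + 1)) / (- \<alpha> + 1))) = ennreal (\<alpha> * C / (\<alpha> - 1) * b powr (1 - \<alpha>))"
  proof -
    have e: "b powr - \<alpha> * b = b powr (1 - \<alpha>)" using b by (simp add: powr_diff powr_minus field_simps)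
    have "C * (- (b powr (- \<alpha> + 1)) / (- \<alpha> + 1)) = C * b powr (1 - \<alpha>) / (\<alpha> - 1)"
      using \<alpha> by (simp add: field_simps)
    moreover have "C * b powr - \<alpha> * b + C * b powr (1 - \<alpha>) / (\<alpha> - 1) = \<alpha> * C / (\<alpha> - 1) * b powr (1 - \<alpha>)"
      using \<alpha> by (simp add: mult.assoc e) (simp add: field_simps)
    ultimately show ?thesis using C \<alpha> b by (subst ennreal_plus[symmetric]) auto
  qed
  finally show ?thesis .
qed

end

section \<open>Laws in a domain of normal attraction\<close>

context real_distribution
begin

lemma truncated_second_moment_le:
  assumes "0 \<le> C" and "\<And>x. 0 < x \<Longrightarrow> abs_tail M x \<le> C * x powr - \<alpha>"
    and "\<alpha> < 2" and "0 < b"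
  shows "truncated_second_moment M b \<le> 2 * C / (2 - \<alpha>) * b powr (2 - \<alpha>)"
  using truncated_moment_le[OF assms(1,2) _ assms(3,4)] by simp

lemma integrable_truncated [simp]:
  "integrable M (\<lambda>y. y\<^sup>2 * indicator {y. \<bar>y\<bar> \<le> b} y)"
  "integrable M (\<lambda>y. y * indicator {y. \<bar>y\<bar> \<le> b} y)"
proof -
  show "integrable M (\<lambda>y. y\<^sup>2 * indicator {y. \<bar>y\<bar> \<le> b} y)"
    by (rule integrable_const_bound[where B="b\<^sup>2"])
      (auto simp: abs_le_square_iff[symmetric] split: split_indicator)
  show "integrable M (\<lambda>y. y * indicator {y. \<bar>y\<bar> \<le> b} y)"
    by (rule integrable_const_bound[where B="\<bar>b\<bar>"]) (auto split: split_indicator)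
qed

lemma integrable_abs_indicator:
  assumes "integrable M (\<lambda>y. y)"
  shows "integrable M (\<lambda>y. \<bar>y\<bar> * indicator {y. b \<le> \<bar>y\<bar>} y)"
  by (rule Bochner_Integration.integrable_bound[OF assms]) (auto split: split_indicator)

end

text \<open>
  What the upper estimates need to know about a law of index \<open>\<alpha>\<close>: its tail, its truncated second
  moment and its truncated mean have at most the order of magnitude of the stable law, with a logarithm in the
  truncated mean for \<open>\<alpha> = 1\<close>, where the two tails may be balanced only approximately.
\<close>
definition stable_type_bounds :: "real measure \<Rightarrow> real \<Rightarrow> real \<Rightarrow> bool" where
  "stable_type_bounds G \<alpha> C \<longleftrightarrow> 1 \<le> C \<and>
    (\<forall>x>0. abs_tail G x \<le> C * x powr - \<alpha>) \<and>
    (\<forall>b>0. truncated_second_moment G b \<le> C * b powr (2 - \<alpha>)) \<and>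
    (\<forall>b>0. \<alpha> \<noteq> 1 \<longrightarrow> \<bar>truncated_mean G b\<bar> \<le> C * b powr (1 - \<alpha>)) \<and>
    (\<forall>b\<ge>exp 1. \<alpha> = 1 \<longrightarrow> \<bar>truncated_mean G b\<bar> \<le> C * ln b)"

context
  fixes G :: "real measure" and d :: "nat \<Rightarrow> real" and \<alpha> l :: real
  assumes attr: "normal_attraction G d \<alpha> l" and \<alpha>: "0 < \<alpha>" "\<alpha> < 2" and l: "0 < l"
begin

interpretation G: real_distribution G
  using attr by (simp add: normal_attraction_def)

text \<open>
  The bound on the characteristic function controls the tail of the symmetrised law, and the
  symmetrised law controls \<open>G\<close> because \<open>G\<close> puts at least half of its mass near the origin.
\<close>
lemma attraction_tail_upper:
  obtains C where "1 \<le> C" "\<And>x. 0 < x \<Longrightarrow> abs_tail G x \<le> C * x powr - \<alpha>"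
proof -
  interpret H: real_distribution "symmetrisation G" by (rule G.real_distribution_symmetrisation)
  obtain c s0 where s0: "0 < s0" and
    up: "\<And>s. 0 < s \<Longrightarrow> s \<le> s0 \<Longrightarrow> 1 - (cmod (char G s))\<^sup>2 \<le> 4 * l * s powr \<alpha>"
    using char_modulus_bounds[OF attr \<alpha> l] by metis
  obtain t1 where t1: "\<And>t. t1 \<le> t \<Longrightarrow> 1 / 2 \<le> measure G {y. \<bar>y\<bar> \<le> t}"
    using G.eventually_central_mass by (auto simp: eventually_at_top_linorder)
  define x1 where "x1 = max 1 (max (2 * t1) (4 / s0))"
  define C where "C = max (x1 powr \<alpha>) (16 * l * 4 powr \<alpha>)"
  have x1: "1 \<le> x1" "2 * t1 \<le> x1" "4 / s0 \<le> x1" by (auto simp: x1_def)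
  show ?thesis
  proof
    have "1 \<le> x1 powr \<alpha>" using x1 \<alpha> by (simp add: ge_one_powr_ge_zero)
    then show "1 \<le> C" by (simp add: C_def)
    fix x :: real assume x: "0 < x"
    show "abs_tail G x \<le> C * x powr - \<alpha>"
    proof (cases "x \<le> x1")
      case True
      have "abs_tail G x \<le> 1" by simp
      also have "1 = x powr \<alpha> * x powr - \<alpha>" using x by (simp add: powr_minus)
      also have "\<dots> \<le> C * x powr - \<alpha>"
        using True x \<alpha> by (intro mult_right_mono) (auto simp: C_def intro!: max.coboundedI1 powr_mono2)
      finally show ?thesis .
    next
      case False
      define u where "u = 4 / x"
      have "4 / s0 \<le> x" using False x1 by linarith
      then have u: "0 < u" "u \<le> s0" using x s0 by (auto simp: u_def field_simps)
      have "abs_tail G x * (1 / 2) \<le> abs_tail G (2 * (x / 2)) * measure G {y. \<bar>y\<bar> \<le> x / 2}"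
      proof -
        have "1 / 2 \<le> measure G {y. \<bar>y\<bar> \<le> x / 2}" using False x1 by (intro t1) auto
        then have "abs_tail G x * (1 / 2) \<le> abs_tail G x * measure G {y. \<bar>y\<bar> \<le> x / 2}"
          by (rule mult_left_mono) simp
        then show ?thesis by simp
      qed
      also have "\<dots> \<le> abs_tail (symmetrisation G) (x / 2)"
        by (rule G.tail_symmetrisation_ge)
      also have "x / 2 = 2 / u" by (simp add: u_def)
      also have "abs_tail (symmetrisation G) (2 / u) \<le> 2 * (4 * l * u powr \<alpha>)"
      proof (rule H.tail_le_char_bound[OF u(1)])
        fix s assume s: "0 < s" "s \<le> u"
        then have "1 - (cmod (char G s))\<^sup>2 \<le> 4 * l * s powr \<alpha>" using u by (intro up) auto
        also have "\<dots> \<le> 4 * l * u powr \<alpha>" using s l \<alpha> by (intro mult_left_mono powr_mono2) auto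
        finally show "1 - Re (char (symmetrisation G) s) \<le> 4 * l * u powr \<alpha>"
          by (simp add: G.char_symmetrisation)
      qed
      also have "u powr \<alpha> = 4 powr \<alpha> * x powr - \<alpha>"
        using x by (simp add: u_def powr_divide powr_minus field_simps)
      finally have "abs_tail G x \<le> (16 * l * 4 powr \<alpha>) * x powr - \<alpha>" by simp
      also have "\<dots> \<le> C * x powr - \<alpha>" by (intro mult_right_mono) (auto simp: C_def)
      finally show ?thesis .
    qed
  qed
qed

text \<open>
  The lower bound on \<open>1 - \<bar>char G s\<bar>\<^sup>2\<close> has to come from somewhere: the points with
  \<open>\<bar>y\<bar> \<le> \<delta> / s\<close> contribute at most a multiple of \<open>\<delta> powr (2 - \<alpha>) * s powr \<alpha>\<close>, by the upper tail
  bound and \<open>\<alpha> < 2\<close>, so for small \<open>\<delta>\<close> the tail beyond \<open>\<delta> / s\<close> has to supply the rest.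
\<close>
lemma attraction_tail_lower:
  obtains c x0 where "0 < c" "\<And>x. x0 \<le> x \<Longrightarrow> c * x powr - \<alpha> \<le> abs_tail G x"
proof -
  interpret H: real_distribution "symmetrisation G" by (rule G.real_distribution_symmetrisation)
  let ?H = "symmetrisation G"
  obtain c s0 where c: "0 < c" and s0: "0 < s0" and
    low: "\<And>s. 0 < s \<Longrightarrow> s \<le> s0 \<Longrightarrow> c * s powr \<alpha> \<le> 1 - (cmod (char G s))\<^sup>2"
    using char_modulus_bounds[OF attr \<alpha> l] by metis
  obtain C where C: "1 \<le> C" and up: "\<And>x. 0 < x \<Longrightarrow> abs_tail G x \<le> C * x powr - \<alpha>"
    using attraction_tail_upper by metis
  define CH where "CH = 2 * C * 2 powr \<alpha>"
  have CH: "0 < CH" using C by (simp add: CH_def)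
  have upH: "abs_tail ?H x \<le> CH * x powr - \<alpha>" if "0 < x" for x
  proof -
    have "abs_tail ?H x \<le> 2 * abs_tail G (x / 2)"
      by (rule G.tail_symmetrisation_le)
    also have "\<dots> \<le> 2 * (C * (x / 2) powr - \<alpha>)" using that by (intro mult_left_mono up) auto
    also have "(x / 2) powr - \<alpha> = 2 powr \<alpha> * x powr - \<alpha>"
      using that by (simp add: powr_divide powr_minus field_simps)
    finally show ?thesis by (simp add: CH_def)
  qed
  define K where "K = 2 * CH / (2 - \<alpha>)"
  have K: "0 < K" using CH \<alpha> by (simp add: K_def)
  \<comment> \<open>The choice makes the part below \<open>\<delta> / s\<close> account for at most half of the lower bound.\<close>
  define \<delta> where "\<delta> = (c / K) powr (1 / (2 - \<alpha>))"
  have \<delta>: "0 < \<delta>" using c K by (simp add: \<delta>_def)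
  have \<delta>p: "K * \<delta> powr (2 - \<alpha>) = c" using c K \<alpha> by (simp add: \<delta>_def powr_powr)
  have main: "c / 4 * s powr \<alpha> \<le> abs_tail ?H (\<delta> / s)" if s: "0 < s" "s \<le> s0" for s
  proof -
    have ic: "integrable ?H (\<lambda>y. cos (s * y))" by (rule H.integrable_const_bound[where B=1]) auto
    have "complex_integrable ?H (\<lambda>y. iexp (s * y))" by (intro H.integrable_iexp) auto
    then have "Re (char ?H s) = (\<integral>y. Re (iexp (s * y)) \<partial>?H)"
      unfolding char_def by (rule integral_Re[symmetric])
    then have "1 - (cmod (char G s))\<^sup>2 = (\<integral>y. 1 - cos (s * y) \<partial>?H)"
      using H.prob_space ic by (simp add: G.char_symmetrisation Re_exp)
    also have "\<dots> \<le> (\<integral>y. s\<^sup>2 / 2 * (y\<^sup>2 * indicator {y. \<bar>y\<bar> \<le> \<delta> / s} y) + 2 * indicator {y. \<delta> / s \<le> \<bar>y\<bar>} y \<partial>?H)"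
    proof (rule integral_mono)
      fix y :: real
      have "1 - cos (s * y) = 2 * (sin (s * y / 2))\<^sup>2" using cos_double_sin[of "s * y / 2"] by simp
      also have "\<dots> \<le> 2 * (s * y / 2)\<^sup>2"
        using iffD1[OF abs_le_square_iff abs_sin_x_le_abs_x[of "s * y / 2"]] by (intro mult_left_mono) auto
      finally have 1: "1 - cos (s * y) \<le> s\<^sup>2 / 2 * y\<^sup>2" by (simp add: power_mult_distrib power_divide)
      have 2: "1 - cos (s * y) \<le> 2" using cos_ge_minus_one[of "s * y"] by linarith
      show "1 - cos (s * y) \<le> s\<^sup>2 / 2 * (y\<^sup>2 * indicator {y. \<bar>y\<bar> \<le> \<delta> / s} y) + 2 * indicator {y. \<delta> / s \<le> \<bar>y\<bar>} y"
        using 1 2 by (auto split: split_indicator)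
    qed (use ic in \<open>auto simp: H.emeasure_eq_measure\<close>)
    also have "\<dots> = s\<^sup>2 / 2 * truncated_second_moment ?H (\<delta> / s) + 2 * abs_tail ?H (\<delta> / s)"
      by (subst Bochner_Integration.integral_add) (auto simp: H.emeasure_eq_measure)
    also have "\<dots> \<le> s\<^sup>2 / 2 * (K * (\<delta> / s) powr (2 - \<alpha>)) + 2 * abs_tail ?H (\<delta> / s)"
      unfolding K_def using s \<delta> CH \<alpha> upH
      by (intro add_right_mono mult_left_mono H.truncated_second_moment_le) auto
    also have "s\<^sup>2 / 2 * (K * (\<delta> / s) powr (2 - \<alpha>)) = (K * \<delta> powr (2 - \<alpha>)) / 2 * s powr \<alpha>"
      using s \<delta> by (simp add: powr_divide powr_diff)
    finally have "c * s powr \<alpha> \<le> c / 2 * s powr \<alpha> + 2 * abs_tail ?H (\<delta> / s)"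
      using low[OF s] by (simp add: \<delta>p)
    then show ?thesis by simp
  qed
  show ?thesis
  proof
    show "0 < c / 8 * (\<delta> / 2) powr \<alpha>" using c \<delta> by simp
    fix x assume x: "\<delta> / (2 * s0) \<le> x"
    have "0 < \<delta> / (2 * s0)" using \<delta> s0 by simp
    with x have x0: "0 < x" by linarith
    define s where "s = \<delta> / (2 * x)"
    have s: "0 < s" "s \<le> s0" using x x0 \<delta> s0 by (auto simp: s_def field_simps)
    have "c / 4 * s powr \<alpha> \<le> abs_tail ?H (\<delta> / s)" by (rule main[OF s])
    also have "\<dots> \<le> 2 * abs_tail G (\<delta> / s / 2)" by (rule G.tail_symmetrisation_le)
    also have "\<delta> / s / 2 = x" using \<delta> x0 by (simp add: s_def)
    also have "s powr \<alpha> = (\<delta> / 2) powr \<alpha> * x powr - \<alpha>"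
      using \<delta> x0 by (simp add: s_def powr_divide powr_mult powr_minus field_simps)
    finally show "c / 8 * (\<delta> / 2) powr \<alpha> * x powr - \<alpha> \<le> abs_tail G x" by simp
  qed
qed

lemma attraction_integrable:
  assumes "1 < \<alpha>" shows "integrable G (\<lambda>y. y)"
proof (rule integrableI_bounded)
  obtain C where C: "1 \<le> C" and up: "\<And>x. 0 < x \<Longrightarrow> abs_tail G x \<le> C * x powr - \<alpha>"
    using attraction_tail_upper by metis
  have "(\<integral>\<^sup>+y. ennreal (norm y) \<partial>G) \<le> (\<integral>\<^sup>+y. ennreal 1 + ennreal (\<bar>y\<bar> * indicator {y. 1 \<le> \<bar>y\<bar>} y) \<partial>G)"
    by (intro nn_integral_mono) (auto split: split_indicator simp: ennreal_plus[symmetric] simp del: ennreal_plus ennreal_1 intro!: ennreal_leI)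
  also have "\<dots> = ennreal 1 + (\<integral>\<^sup>+y. ennreal (\<bar>y\<bar> * indicator {y. 1 \<le> \<bar>y\<bar>} y) \<partial>G)"
    by (subst nn_integral_add) (auto simp: G.emeasure_space_1[simplified])
  also have "\<dots> \<le> ennreal 1 + ennreal (\<alpha> * C / (\<alpha> - 1) * 1 powr (1 - \<alpha>))"
    using C assms up by (intro add_left_mono G.tail_moment_le) auto
  also have "\<dots> < \<infinity>" by simp
  finally show "(\<integral>\<^sup>+y. ennreal (norm y) \<partial>G) < \<infinity>" .
qed simp

text \<open>
  A mean \<open>m \<noteq> 0\<close> would make the sum of \<open>n\<close> summands drift by \<open>n * m\<close>, much more than
  \<open>n powr (1 / \<alpha>)\<close>. In terms of characteristic functions: \<open>char G s\<close> differs from \<open>exp (\<i> * s * m)\<close>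
  by at most a multiple of \<open>s powr \<alpha> + s\<^sup>2\<close>. At \<open>s = pi / (\<bar>m\<bar> * n)\<close> the \<open>n\<close>-th power of the latter is
  \<open>- 1\<close>, while \<open>s * n powr (1 / \<alpha>)\<close> tends to zero, so that the \<open>n\<close>-th power of the former tends to
  the limiting characteristic function at \<open>0\<close>, which is \<open>1\<close>.
\<close>
lemma attraction_mean_zero:
  assumes \<alpha>1: "1 < \<alpha>" and d: "\<And>n. d n = 0" shows "(\<integral>y. y \<partial>G) = 0"
proof (rule ccontr)
  define m where "m = (\<integral>y. y \<partial>G)"
  assume "(\<integral>y. y \<partial>G) \<noteq> 0"
  then have m: "m \<noteq> 0" by (simp add: m_def)
  obtain C where C: "1 \<le> C" and up: "\<And>x. 0 < x \<Longrightarrow> abs_tail G x \<le> C * x powr - \<alpha>"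
    using attraction_tail_upper by metis
  define K1 where "K1 = 2 * C / (2 - \<alpha>)"
  define K2 where "K2 = \<alpha> * C / (\<alpha> - 1)"
  note int = attraction_integrable[OF \<alpha>1]
  have tm: "(\<integral>y. \<bar>y\<bar> * indicator {y. b \<le> \<bar>y\<bar>} y \<partial>G) \<le> K2 * b powr (1 - \<alpha>)" if "0 < b" for b
  proof -
    have "ennreal (\<integral>y. \<bar>y\<bar> * indicator {y. b \<le> \<bar>y\<bar>} y \<partial>G) = (\<integral>\<^sup>+y. ennreal (\<bar>y\<bar> * indicator {y. b \<le> \<bar>y\<bar>} y) \<partial>G)"
      by (rule nn_integral_eq_integral[symmetric, OF G.integrable_abs_indicator[OF int]]) auto
    also have "\<dots> \<le> ennreal (K2 * b powr (1 - \<alpha>))"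
      unfolding K2_def using C up that \<alpha>1 by (intro G.tail_moment_le) auto
    finally show ?thesis using C \<alpha>1 by (subst (asm) ennreal_le_iff) (auto simp: K2_def)
  qed
  have approx: "cmod (char G s - (1 + \<i> * (s * m))) \<le> (K1 / 2 + 2 * K2) * s powr \<alpha>" if s: "0 < s" for s
  proof -
    have i1: "complex_integrable G (\<lambda>y. iexp (s * y))" by (intro G.integrable_iexp) auto
    have i2: "complex_integrable G (\<lambda>y. 1 + \<i> * complex_of_real (s * y))" using int by (auto simp: G.emeasure_eq_measure)
    have "char G s - (1 + \<i> * (s * m)) = (CLINT y|G. iexp (s * y) - (1 + \<i> * complex_of_real (s * y)))"
      unfolding Bochner_Integration.integral_diff[OF i1 i2] using int G.prob_space
      by (subst Bochner_Integration.integral_add) (auto simp: char_def m_def)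
    also have "cmod \<dots> \<le> (\<integral>y. cmod (iexp (s * y) - (1 + \<i> * complex_of_real (s * y))) \<partial>G)"
      by (rule integral_norm_bound)
    also have "\<dots> \<le> (\<integral>y. s\<^sup>2 / 2 * (y\<^sup>2 * indicator {y. \<bar>y\<bar> \<le> 1 / s} y) + 2 * s * (\<bar>y\<bar> * indicator {y. 1 / s \<le> \<bar>y\<bar>} y) \<partial>G)"
    proof (rule integral_mono)
      fix y :: real
      have 1: "cmod (iexp (s * y) - (1 + \<i> * complex_of_real (s * y))) \<le> s\<^sup>2 / 2 * y\<^sup>2"
        using iexp_approx1[of "s * y" 1] by (simp add: power2_abs power_mult_distrib numeral_2_eq_2[symmetric])
      have 2: "cmod (iexp (s * y) - (1 + \<i> * complex_of_real (s * y))) \<le> 2 * s * \<bar>y\<bar>"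
        using iexp_approx2[of "s * y" 1] s by (simp add: abs_mult)
      show "cmod (iexp (s * y) - (1 + \<i> * complex_of_real (s * y))) \<le> s\<^sup>2 / 2 * (y\<^sup>2 * indicator {y. \<bar>y\<bar> \<le> 1 / s} y) + 2 * s * (\<bar>y\<bar> * indicator {y. 1 / s \<le> \<bar>y\<bar>} y)"
        using 1 2 s by (auto split: split_indicator intro: add_increasing2)
    qed (use i1 i2 G.integrable_abs_indicator[OF int] in \<open>auto intro!: integrable_norm\<close>)
    also have "\<dots> = s\<^sup>2 / 2 * truncated_second_moment G (1 / s) + 2 * s * (\<integral>y. \<bar>y\<bar> * indicator {y. 1 / s \<le> \<bar>y\<bar>} y \<partial>G)"
      using G.integrable_abs_indicator[OF int] by (subst Bochner_Integration.integral_add) auto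
    also have "\<dots> \<le> s\<^sup>2 / 2 * (K1 * (1 / s) powr (2 - \<alpha>)) + 2 * s * (K2 * (1 / s) powr (1 - \<alpha>))"
      unfolding K1_def using s C up \<alpha>
      by (intro add_mono mult_left_mono tm G.truncated_second_moment_le) auto
    also have "\<dots> = (K1 / 2 + 2 * K2) * s powr \<alpha>"
      using s by (simp add: powr_divide powr_diff power2_eq_square field_simps)
    finally show ?thesis .
  qed
  define K where "K = K1 / 2 + 2 * K2"
  \<comment> \<open>With \<open>Suc n\<close> summands, this argument rotates \<open>exp (\<i> * s * m)\<close> by exactly \<open>pi\<close>.\<close>
  define s where "s = (\<lambda>n. pi / (\<bar>m\<bar> * real (Suc n)))"
  define t where "t = (\<lambda>n. s n * real (Suc n) powr (1 / \<alpha>))"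
  have s0: "0 < s n" for n using m by (simp add: s_def)
  have t0: "t \<longlonglongrightarrow> 0"
  proof -
    have "t = (\<lambda>n. pi / \<bar>m\<bar> * real (Suc n) powr (1 / \<alpha> - 1))"
      by (auto simp: t_def s_def powr_diff field_simps)
    moreover have "(\<lambda>n. real (Suc n) powr (1 / \<alpha> - 1)) \<longlonglongrightarrow> 0"
      using \<alpha>1 by (intro LIMSEQ_Suc tendsto_neg_powr filterlim_real_sequentially) auto
    ultimately show ?thesis by (simp only: tendsto_mult_right_zero)
  qed
  have rotate: "iexp (s n * m) ^ Suc n = -1" for n
  proof -
    have "iexp (s n * m) ^ Suc n = iexp (real (Suc n) * (s n * m))"
      unfolding exp_of_nat_mult[symmetric] by (simp add: algebra_simps)
    also have "real (Suc n) * (s n * m) = (if m < 0 then - pi else pi)"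
    proof -
      have "real (Suc n) * s n = pi / \<bar>m\<bar>" using m by (simp add: s_def)
      then have "real (Suc n) * (s n * m) = pi / \<bar>m\<bar> * m" by (metis mult.assoc)
      then show ?thesis using m by (simp add: abs_if)
    qed
    finally show ?thesis by (auto simp: exp_pi_i' exp_minus)
  qed
  have bound: "cmod (char G (s n) ^ Suc n - (-1)) \<le> K * t n powr \<alpha> + m\<^sup>2 * (s n * pi / \<bar>m\<bar>) / 2" for n
  proof -
    have sn: "real (Suc n) * s n = pi / \<bar>m\<bar>" using m by (simp add: s_def)
    have "cmod (char G (s n) ^ Suc n - iexp (s n * m) ^ Suc n) \<le> real (Suc n) * cmod (char G (s n) - iexp (s n * m))"
      by (intro norm_power_diff G.cmod_char_le_1) (simp del: of_real_mult)
    also have "cmod (char G (s n) - iexp (s n * m)) \<le> cmod (char G (s n) - (1 + \<i> * (s n * m))) + cmod (iexp (s n * m) - (1 + \<i> * (s n * m)))"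
      using norm_triangle_ineq4[of "char G (s n) - (1 + \<i> * (s n * m))" "iexp (s n * m) - (1 + \<i> * (s n * m))"] by simp
    also have "\<dots> \<le> K * s n powr \<alpha> + (s n * m)\<^sup>2 / 2"
      using approx[OF s0[of n]] iexp_approx1[of "s n * m" 1]
      by (intro add_mono) (simp_all add: K_def power2_abs numeral_2_eq_2[symmetric])
    also have "real (Suc n) * (K * s n powr \<alpha> + (s n * m)\<^sup>2 / 2) = K * (real (Suc n) * s n powr \<alpha>) + m\<^sup>2 * (s n * (real (Suc n) * s n)) / 2"
      by (simp add: power2_eq_square algebra_simps)
    also have "real (Suc n) * s n powr \<alpha> = t n powr \<alpha>"
      using s0[of n] \<alpha> by (simp add: t_def powr_mult powr_powr)
    also have "s n * (real (Suc n) * s n) = s n * pi / \<bar>m\<bar>" by (simp only: sn times_divide_eq_right)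
    finally show ?thesis unfolding rotate by (simp add: mult_left_mono)
  qed
  have "s \<longlonglongrightarrow> 0" 
  proof -
    have "s = (\<lambda>n. pi / \<bar>m\<bar> * inverse (real (Suc n)))" by (auto simp: s_def field_simps)
    then show ?thesis by (simp only: tendsto_mult_right_zero LIMSEQ_inverse_real_of_nat)
  qed
  then have "(\<lambda>n. K * t n powr \<alpha> + m\<^sup>2 * (s n * pi / \<bar>m\<bar>) / 2) \<longlonglongrightarrow> K * 0 + m\<^sup>2 * (0 * pi / \<bar>m\<bar>) / 2"
    using t0 \<alpha> by (intro tendsto_intros tendsto_zero_powrI[OF t0 tendsto_const]) (auto simp: m t_def less_imp_le[OF s0])
  then have "(\<lambda>n. char G (s n) ^ Suc n - (-1)) \<longlonglongrightarrow> 0"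
    by (intro Lim_null_comparison[OF always_eventually[OF allI[OF bound]]]) simp
  from tendsto_add[OF this tendsto_const[of "-1"]]
  have lim1: "(\<lambda>n. char G (s n) ^ Suc n) \<longlonglongrightarrow> -1" by simp
  have ts: "t n / real (Suc n) powr (1 / \<alpha>) = s n" for n by (simp add: t_def)
  have "(\<lambda>n. char G (s n) ^ Suc n) \<longlonglongrightarrow> 1"
    using char_normed_sum_tendsto[OF attr \<alpha> l filterlim_Suc t0] \<alpha>
    unfolding ts d by simp
  from LIMSEQ_unique[OF lim1 this] show False by simp
qed

text \<open>
  The truncated mean is the delicate quantity. For \<open>\<alpha> < 1\<close> the truncated absolute moment suffices. For
  \<open>\<alpha> > 1\<close> the mean vanishes, so the truncated mean equals minus the mean over the tail. For \<open>\<alpha> = 1\<close>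
  the absolute moment is estimated with the exponent \<open>1 - 1 / ln b\<close> in place of \<open>1\<close>: this choice
  costs a factor \<open>ln b\<close>, while \<open>b powr (1 / ln b) = exp 1\<close> stays bounded.
\<close>
lemma normal_attraction_bounds:
  assumes cent: "centering_convention \<alpha> d"
  obtains C c x0 where "stable_type_bounds G \<alpha> C" "0 < c"
    "\<And>x. x0 \<le> x \<Longrightarrow> c * x powr - \<alpha> \<le> abs_tail G x"
proof -
  obtain C where C: "1 \<le> C" and up: "\<And>x. 0 < x \<Longrightarrow> abs_tail G x \<le> C * x powr - \<alpha>"
    using attraction_tail_upper by metis
  obtain c x0 where low: "0 < c" "\<And>x. x0 \<le> x \<Longrightarrow> c * x powr - \<alpha> \<le> abs_tail G x"
    using attraction_tail_lower by metis
  have abs_le: "\<bar>truncated_mean G b\<bar> \<le> C / (1 - \<beta>) * b powr (1 - \<beta>)"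
    if "\<beta> < 1" "0 < b" and upb: "\<And>x. 0 < x \<Longrightarrow> abs_tail G x \<le> C * x powr - \<beta>" for \<beta> b
  proof -
    have "\<bar>truncated_mean G b\<bar> \<le> (\<integral>y. \<bar>y * indicator {y. \<bar>y\<bar> \<le> b} y\<bar> \<partial>G)"
      by (rule integral_abs_bound)
    also have "\<dots> = (\<integral>y. \<bar>y\<bar> powr 1 * indicator {y. \<bar>y\<bar> \<le> b} y \<partial>G)"
      by (intro Bochner_Integration.integral_cong) (auto split: split_indicator)
    also have "\<dots> \<le> 1 * C / (1 - \<beta>) * b powr (1 - \<beta>)"
      using C that by (intro G.truncated_moment_le) auto
    finally show ?thesis by simp
  qed
  define C1 where "C1 = (if \<alpha> < 1 then C / (1 - \<alpha>) else if \<alpha> = 1 then C * exp 1 else \<alpha> * C / (\<alpha> - 1))"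
  define C2 where "C2 = 2 * C / (2 - \<alpha>)"
  have "stable_type_bounds G \<alpha> (max C (max C1 C2))"
    unfolding stable_type_bounds_def
  proof (intro conjI allI impI)
    show "1 \<le> max C (max C1 C2)" using C by simp
  next
    fix x :: real assume x: "0 < x"
    show "abs_tail G x \<le> max C (max C1 C2) * x powr - \<alpha>"
      by (rule order_trans[OF up[OF x]]) (intro mult_right_mono, auto)
  next
    fix b :: real assume b: "0 < b"
    have "truncated_second_moment G b \<le> C2 * b powr (2 - \<alpha>)"
      unfolding C2_def using C up \<alpha> b by (intro G.truncated_second_moment_le) auto
    also have "\<dots> \<le> max C (max C1 C2) * b powr (2 - \<alpha>)" by (intro mult_right_mono) auto
    finally show "truncated_second_moment G b \<le> max C (max C1 C2) * b powr (2 - \<alpha>)" .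
  next
    fix b :: real assume b: "0 < b" and ne: "\<alpha> \<noteq> 1"
    have "\<bar>truncated_mean G b\<bar> \<le> C1 * b powr (1 - \<alpha>)"
    proof (cases "\<alpha> < 1")
      case True
      then show ?thesis using abs_le[OF True b up] by (simp add: C1_def)
    next
      case False
      then have \<alpha>1: "1 < \<alpha>" using ne by simp
      note int = attraction_integrable[OF \<alpha>1]
      have int2: "integrable G (\<lambda>y. \<bar>y\<bar> * indicator {y. b \<le> \<bar>y\<bar>} y)" by (rule G.integrable_abs_indicator[OF int])
      have "(\<integral>y. y \<partial>G) = 0" using cent ne by (intro attraction_mean_zero[OF \<alpha>1]) (auto simp: centering_convention_def)
      then have "truncated_mean G b = - (\<integral>y. y - y * indicator {y. \<bar>y\<bar> \<le> b} y \<partial>G)"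
        using int by (subst Bochner_Integration.integral_diff) auto
      then have "\<bar>truncated_mean G b\<bar> \<le> (\<integral>y. \<bar>y - y * indicator {y. \<bar>y\<bar> \<le> b} y\<bar> \<partial>G)"
        by (simp del: abs_minus_cancel add: abs_minus_cancel)
      also have "\<dots> \<le> (\<integral>y. \<bar>y\<bar> * indicator {y. b \<le> \<bar>y\<bar>} y \<partial>G)"
        using int int2 by (intro integral_mono) (auto split: split_indicator intro!: integrable_abs)
      finally have "ennreal \<bar>truncated_mean G b\<bar> \<le> ennreal (\<integral>y. \<bar>y\<bar> * indicator {y. b \<le> \<bar>y\<bar>} y \<partial>G)"
        by (rule ennreal_leI)
      also have "\<dots> = (\<integral>\<^sup>+y. ennreal (\<bar>y\<bar> * indicator {y. b \<le> \<bar>y\<bar>} y) \<partial>G)"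
        by (rule nn_integral_eq_integral[symmetric, OF int2]) auto
      also have "\<dots> \<le> ennreal (\<alpha> * C / (\<alpha> - 1) * b powr (1 - \<alpha>))"
        using C up b \<alpha>1 by (intro G.tail_moment_le) auto
      finally show ?thesis using C \<alpha>1 by (subst (asm) ennreal_le_iff) (auto simp: C1_def)
    qed
    also have "\<dots> \<le> max C (max C1 C2) * b powr (1 - \<alpha>)" by (intro mult_right_mono) auto
    finally show "\<bar>truncated_mean G b\<bar> \<le> max C (max C1 C2) * b powr (1 - \<alpha>)" .
  next
    fix b :: real assume b: "exp 1 \<le> b" and e: "\<alpha> = 1"
    define L where "L = ln b"
    have b0: "0 < b" using b exp_gt_zero[of "1::real"] by linarith
    have L: "1 \<le> L" using b b0 by (simp add: L_def ln_ge_iff)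
    have "\<bar>truncated_mean G b\<bar> \<le> C / (1 - (1 - 1 / L)) * b powr (1 - (1 - 1 / L))"
    proof (rule abs_le)
      show "1 - 1 / L < 1" "0 < b" using L b0 by auto
      fix x :: real assume x: "0 < x"
      show "abs_tail G x \<le> C * x powr - (1 - 1 / L)"
      proof (cases "1 \<le> x")
        case True
        have "abs_tail G x \<le> C * x powr - 1" using up[OF x] e by simp
        also have "\<dots> \<le> C * x powr - (1 - 1 / L)" using True L C by (intro mult_left_mono powr_mono) auto
        finally show ?thesis .
      next
        case False
        have "abs_tail G x \<le> 1" by simp
        also have "1 \<le> C * x powr - (1 - 1 / L)"
        proof -
          have "1 = x powr 0" using x by simp
          also have "\<dots> \<le> x powr - (1 - 1 / L)" using x False L by (intro powr_mono') auto
          finally show ?thesis using C mult_mono[of 1 C 1 "x powr - (1 - 1 / L)"] by simp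
        qed
        finally show ?thesis .
      qed
    qed
    also have "\<dots> = C * exp 1 * ln b"
      using L b0 by (simp add: powr_def L_def[symmetric])
    also have "\<dots> = C1 * ln b" using e by (simp add: C1_def)
    also have "\<dots> \<le> max C (max C1 C2) * ln b" using L by (intro mult_right_mono) (auto simp: L_def)
    finally show "\<bar>truncated_mean G b\<bar> \<le> max C (max C1 C2) * ln b" .
  qed
  then show ?thesis using low by (rule that)
qed

end

section \<open>First passage, random series and the Kronecker lemma\<close>

context prob_space
begin

text \<open>
  The sigma-algebra generated by the variables with index in \<open>J\<close>, as a measure space, so that
  measurability of functions of these variables can be stated with the usual arrow.
\<close>
definition history :: "(nat \<Rightarrow> 'a \<Rightarrow> real) \<Rightarrow> nat set \<Rightarrow> 'a measure" where
  "history X J = sigma (space M) (\<Union>j\<in>J. {X j -` A \<inter> space M |A. A \<in> sets borel})"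

lemma space_history [simp]: "space (history X J) = space M"
  by (simp add: history_def space_measure_of_conv)

lemma sets_history:
  "sets (history X J) = sigma_sets (space M) (\<Union>j\<in>J. {X j -` A \<inter> space M |A. A \<in> sets borel})"
  unfolding history_def by (rule sets_measure_of) auto

lemma measurable_history: "j \<in> J \<Longrightarrow> X j \<in> borel_measurable (history X J)"
  by (intro measurableI) (auto simp: sets_history intro!: sigma_sets.Basic)

lemma sets_history_Collect:
  assumes "f \<in> borel_measurable (history X J)" and "A \<in> sets borel"
  shows "{\<omega> \<in> space M. f \<omega> \<in> A} \<in> sets (history X J)"
  using measurable_sets[OF assms] by (simp add: vimage_def Int_def conj_commute)

lemma sets_history_mono: "J \<subseteq> K \<Longrightarrow> sets (history X J) \<subseteq> sets (history X K)"
  unfolding sets_history by (intro sigma_sets_mono') auto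

lemma sets_history_events:
  assumes "\<And>j. j \<in> J \<Longrightarrow> random_variable borel (X j)"
  shows "sets (history X J) \<subseteq> events"
  unfolding sets_history using assms by (intro sets.sigma_sets_subset) (auto intro: measurable_sets)

lemma prob_history_indep:
  assumes indep: "indep_vars (\<lambda>_. borel) X I" and JK: "J \<subseteq> I" "K \<subseteq> I" "J \<inter> K = {}"
    and A: "A \<in> sets (history X J)" and B: "B \<in> sets (history X K)"
  shows "prob (A \<inter> B) = prob A * prob B"
proof -
  let ?E = "\<lambda>i. {X i -` A \<inter> space M |A. A \<in> sets borel}"
  let ?S = "case_bool J K"
  have "indep_sets (\<lambda>b. sigma_sets (space M) (\<Union>i\<in>?S b. ?E i)) UNIV"
  proof (rule indep_sets_collect_sigma)
    have "indep_sets ?E I" using indep by (simp add: indep_vars_def2)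
    then show "indep_sets ?E (\<Union>b\<in>UNIV. ?S b)"
      by (rule indep_sets_mono_index[rotated]) (use JK in \<open>auto split: bool.splits\<close>)
    show "disjoint_family_on ?S UNIV" using JK by (auto simp: disjoint_family_on_def split: bool.splits)
    fix i show "Int_stable (?E i)"
    proof (rule Int_stableI)
      fix a b assume "a \<in> ?E i" "b \<in> ?E i"
      then obtain a' b' where "a = X i -` a' \<inter> space M" "b = X i -` b' \<inter> space M" "a' \<in> sets borel" "b' \<in> sets borel"
        by auto
      then show "a \<inter> b \<in> ?E i" by (intro CollectI exI[of _ "a' \<inter> b'"]) auto
    qed
  qed
  also have "(\<lambda>b. sigma_sets (space M) (\<Union>i\<in>?S b. ?E i)) = case_bool (sets (history X J)) (sets (history X K))"
    by (auto simp: sets_history split: bool.split intro!: ext)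
  finally have "indep_set (sets (history X J)) (sets (history X K))" unfolding indep_set_def .
  then show ?thesis using A B by (rule indep_setD)
qed

text \<open>
  A first-passage decomposition. Let \<open>N k\<close> be the event that \<open>k\<close> is the first index in the range at
  which \<open>F k\<close> occurs. It depends on the past of \<open>k\<close> only and is therefore independent of \<open>Q k\<close>, which
  depends on the future; summing \<open>prob (N k \<inter> Q k) \<ge> q * prob (N k)\<close> over \<open>k\<close> gives the claim.
  The lemma is used twice: for a maximal inequality, and to see that a large summand is not cancelled
  by the summands that follow it.
\<close>
lemma first_passage:
  assumes indep: "indep_vars (\<lambda>_. borel) X {1..}" and m: "1 \<le> m"
    and F: "\<And>k. k \<in> {m..n} \<Longrightarrow> F k \<in> sets (history X {1..k})"
    and Q: "\<And>k. k \<in> {m..n} \<Longrightarrow> Q k \<in> sets (history X {k<..})"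
    and q: "0 \<le> q" "\<And>k. k \<in> {m..n} \<Longrightarrow> q \<le> prob (Q k)"
  shows "q * prob (\<Union>k\<in>{m..n}. F k) \<le> prob (\<Union>k\<in>{m..n}. F k \<inter> Q k)"
proof -
  define N where "N k = F k - (\<Union>j\<in>{m..<k}. F j)" for k
  have rv: "random_variable borel (X j)" if "j \<in> {1..}" for j
    using indep that by (auto simp: indep_vars_def2)
  have F_past: "F j \<in> sets (history X {1..k})" if "j \<in> {m..<k}" "k \<in> {m..n}" for j k
  proof (rule subsetD[OF sets_history_mono])
    show "F j \<in> sets (history X {1..j})" using that by (intro F) auto
  qed (use that in auto)
  have N: "N k \<in> sets (history X {1..k})" if k: "k \<in> {m..n}" for k
    unfolding N_def by (intro sets.Diff sets.finite_UN F[OF k] F_past[OF _ k]) auto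
  have N_ev: "N k \<in> events" if "k \<in> {m..n}" for k
    using N[OF that] sets_history_events[of "{1..k}" X] rv by auto
  have F_ev: "F k \<in> events" if "k \<in> {m..n}" for k
    using F[OF that] sets_history_events[of "{1..k}" X] rv by auto
  have Q_ev: "Q k \<in> events" if "k \<in> {m..n}" for k
    using Q[OF that] sets_history_events[of "{k<..}" X] rv by auto
  have disj: "disjoint_family_on N {m..n}"
  proof -
    have "N i \<inter> N j = {}" if "i \<in> {m..n}" "j \<in> {m..n}" "i < j" for i j
      using that by (auto simp: N_def)
    then show ?thesis unfolding disjoint_family_on_def neq_iff by blast
  qed
  have UN: "(\<Union>k\<in>{m..n}. F k) = (\<Union>k\<in>{m..n}. N k)"
  proof (intro equalityI subsetI)
    fix x assume "x \<in> (\<Union>k\<in>{m..n}. F k)"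
    then obtain k where k: "k \<in> {m..n}" "x \<in> F k" by auto
    define k0 where "k0 = (LEAST k. k \<in> {m..n} \<and> x \<in> F k)"
    have k0: "k0 \<in> {m..n} \<and> x \<in> F k0"
      unfolding k0_def using k by (intro LeastI[where P="\<lambda>k. k \<in> {m..n} \<and> x \<in> F k"]) auto
    have "x \<notin> F j" if "j \<in> {m..<k0}" for j
      using not_less_Least[of j "\<lambda>k. k \<in> {m..n} \<and> x \<in> F k"] that k0 by (auto simp: k0_def)
    then show "x \<in> (\<Union>k\<in>{m..n}. N k)" using k0 by (auto simp: N_def)
  qed (auto simp: N_def)
  have "q * prob (\<Union>k\<in>{m..n}. F k) = (\<Sum>k\<in>{m..n}. q * prob (N k))"
    unfolding UN using N_ev disj by (subst finite_measure_finite_Union) (auto simp: sum_distrib_left)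
  also have "\<dots> \<le> (\<Sum>k\<in>{m..n}. prob (N k \<inter> Q k))"
  proof (rule sum_mono)
    fix k assume k: "k \<in> {m..n}"
    have "q * prob (N k) \<le> prob (N k) * prob (Q k)"
      using mult_left_mono[OF q(2)[OF k], of "prob (N k)"] by (simp add: mult.commute)
    also have "\<dots> = prob (N k \<inter> Q k)"
      using k m by (intro prob_history_indep[OF indep _ _ _ N[OF k] Q[OF k], symmetric]) auto
    finally show "q * prob (N k) \<le> prob (N k \<inter> Q k)" .
  qed
  also have "\<dots> = prob (\<Union>k\<in>{m..n}. N k \<inter> Q k)"
  proof (rule finite_measure_finite_Union[symmetric])
    show "disjoint_family_on (\<lambda>k. N k \<inter> Q k) {m..n}"
      using disj unfolding disjoint_family_on_def by blast
  qed (use N_ev Q_ev in auto)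
  also have "\<dots> \<le> prob (\<Union>k\<in>{m..n}. F k \<inter> Q k)"
  proof (rule finite_measure_mono)
    show "(\<Union>k\<in>{m..n}. F k \<inter> Q k) \<in> events"
      by (intro sets.finite_UN sets.Int F_ev Q_ev) auto
  qed (auto simp: N_def)
  finally show ?thesis .
qed

lemma second_moment_sum:
  fixes X :: "'i \<Rightarrow> 'a \<Rightarrow> real"
  assumes indep: "indep_vars (\<lambda>_. borel) X I" and fin: "finite J" and JI: "J \<subseteq> I"
    and sq: "\<And>j. j \<in> J \<Longrightarrow> integrable M (\<lambda>\<omega>. (X j \<omega>)\<^sup>2)"
    and mean: "\<And>j. j \<in> J \<Longrightarrow> expectation (X j) = 0"
  shows "integrable M (\<lambda>\<omega>. (\<Sum>j\<in>J. X j \<omega>)\<^sup>2) \<and>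
    expectation (\<lambda>\<omega>. (\<Sum>j\<in>J. X j \<omega>)\<^sup>2) = (\<Sum>j\<in>J. expectation (\<lambda>\<omega>. (X j \<omega>)\<^sup>2))"
  using fin JI sq mean
proof (induction J)
  case (insert i J)
  have rv [measurable]: "random_variable borel (X j)" if "j \<in> I" for j
    using indep that by (auto simp: indep_vars_def2)
  have IH: "integrable M (\<lambda>\<omega>. (\<Sum>j\<in>J. X j \<omega>)\<^sup>2)"
    "expectation (\<lambda>\<omega>. (\<Sum>j\<in>J. X j \<omega>)\<^sup>2) = (\<Sum>j\<in>J. expectation (\<lambda>\<omega>. (X j \<omega>)\<^sup>2))"
    using insert by auto
  have int: "integrable M (X j)" if "j \<in> insert i J" for j
    using that insert.prems(1) by (intro square_integrable_imp_integrable[OF rv insert.prems(2)]) auto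
  have ind: "indep_var borel (X i) borel (\<lambda>\<omega>. \<Sum>j\<in>J. X j \<omega>)"
    using insert by (intro indep_vars_sum indep_vars_subset[OF indep]) auto
  have intS: "integrable M (\<lambda>\<omega>. \<Sum>j\<in>J. X j \<omega>)" using int by auto
  have cross: "integrable M (\<lambda>\<omega>. X i \<omega> * (\<Sum>j\<in>J. X j \<omega>))"
    using ind int intS by (intro indep_var_integrable) auto
  have "expectation (\<lambda>\<omega>. X i \<omega> * (\<Sum>j\<in>J. X j \<omega>)) = 0"
    using indep_var_lebesgue_integral[OF ind] int intS insert.prems by simp
  moreover have "(\<Sum>j\<in>insert i J. X j \<omega>)\<^sup>2 = (X i \<omega>)\<^sup>2 + (\<Sum>j\<in>J. X j \<omega>)\<^sup>2 + 2 * (X i \<omega> * (\<Sum>j\<in>J. X j \<omega>))" for \<omega>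
    using insert.hyps by (simp add: power2_sum)
  ultimately show ?case
    using insert.hyps insert.prems IH cross by simp
qed simp

text \<open>
  Ottaviani's argument. Once the partial sum exceeds \<open>2 * e\<close>, the remaining summands add up to at
  most \<open>e\<close> with probability at least one half, by Chebyshev, and then the total exceeds \<open>e\<close>, which is
  unlikely by Chebyshev again.
\<close>
lemma maximal_inequality:
  fixes X :: "nat \<Rightarrow> 'a \<Rightarrow> real"
  assumes indep: "indep_vars (\<lambda>_. borel) X {1..}"
    and sq: "\<And>j. 1 \<le> j \<Longrightarrow> integrable M (\<lambda>\<omega>. (X j \<omega>)\<^sup>2)"
    and mean: "\<And>j. 1 \<le> j \<Longrightarrow> expectation (X j) = 0"
    and e: "0 < e" and V: "(\<Sum>j\<in>{m<..n}. expectation (\<lambda>\<omega>. (X j \<omega>)\<^sup>2)) \<le> V" "V \<le> e\<^sup>2 / 2"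
  shows "prob (\<Union>k\<in>{m<..n}. {\<omega> \<in> space M. 2 * e < \<bar>\<Sum>j\<in>{m<..k}. X j \<omega>\<bar>}) \<le> 2 * V / e\<^sup>2"
proof -
  have rv [measurable]: "random_variable borel (X j)" if "j \<in> {1..}" for j
    using indep that by (auto simp: indep_vars_def2)
  have cheb: "prob {\<omega> \<in> space M. e < \<bar>\<Sum>j\<in>{k<..n}. X j \<omega>\<bar>} \<le> V / e\<^sup>2" if "m \<le> k" for k
  proof -
    note sm = second_moment_sum[OF indep, of "{k<..n}"]
    have sub: "{k<..n} \<subseteq> {1..}" by auto
    have i: "integrable M (\<lambda>\<omega>. (\<Sum>j\<in>{k<..n}. X j \<omega>)\<^sup>2)" using sm sub sq mean by auto
    have "prob {\<omega> \<in> space M. e < \<bar>\<Sum>j\<in>{k<..n}. X j \<omega>\<bar>} \<le> prob {\<omega> \<in> space M. e\<^sup>2 \<le> (\<Sum>j\<in>{k<..n}. X j \<omega>)\<^sup>2}"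
    proof (rule finite_measure_mono)
      show "{\<omega> \<in> space M. e\<^sup>2 \<le> (\<Sum>j\<in>{k<..n}. X j \<omega>)\<^sup>2} \<in> events"
        using borel_measurable_integrable[OF i] by measurable
      show "{\<omega> \<in> space M. e < \<bar>\<Sum>j\<in>{k<..n}. X j \<omega>\<bar>} \<subseteq> {\<omega> \<in> space M. e\<^sup>2 \<le> (\<Sum>j\<in>{k<..n}. X j \<omega>)\<^sup>2}"
        using e by (auto simp: abs_le_square_iff[symmetric])
    qed
    also have "\<dots> \<le> expectation (\<lambda>\<omega>. (\<Sum>j\<in>{k<..n}. X j \<omega>)\<^sup>2) / e\<^sup>2"
      using e i by (intro integral_Markov_inequality_measure[where A="{}"]) auto
    also have "expectation (\<lambda>\<omega>. (\<Sum>j\<in>{k<..n}. X j \<omega>)\<^sup>2) = (\<Sum>j\<in>{k<..n}. expectation (\<lambda>\<omega>. (X j \<omega>)\<^sup>2))"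
      using sm sub sq mean by auto
    also have "\<dots> \<le> (\<Sum>j\<in>{m<..n}. expectation (\<lambda>\<omega>. (X j \<omega>)\<^sup>2))"
      using that by (intro sum_mono2) auto
    also have "\<dots> \<le> V" by fact
    finally show ?thesis by (simp add: divide_right_mono)
  qed
  let ?F = "\<lambda>k. {\<omega> \<in> space M. 2 * e < \<bar>\<Sum>j\<in>{m<..k}. X j \<omega>\<bar>}"
  let ?Q = "\<lambda>k. {\<omega> \<in> space M. \<bar>\<Sum>j\<in>{k<..n}. X j \<omega>\<bar> \<le> e}"
  have sum_meas: "(\<lambda>\<omega>. \<Sum>j\<in>J. X j \<omega>) \<in> borel_measurable (history X K)" if "J \<subseteq> K" for J K
    using that by (intro borel_measurable_sum measurable_history) auto
  have sum_rv [measurable]: "(\<lambda>\<omega>. \<Sum>j\<in>J. X j \<omega>) \<in> borel_measurable M" if "J \<subseteq> {1..}" for J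
    using that by (intro borel_measurable_sum) (auto intro: rv)
  have "1 / 2 * prob (\<Union>k\<in>{Suc m..n}. ?F k) \<le> prob (\<Union>k\<in>{Suc m..n}. ?F k \<inter> ?Q k)"
  proof (rule first_passage[OF indep])
    fix k assume k: "k \<in> {Suc m..n}"
    show "?F k \<in> sets (history X {1..k})"
      using sets_history_Collect[OF sum_meas[of "{m<..k}" "{1..k}"], of "{x. 2 * e < \<bar>x\<bar>}"] by (auto simp: subset_eq)
    show "?Q k \<in> sets (history X {k<..})"
      using sets_history_Collect[OF sum_meas[of "{k<..n}" "{k<..}"], of "{x. \<bar>x\<bar> \<le> e}"] by (auto simp: subset_eq)
    have "prob (?Q k) = 1 - prob {\<omega> \<in> space M. e < \<bar>\<Sum>j\<in>{k<..n}. X j \<omega>\<bar>}"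
      using sum_rv[of "{k<..n}"] by (subst prob_compl[symmetric]) (auto intro!: arg_cong[where f=prob])
    moreover have "V / e\<^sup>2 \<le> 1 / 2" using V(2) e by (simp add: field_simps)
    moreover have "prob {\<omega> \<in> space M. e < \<bar>\<Sum>j\<in>{k<..n}. X j \<omega>\<bar>} \<le> V / e\<^sup>2"
      using k by (intro cheb) simp
    ultimately show "1 / 2 \<le> prob (?Q k)" by linarith
  qed auto
  also have "\<dots> \<le> prob {\<omega> \<in> space M. e < \<bar>\<Sum>j\<in>{m<..n}. X j \<omega>\<bar>}"
  proof (rule finite_measure_mono)
    show "{\<omega> \<in> space M. e < \<bar>\<Sum>j\<in>{m<..n}. X j \<omega>\<bar>} \<in> events" using sum_rv[of "{m<..n}"] by auto
    show "(\<Union>k\<in>{Suc m..n}. ?F k \<inter> ?Q k) \<subseteq> {\<omega> \<in> space M. e < \<bar>\<Sum>j\<in>{m<..n}. X j \<omega>\<bar>}"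
    proof
      fix \<omega> assume "\<omega> \<in> (\<Union>k\<in>{Suc m..n}. ?F k \<inter> ?Q k)"
      then obtain k where k: "k \<in> {Suc m..n}" "\<omega> \<in> space M" "2 * e < \<bar>\<Sum>j\<in>{m<..k}. X j \<omega>\<bar>" "\<bar>\<Sum>j\<in>{k<..n}. X j \<omega>\<bar> \<le> e"
        by auto
      have "{m<..n} = {m<..k} \<union> {k<..n}" using k by auto
      then have "(\<Sum>j\<in>{m<..n}. X j \<omega>) = (\<Sum>j\<in>{m<..k}. X j \<omega>) + (\<Sum>j\<in>{k<..n}. X j \<omega>)"
        by (simp only:) (rule sum.union_disjoint, auto)
      then show "\<omega> \<in> {\<omega> \<in> space M. e < \<bar>\<Sum>j\<in>{m<..n}. X j \<omega>\<bar>}" using k by auto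
    qed
  qed
  also have "\<dots> \<le> V / e\<^sup>2" by (rule cheb) simp
  finally show ?thesis by (simp add: atLeastSucAtMost_greaterThanAtMost mult.commute)
qed

text \<open>
  By the maximal inequality the oscillation of the partial sums after \<open>m\<close> exceeds \<open>2 * e\<close> with
  a probability that tends to zero as \<open>m\<close> grows; hence the partial sums are almost surely Cauchy.
\<close>
lemma convergent_sum_of_variances:
  fixes X :: "nat \<Rightarrow> 'a \<Rightarrow> real"
  assumes indep: "indep_vars (\<lambda>_. borel) X {1..}"
    and sq: "\<And>j. 1 \<le> j \<Longrightarrow> integrable M (\<lambda>\<omega>. (X j \<omega>)\<^sup>2)"
    and mean: "\<And>j. 1 \<le> j \<Longrightarrow> expectation (X j) = 0"
    and var: "summable (\<lambda>j. expectation (\<lambda>\<omega>. (X j \<omega>)\<^sup>2))"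
  shows "AE \<omega> in M. convergent (\<lambda>n. \<Sum>j=1..n. X j \<omega>)"
proof -
  have rv [measurable]: "random_variable borel (X j)" if "j \<in> {1..}" for j
    using indep that by (auto simp: indep_vars_def2)
  let ?v = "\<lambda>j. expectation (\<lambda>\<omega>. (X j \<omega>)\<^sup>2)"
  let ?F = "\<lambda>e m k. {\<omega> \<in> space M. 2 * e < \<bar>\<Sum>j\<in>{m<..k}. X j \<omega>\<bar>}"
  have F_ev: "?F e m k \<in> events" for e m k
    using borel_measurable_sum[of "{m<..k}" X M] rv by auto
  have D: "prob (\<Union>k\<in>{m<..}. ?F e m k) \<le> 2 * V / e\<^sup>2"
    if e: "0 < e" and V: "V \<le> e\<^sup>2 / 2" "\<And>n. (\<Sum>j\<in>{m<..n}. ?v j) \<le> V" for e V m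
  proof (rule LIMSEQ_le_const2)
    show "\<exists>N. \<forall>n\<ge>N. prob (\<Union>k\<in>{m<..n}. ?F e m k) \<le> 2 * V / e\<^sup>2"
      using maximal_inequality[OF indep sq mean e V(2,1)] by auto
    \<comment> \<open>The maximal inequality concerns finitely many partial sums; continuity from below removes \<open>n\<close>.\<close>
    have "{m<..} = (\<Union>n. {m<..n})" by force
    then have "(\<Union>k\<in>{m<..}. ?F e m k) = (\<Union>n. \<Union>k\<in>{m<..n}. ?F e m k)"
      by (simp only: UN_UN_flatten)
    then show "(\<lambda>n. prob (\<Union>k\<in>{m<..n}. ?F e m k)) \<longlonglongrightarrow> prob (\<Union>k\<in>{m<..}. ?F e m k)"
      using F_ev by (simp only:) (rule finite_Lim_measure_incseq, auto simp: incseq_def, force)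
  qed
  have AE: "AE \<omega> in M. \<exists>m. \<forall>k>m. \<bar>\<Sum>j\<in>{m<..k}. X j \<omega>\<bar> \<le> 2 * e" if e: "0 < e" for e
  proof -
    let ?N = "\<Inter>m. \<Union>k\<in>{m<..}. ?F e m k"
    have N: "?N \<in> events" using F_ev by (intro sets.countable_INT sets.countable_UN') auto
    have le: "prob ?N \<le> \<epsilon>" if \<epsilon>: "0 < \<epsilon>" for \<epsilon>
    proof -
      define V where "V = min (e\<^sup>2 / 2) (\<epsilon> * e\<^sup>2 / 2)"
      have V: "0 < V" using e \<epsilon> by (simp add: V_def)
      have "(\<lambda>m. \<Sum>i. ?v (i + m)) \<longlonglongrightarrow> 0" by (rule suminf_exist_split2[OF var])
      then have "\<forall>\<^sub>F m in sequentially. (\<Sum>i. ?v (i + m)) < V" by (rule order_tendstoD) (rule V)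
      then obtain m where m: "(\<Sum>i. ?v (i + m)) < V" by (auto simp: eventually_sequentially)
      have "(\<Sum>j\<in>{m<..n}. ?v j) \<le> V" for n
      proof -
        have "(\<Sum>j\<in>{m<..n}. ?v j) \<le> (\<Sum>j\<in>{m..<n + 1 + m}. ?v j)" by (intro sum_mono2) auto
        also have "\<dots> = (\<Sum>i<n + 1. ?v (i + m))"
          by (rule sum.reindex_bij_witness[where i="\<lambda>i. i + m" and j="\<lambda>j. j - m"]) auto
        also have "\<dots> \<le> (\<Sum>i. ?v (i + m))"
          using var by (intro sum_le_suminf summable_ignore_initial_segment) auto
        finally show ?thesis using m by simp
      qed
      then have "prob (\<Union>k\<in>{m<..}. ?F e m k) \<le> 2 * V / e\<^sup>2"
        by (intro D[OF e]) (simp add: V_def)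
      also have "2 * V \<le> \<epsilon> * e\<^sup>2" by (simp add: V_def)
      then have "2 * V / e\<^sup>2 \<le> \<epsilon>" using e by (simp add: divide_le_eq)
      finally have "prob (\<Union>k\<in>{m<..}. ?F e m k) \<le> \<epsilon>" .
      moreover have "prob ?N \<le> prob (\<Union>k\<in>{m<..}. ?F e m k)"
        using F_ev by (intro finite_measure_mono sets.countable_UN') auto
      ultimately show ?thesis by (rule order_trans[rotated])
    qed
    have "prob ?N \<le> 0" by (rule field_le_epsilon, unfold add_0, rule le)
    then have "prob ?N = 0" by (rule antisym) (rule measure_nonneg)
    then have "AE \<omega> in M. \<omega> \<notin> ?N" by (rule iffD1[OF prob_eq_0[OF N]])
    then show ?thesis
    proof (rule AE_mp, intro AE_I2 impI)
      fix \<omega> assume "\<omega> \<in> space M" "\<omega> \<notin> ?N"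
      then obtain m where "\<forall>k\<in>{m<..}. \<omega> \<notin> ?F e m k" by blast
      with \<open>\<omega> \<in> space M\<close> show "\<exists>m. \<forall>k>m. \<bar>\<Sum>j\<in>{m<..k}. X j \<omega>\<bar> \<le> 2 * e"
        by (intro exI[of _ m]) (simp add: not_less)
    qed
  qed
  have "AE \<omega> in M. \<forall>i::nat. \<exists>m. \<forall>k>m. \<bar>\<Sum>j\<in>{m<..k}. X j \<omega>\<bar> \<le> 2 * (1 / Suc i)"
    by (rule AE_all_countable[THEN iffD2], rule allI, rule AE) simp
  then show ?thesis
  proof (rule AE_mp, intro AE_I2 impI)
    fix \<omega> assume *: "\<forall>i::nat. \<exists>m. \<forall>k>m. \<bar>\<Sum>j\<in>{m<..k}. X j \<omega>\<bar> \<le> 2 * (1 / Suc i)"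
    let ?S = "\<lambda>n. \<Sum>j=1..n. X j \<omega>"
    have S: "(\<Sum>j\<in>{m<..k}. X j \<omega>) = ?S k - ?S m" if "m \<le> k" for m k
    proof -
      have "{1..k} = {1..m} \<union> {m<..k}" using that by auto
      then have "?S k = ?S m + (\<Sum>j\<in>{m<..k}. X j \<omega>)"
        by (simp only:) (rule sum.union_disjoint, auto)
      then show ?thesis by simp
    qed
    have "Cauchy ?S"
    proof (rule metric_CauchyI)
      fix e :: real assume "0 < e"
      then have "0 < e / 4" by simp
      from reals_Archimedean[OF this] obtain i where "inverse (real (Suc i)) < e / 4" ..
      then have i: "1 / Suc i < e / 4" by (simp only: inverse_eq_divide)
      obtain m where m: "\<And>k. m < k \<Longrightarrow> \<bar>\<Sum>j\<in>{m<..k}. X j \<omega>\<bar> \<le> 2 * (1 / Suc i)" using *[rule_format, of i] by blast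
      have m': "\<bar>?S k - ?S m\<bar> \<le> 2 * (1 / Suc i)" if "m < k" for k
        using m[OF that] S[of m k] that by simp
      have "dist (?S k) (?S k') < e" if "Suc m \<le> k" "Suc m \<le> k'" for k k'
        using m'[of k] m'[of k'] that i unfolding dist_real_def by linarith
      then show "\<exists>M. \<forall>m\<ge>M. \<forall>n\<ge>M. dist (?S m) (?S n) < e" by (intro exI[of _ "Suc m"]) simp
    qed
    then show "convergent ?S" by (rule Cauchy_convergent)
  qed
qed

end

text \<open>
  With \<open>s\<close> the partial sums of \<open>x\<close> and \<open>E\<close> those of \<open>b * x\<close>, the quantity
  \<open>E n - E m - b n * (s n - s m)\<close> decreases at each step by \<open>(b (n + 1) - b n) * (s n - s m)\<close>, so its
  absolute value is at most \<open>e * (b n - b m)\<close> when the \<open>s n\<close> stay within \<open>e\<close> of \<open>s m\<close>.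
\<close>
lemma kronecker_lemma:
  fixes b x :: "nat \<Rightarrow> real"
  assumes pos: "\<And>n. 0 < b n" and mono: "mono b" and top: "filterlim b at_top sequentially"
    and conv: "convergent (\<lambda>n. \<Sum>k=1..n. x k)"
  shows "(\<lambda>n. (\<Sum>k=1..n. b k * x k) / b n) \<longlonglongrightarrow> 0"
proof (rule LIMSEQ_I)
  fix e :: real assume e: "0 < e"
  let ?s = "\<lambda>n. \<Sum>k=1..n. x k"
  let ?E = "\<lambda>n. \<Sum>k=1..n. b k * x k"
  have "Cauchy ?s" using conv by (rule convergent_Cauchy)
  moreover have "0 < e / 4" using e by simp
  ultimately obtain m where "\<forall>k\<ge>m. \<forall>l\<ge>m. dist (?s k) (?s l) < e / 4"
    unfolding Cauchy_def by blast
  then have m: "\<And>k. m \<le> k \<Longrightarrow> \<bar>?s k - ?s m\<bar> \<le> e / 4"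
    by (auto simp: dist_real_def intro: less_imp_le)
  have claim: "\<bar>?E n - ?E m - b n * (?s n - ?s m)\<bar> \<le> e / 4 * (b n - b m)" if "m \<le> n" for n
    using that
  proof (induction n rule: dec_induct)
    case (step n)
    have "?E (Suc n) - ?E m - b (Suc n) * (?s (Suc n) - ?s m)
        = (?E n - ?E m - b n * (?s n - ?s m)) - (b (Suc n) - b n) * (?s n - ?s m)"
      by (simp add: algebra_simps)
    moreover have "\<bar>(b (Suc n) - b n) * (?s n - ?s m)\<bar> \<le> (b (Suc n) - b n) * (e / 4)"
      using mult_left_mono[OF m[OF step.hyps(1)], of "b (Suc n) - b n"] monoD[OF mono, of n "Suc n"]
      by (simp only: abs_mult) simp
    ultimately have "\<bar>?E (Suc n) - ?E m - b (Suc n) * (?s (Suc n) - ?s m)\<bar>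
        \<le> e / 4 * (b n - b m) + (b (Suc n) - b n) * (e / 4)"
      using step.IH by linarith
    also have "\<dots> = e / 4 * (b (Suc n) - b m)" by (simp add: field_simps)
    finally show ?case .
  qed simp
  have "\<forall>\<^sub>F n in sequentially. 4 * \<bar>?E m\<bar> / e \<le> b n" using top by (auto simp: filterlim_at_top)
  then have "\<forall>\<^sub>F n in sequentially. 4 * \<bar>?E m\<bar> / e \<le> b n \<and> m \<le> n"
    by (intro eventually_conj eventually_ge_at_top)
  then obtain N where N: "\<And>n. N \<le> n \<Longrightarrow> 4 * \<bar>?E m\<bar> / e \<le> b n \<and> m \<le> n"
    by (auto simp: eventually_sequentially)
  have "norm (?E n / b n - 0) < e" if "N \<le> n" for n
  proof -
    have n: "4 * \<bar>?E m\<bar> / e \<le> b n" "m \<le> n" using N[OF that] by auto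
    have 1: "\<bar>?E m\<bar> \<le> e / 4 * b n" using n(1) e by (simp add: field_simps)
    have 2: "\<bar>b n * (?s n - ?s m)\<bar> \<le> e / 4 * b n"
      using mult_right_mono[OF m[OF n(2)], of "b n"] pos[of n] by (simp add: abs_mult mult.commute)
    have 3: "e / 4 * (b n - b m) \<le> e / 4 * b n" using pos[of m] e by (intro mult_left_mono) auto
    have "\<bar>?E n\<bar> \<le> 3 * (e / 4 * b n)" using claim[OF n(2)] 1 2 3 by linarith
    moreover have "0 < e / 4 * b n" using e pos[of n] by simp
    ultimately have "\<bar>?E n\<bar> < e * b n" by linarith
    then show ?thesis using pos[of n] by (simp add: field_simps)
  qed
  then show "\<exists>no. \<forall>n\<ge>no. norm (?E n / b n - 0) < e" by blast
qed

section \<open>A strong law and large windows\<close>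

abbreviation (input) window :: "(nat \<Rightarrow> 'a \<Rightarrow> real) \<Rightarrow> (nat \<Rightarrow> nat) \<Rightarrow> nat \<Rightarrow> 'a \<Rightarrow> real" where
  "window X a n \<omega> \<equiv> partial_sum X (n + a n) \<omega> - partial_sum X n \<omega>"

context prob_space
begin

text \<open>
  The summands are truncated at \<open>b k\<close>. The first series says that the truncation changes only finitely
  many of them, the second that the truncated, centered summands divided by \<open>b k\<close> form an almost surely
  convergent series, to which the Kronecker lemma applies; what is left is the drift of the truncated
  means.
\<close>
lemma sum_over_norming_tendsto_0:
  fixes X :: "nat \<Rightarrow> 'a \<Rightarrow> real"
  assumes indep: "indep_vars (\<lambda>_. borel) X {1..}"
    and pos: "\<And>n. 0 < b n" and mono: "mono b" and top: "filterlim b at_top sequentially"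
    and tails: "summable (\<lambda>k. prob {\<omega> \<in> space M. b k < \<bar>X k \<omega>\<bar>})"
    and vars: "summable (\<lambda>k. expectation (\<lambda>\<omega>. (X k \<omega>)\<^sup>2 * indicator {x. \<bar>x\<bar> \<le> b k} (X k \<omega>)) / (b k)\<^sup>2)"
    and drift: "(\<lambda>n. (\<Sum>k=1..n. expectation (\<lambda>\<omega>. X k \<omega> * indicator {x. \<bar>x\<bar> \<le> b k} (X k \<omega>))) / b n) \<longlonglongrightarrow> 0"
  shows "AE \<omega> in M. (\<lambda>n. partial_sum X n \<omega> / b n) \<longlonglongrightarrow> 0"
proof -
  have rv [measurable]: "random_variable borel (X j)" if "1 \<le> j" for j
    using indep that by (auto simp: indep_vars_def2)
  define Y where "Y = (\<lambda>k \<omega>. X k \<omega> * indicator {x. \<bar>x\<bar> \<le> b k} (X k \<omega>))"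
  define \<mu> where "\<mu> = (\<lambda>k. expectation (Y k))"
  define W where "W = (\<lambda>k \<omega>. (Y k \<omega> - \<mu> k) / b k)"
  have Y_rv [measurable]: "random_variable borel (Y k)" if "1 \<le> k" for k
    using rv[OF that] unfolding Y_def by measurable
  have Y_bd: "\<bar>Y k \<omega>\<bar> \<le> b k" for k \<omega>
    using less_imp_le[OF pos[of k]] by (auto simp: Y_def split: split_indicator)
  have Y_int: "integrable M (Y k)" if "1 \<le> k" for k
    by (rule integrable_const_bound[where B="b k"]) (use Y_bd Y_rv[OF that] in auto)
  have Y_sq: "integrable M (\<lambda>\<omega>. (Y k \<omega>)\<^sup>2)" if "1 \<le> k" for k
  proof (rule integrable_const_bound[where B="(b k)\<^sup>2"])
    show "AE \<omega> in M. norm ((Y k \<omega>)\<^sup>2) \<le> (b k)\<^sup>2"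
      using Y_bd[of k] less_imp_le[OF pos[of k]] by (intro AE_I2) (simp add: abs_le_square_iff[symmetric])
  qed (use Y_rv[OF that] in measurable)
  have W_sq: "integrable M (\<lambda>\<omega>. (W k \<omega>)\<^sup>2)" if "1 \<le> k" for k
    using Y_sq[OF that] Y_int[OF that] by (simp add: W_def power_divide power2_diff)
  have W_indep: "indep_vars (\<lambda>_. borel) W {1..}"
    unfolding W_def Y_def
    by (rule indep_vars_compose2[OF indep, where Y="\<lambda>k x. (x * indicator {x. \<bar>x\<bar> \<le> b k} x - \<mu> k) / b k"]) measurable
  have W_mean: "expectation (W k) = 0" if "1 \<le> k" for k
    using Y_int[OF that] prob_space by (simp add: W_def \<mu>_def)
  have W_var: "expectation (\<lambda>\<omega>. (W k \<omega>)\<^sup>2) \<le> expectation (\<lambda>\<omega>. (Y k \<omega>)\<^sup>2) / (b k)\<^sup>2" if "1 \<le> k" for k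
  proof -
    have "expectation (\<lambda>\<omega>. (W k \<omega>)\<^sup>2) = variance (Y k) / (b k)\<^sup>2"
      by (simp add: W_def \<mu>_def power_divide)
    also have "variance (Y k) \<le> expectation (\<lambda>\<omega>. (Y k \<omega>)\<^sup>2)"
      using variance_eq[OF Y_int Y_sq] that by simp
    finally show ?thesis by (simp add: divide_right_mono)
  qed
  have Y2: "(Y k \<omega>)\<^sup>2 = (X k \<omega>)\<^sup>2 * indicator {x. \<bar>x\<bar> \<le> b k} (X k \<omega>)" for k \<omega>
    by (auto simp: Y_def split: split_indicator)
  have "summable (\<lambda>k. expectation (\<lambda>\<omega>. (W k \<omega>)\<^sup>2))"
    by (rule summable_comparison_test'[where N=1, OF vars[folded Y2]]) (simp add: W_var)
  from convergent_sum_of_variances[OF W_indep W_sq W_mean this]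
  have conv: "AE \<omega> in M. convergent (\<lambda>n. \<Sum>j=1..n. W j \<omega>)" by simp
  have "AE \<omega> in M. \<forall>\<^sub>F n in sequentially. \<omega> \<in> space M - {\<omega> \<in> space M. b (Suc n) < \<bar>X (Suc n) \<omega>\<bar>}"
    using rv tails[THEN summable_Suc_iff[THEN iffD2]]
    by (intro borel_cantelli_AE1) (auto simp: emeasure_eq_measure)
  with conv show ?thesis
  proof eventually_elim
    case (elim \<omega>)
    from elim(2) obtain N where N: "\<And>n. N \<le> n \<Longrightarrow> \<bar>X (Suc n) \<omega>\<bar> \<le> b (Suc n)"
      by (auto simp: eventually_sequentially not_less)
    have XY: "X k \<omega> = Y k \<omega>" if "N < k" for k
      using N[of "k - 1"] that by (simp add: Y_def)
    have "(\<lambda>n. (\<Sum>k=1..n. b k * W k \<omega>) / b n) \<longlonglongrightarrow> 0"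
      by (rule kronecker_lemma[OF pos mono top elim(1)])
    moreover have "b k * W k \<omega> = Y k \<omega> - \<mu> k" for k using pos[of k] by (simp add: W_def)
    ultimately have 1: "(\<lambda>n. (\<Sum>k=1..n. Y k \<omega> - \<mu> k) / b n) \<longlonglongrightarrow> 0" by simp
    have 2: "(\<lambda>n. (\<Sum>k=1..n. \<mu> k) / b n) \<longlonglongrightarrow> 0" using drift by (simp add: \<mu>_def Y_def)
    have 3: "(\<lambda>n. (\<Sum>k=1..n. X k \<omega> - Y k \<omega>) / b n) \<longlonglongrightarrow> 0"
    proof (rule Lim_transform_eventually)
      show "(\<lambda>n. (\<Sum>k=1..N. X k \<omega> - Y k \<omega>) / b n) \<longlonglongrightarrow> 0"
        by (intro real_tendsto_divide_at_top[OF tendsto_const top])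
      show "\<forall>\<^sub>F n in sequentially. (\<Sum>k=1..N. X k \<omega> - Y k \<omega>) / b n = (\<Sum>k=1..n. X k \<omega> - Y k \<omega>) / b n"
      proof (rule eventually_mono[OF eventually_ge_at_top[of N]])
        fix n assume "N \<le> n"
        then have "(\<Sum>k=1..N. X k \<omega> - Y k \<omega>) = (\<Sum>k=1..n. X k \<omega> - Y k \<omega>)"
          by (intro sum.mono_neutral_left) (auto simp: XY)
        then show "(\<Sum>k=1..N. X k \<omega> - Y k \<omega>) / b n = (\<Sum>k=1..n. X k \<omega> - Y k \<omega>) / b n" by simp
      qed
    qed
    have "partial_sum X n \<omega> / b n = (\<Sum>k=1..n. Y k \<omega> - \<mu> k) / b n + (\<Sum>k=1..n. \<mu> k) / b n + (\<Sum>k=1..n. X k \<omega> - Y k \<omega>) / b n" for n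
      by (simp add: partial_sum_def add_divide_distrib[symmetric] sum.distrib[symmetric])
    then show ?case using tendsto_add[OF tendsto_add[OF 1 2] 3] by simp
  qed
qed

text \<open>
  The quantitative form of the second Borel--Cantelli lemma: by independence the probability that none
  of the events occurs is at most the exponential of minus the sum of the probabilities.
\<close>
lemma prob_union_independent_ge_half:
  fixes X :: "nat \<Rightarrow> 'a \<Rightarrow> real"
  assumes indep: "indep_vars (\<lambda>_. borel) X {1..}" and m: "1 \<le> m"
    and F: "\<And>k. 1 \<le> k \<Longrightarrow> F k \<in> sets (history X {k})"
    and div: "\<not> summable (\<lambda>k. prob (F k))"
  obtains n where "1 / 2 \<le> prob (\<Union>k\<in>{m..n}. F k)"
proof -
  have rv: "random_variable borel (X j)" if "j \<in> {1..}" for j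
    using indep that by (auto simp: indep_vars_def2)
  have F_ev: "F k \<in> events" if "1 \<le> k" for k
    using F[OF that] sets_history_events[of "{k}" X] rv that by auto
  have bound: "1 - prob (\<Union>k\<in>{m..<m + i}. F k) \<le> exp (- (\<Sum>k\<in>{m..<m + i}. prob (F k)))" for i
  proof (induction i)
    case (Suc i)
    let ?U = "\<Union>k\<in>{m..<m + i}. F k"
    have U: "?U \<in> sets (history X {1..<m + i})"
    proof (intro sets.finite_UN)
      fix k assume k: "k \<in> {m..<m + i}"
      show "F k \<in> sets (history X {1..<m + i})"
        by (rule subsetD[OF sets_history_mono F]) (use k m in auto)
    qed simp
    have U_ev: "?U \<in> events" using m by (intro sets.finite_UN F_ev) auto
    have "prob (?U \<inter> F (m + i)) = prob ?U * prob (F (m + i))"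
      using m by (intro prob_history_indep[OF indep _ _ _ U F]) auto
    moreover have "prob (?U \<union> F (m + i)) = prob ?U + prob (F (m + i)) - prob (?U \<inter> F (m + i))"
      using U_ev F_ev[of "m + i"] m by (intro measure_Un3) (auto simp: fmeasurable_eq_sets)
    moreover have "(\<Union>k\<in>{m..<m + Suc i}. F k) = ?U \<union> F (m + i)"
      by (simp add: atLeastLessThanSuc Un_commute)
    ultimately have "1 - prob (\<Union>k\<in>{m..<m + Suc i}. F k) = (1 - prob ?U) * (1 - prob (F (m + i)))"
      by (simp add: algebra_simps)
    also have "\<dots> \<le> exp (- (\<Sum>k\<in>{m..<m + i}. prob (F k))) * exp (- prob (F (m + i)))"
      using Suc.IH exp_ge_add_one_self[of "- prob (F (m + i))"] by (intro mult_mono) auto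
    finally show ?case by (simp add: exp_add[symmetric])
  qed simp
  have "\<exists>i. ln 2 \<le> (\<Sum>k\<in>{m..<m + i}. prob (F k))"
  proof (rule ccontr)
    assume "\<not> ?thesis"
    then have le: "(\<Sum>k\<in>{m..<m + i}. prob (F k)) \<le> ln 2" for i by (auto simp: not_le intro: less_imp_le)
    have "summable (\<lambda>k. prob (F (k + m)))"
    proof (rule bounded_imp_summable)
      fix i
      have "(\<Sum>k\<le>i. prob (F (k + m))) = (\<Sum>k\<in>{m..<m + Suc i}. prob (F k))"
        by (rule sum.reindex_bij_witness[where j="\<lambda>k. k + m" and i="\<lambda>k. k - m"]) auto
      then show "(\<Sum>k\<le>i. prob (F (k + m))) \<le> ln 2" using le[of "Suc i"] by simp
    qed simp
    then show False using div summable_iff_shift[of "\<lambda>k. prob (F k)" m] by simp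
  qed
  then obtain i where i: "ln 2 \<le> (\<Sum>k\<in>{m..<m + i}. prob (F k))" by auto
  have "exp (- (\<Sum>k\<in>{m..<m + i}. prob (F k))) \<le> exp (- ln 2)" using i by simp
  also have "\<dots> = 1 / 2" by (simp add: exp_minus)
  finally have "1 / 2 \<le> prob (\<Union>k\<in>{m..<m + i}. F k)" using bound[of i] by simp
  also have "\<dots> \<le> prob (\<Union>k\<in>{m..m + i}. F k)"
    using m by (intro finite_measure_mono UN_mono sets.finite_UN F_ev) auto
  finally show ?thesis by (rule that)
qed

text \<open>
  Kolmogorov's law is applied to the sequence that starts with \<open>X 1\<close>, since nothing is known about \<open>X 0\<close>.
\<close>
lemma prob_tail_zero_one:
  fixes X :: "nat \<Rightarrow> 'a \<Rightarrow> real"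
  assumes indep: "indep_vars (\<lambda>_. borel) X {1..}" and E: "\<And>n. E \<in> sets (history X {Suc n..})"
  shows "prob E = 0 \<or> prob E = 1"
proof (rule kolmogorov_0_1_law)
  let ?A = "\<lambda>i. sigma_sets (space M) {X (Suc i) -` B \<inter> space M |B. B \<in> sets borel}"
  show "sigma_algebra (space M) (?A i)" for i by (rule sigma_algebra_sigma_sets) auto
  let ?F = "\<lambda>i. sigma_sets (space M) {X i -` B \<inter> space M |B. B \<in> sets borel}"
  have F: "indep_sets ?F {1..}" using indep by (simp add: indep_vars_def)
  show "indep_sets ?A UNIV"
  proof (rule indep_setsI)
    show "?A i \<subseteq> events" for i using F by (auto simp: indep_sets_def)
    fix S :: "nat \<Rightarrow> 'a set" and J :: "nat set"
    assume J: "J \<noteq> {}" "finite J" and S: "\<forall>j\<in>J. S j \<in> ?A j"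
    have "prob (\<Inter>j\<in>Suc ` J. S (j - 1)) = (\<Prod>j\<in>Suc ` J. prob (S (j - 1)))"
      using J S by (intro indep_setsD[OF F]) auto
    then show "prob (\<Inter>j\<in>J. S j) = (\<Prod>j\<in>J. prob (S j))"
      by (simp add: prod.reindex)
  qed
  have "E \<in> sigma_sets (space M) (\<Union> (?A ` {n..}))" for n
  proof -
    have "(\<Union>j\<in>{Suc n..}. {X j -` A \<inter> space M |A. A \<in> sets borel}) \<subseteq> \<Union> (?A ` {n..})"
    proof
      fix S assume "S \<in> (\<Union>j\<in>{Suc n..}. {X j -` A \<inter> space M |A. A \<in> sets borel})"
      then obtain j A where S: "Suc n \<le> j" "S = X j -` A \<inter> space M" "A \<in> sets borel" by auto
      then have "S \<in> ?A (j - 1)" by (intro sigma_sets.Basic) auto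
      moreover have "n \<le> j - 1" using S by simp
      ultimately show "S \<in> \<Union> (?A ` {n..})" by blast
    qed
    then show ?thesis using E[of n] unfolding sets_history by (meson sigma_sets_mono' subsetD)
  qed
  then show "E \<in> tail_events ?A" by (simp add: tail_events_def)
qed

text \<open>
  The event that infinitely many windows are large belongs to the tail sigma-algebra, so it suffices to
  exclude that its probability is zero. In that case the probability of \<open>D m\<close>, that some window
  starting at \<open>m\<close> or later is large, tends to zero. The window that starts at \<open>k - 1\<close> consists of \<open>X k\<close>
  and an independent rest \<open>R k\<close>; since both this window and \<open>X k\<close> are rarely large, \<open>R k\<close> is below
  \<open>2 * b k\<close> with probability at least one half. By \<open>first_passage\<close> the probability that some \<open>X k\<close>
  exceeds \<open>3 * b k\<close> while \<open>R k\<close> stays below \<open>2 * b k\<close> is at least one quarter, by divergence of the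
  series. On this event the window is large, a contradiction.
\<close>
lemma frequently_large_window:
  fixes X :: "nat \<Rightarrow> 'a \<Rightarrow> real" and a :: "nat \<Rightarrow> nat" and b :: "nat \<Rightarrow> real"
  assumes indep: "indep_vars (\<lambda>_. borel) X {1..}"
    and b: "\<And>n. 0 < b n" "mono b" and a: "\<And>n. 1 \<le> n \<Longrightarrow> 0 < a n"
    and small: "(\<lambda>k. prob {\<omega> \<in> space M. b k < \<bar>X k \<omega>\<bar>}) \<longlonglongrightarrow> 0"
    and div: "\<not> summable (\<lambda>k. prob {\<omega> \<in> space M. 3 * b k < \<bar>X k \<omega>\<bar>})"
  shows "AE \<omega> in M. \<forall>m. \<exists>n\<ge>m. b n < \<bar>window X a n \<omega>\<bar>"
proof -
  have rv [measurable]: "random_variable borel (X j)" if "j \<in> {1..}" for j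
    using indep that by (auto simp: indep_vars_def2)
  define T where "T = (\<lambda>n \<omega>. \<Sum>k\<in>{n<..n + a n}. X k \<omega>)"
  have T: "window X a n \<omega> = T n \<omega>" for n \<omega>
  proof -
    have "{1..n + a n} = {1..n} \<union> {n<..n + a n}" by auto
    then have "partial_sum X (n + a n) \<omega> = partial_sum X n \<omega> + T n \<omega>"
      unfolding partial_sum_def T_def by (simp only:) (rule sum.union_disjoint, auto)
    then show ?thesis by simp
  qed
  have sum_meas: "(\<lambda>\<omega>. \<Sum>j\<in>J. X j \<omega>) \<in> borel_measurable (history X K)" if "J \<subseteq> K" for J K
    using that by (intro borel_measurable_sum measurable_history) auto
  have hist_ev: "A \<in> events" if "A \<in> sets (history X J)" "J \<subseteq> {1..}" for A J
    using sets_history_events[of J X] rv that by blast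
  define L where "L n = {\<omega> \<in> space M. b n < \<bar>T n \<omega>\<bar>}" for n
  have L: "L n \<in> sets (history X {Suc m..})" if "m \<le> n" for m n
    using sets_history_Collect[OF sum_meas[of "{n<..n + a n}" "{Suc m..}"], of "{x. b n < \<bar>x\<bar>}"] that
    by (auto simp: L_def T_def subset_eq)
  have L_ev: "L n \<in> events" for n using hist_ev[OF L[of n n]] by auto
  define D where "D m = (\<Union>n\<in>{m..}. L n)" for m
  have D: "D m \<in> sets (history X {Suc n..})" if "n \<le> m" for m n
    unfolding D_def using that by (intro sets.countable_UN') (auto intro!: L)
  have D_ev: "D m \<in> events" for m using hist_ev[OF D[of m m]] by auto
  define E where "E = (\<Inter>m. D m)"
  have dec: "decseq D" unfolding decseq_def D_def by (intro allI impI UN_mono) auto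
  have "E \<in> sets (history X {Suc n..})" for n
  proof -
    have "D (m + n) \<subseteq> D m" for m by (rule decseqD[OF dec le_add1])
    then have "E = (\<Inter>m. D (m + n))" unfolding E_def by blast
    also have "\<dots> \<in> sets (history X {Suc n..})" by (intro sets.countable_INT) (auto intro: D)
    finally show ?thesis .
  qed
  then have "prob E = 0 \<or> prob E = 1" by (intro prob_tail_zero_one[OF indep])
  moreover have "prob E \<noteq> 0"
  proof
    assume "prob E = 0"
    have "(\<lambda>m. prob (D m)) \<longlonglongrightarrow> prob E"
      unfolding E_def using D_ev dec by (intro finite_Lim_measure_decseq) auto
    with \<open>prob E = 0\<close> have "\<forall>\<^sub>F m in sequentially. prob (D m) < 1 / 4"
      by (intro order_tendstoD) auto
    moreover have "\<forall>\<^sub>F k in sequentially. prob {\<omega> \<in> space M. b k < \<bar>X k \<omega>\<bar>} < 1 / 4"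
      by (intro order_tendstoD[OF small]) auto
    ultimately have "\<forall>\<^sub>F m in sequentially. prob (D m) < 1 / 4 \<and> prob {\<omega> \<in> space M. b m < \<bar>X m \<omega>\<bar>} < 1 / 4"
      by (rule eventually_conj)
    then obtain m0 where "\<forall>m\<ge>m0. prob (D m) < 1 / 4 \<and> prob {\<omega> \<in> space M. b m < \<bar>X m \<omega>\<bar>} < 1 / 4"
      unfolding eventually_sequentially by blast
    then have m0: "prob (D m) < 1 / 4" "prob {\<omega> \<in> space M. b m < \<bar>X m \<omega>\<bar>} < 1 / 4" if "m0 \<le> m" for m
      using that by blast+
    define m where "m = m0 + 2"
    \<comment> \<open>The three events: \<open>X k\<close> is large, \<open>R k\<close> is the rest of the window, and \<open>Q k\<close> says that it is moderate.\<close>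
    define F where "F k = {\<omega> \<in> space M. 3 * b k < \<bar>X k \<omega>\<bar>}" for k
    define R where "R k \<omega> = (\<Sum>j\<in>{k<..k - 1 + a (k - 1)}. X j \<omega>)" for k \<omega>
    define Q where "Q k = {\<omega> \<in> space M. \<bar>R k \<omega>\<bar> \<le> 2 * b k}" for k
    have TR: "T (k - 1) \<omega> = X k \<omega> + R k \<omega>" if "m \<le> k" for k \<omega>
    proof -
      have "0 < a (k - 1)" using that a[of "k - 1"] by (simp add: m_def)
      then have "{k - 1<..k - 1 + a (k - 1)} = insert k {k<..k - 1 + a (k - 1)}"
        using that by (auto simp: m_def)
      then show ?thesis by (simp add: T_def R_def)
    qed
    have F: "F k \<in> sets (history X {k})" for k
      using sets_history_Collect[OF measurable_history[of k "{k}" X], of "{x. 3 * b k < \<bar>x\<bar>}"] by (simp add: F_def)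
    have Q: "Q k \<in> sets (history X {k<..})" for k
      using sets_history_Collect[OF sum_meas[of "{k<..k - 1 + a (k - 1)}" "{k<..}"], of "{x. \<bar>x\<bar> \<le> 2 * b k}"]
      by (auto simp: Q_def R_def subset_eq)
    have Q_ev: "Q k \<in> events" for k by (rule hist_ev[OF Q]) auto
    have F_ev: "F k \<in> events" if "1 \<le> k" for k using hist_ev[OF F] that by auto
    have Q_half: "1 / 2 \<le> prob (Q k)" if k: "m \<le> k" for k
    proof -
      have "space M - Q k \<subseteq> D (k - 1) \<union> {\<omega> \<in> space M. b k < \<bar>X k \<omega>\<bar>}"
      proof
        fix \<omega> assume \<omega>: "\<omega> \<in> space M - Q k"
        then have "2 * b k < \<bar>R k \<omega>\<bar>" by (auto simp: Q_def)
        moreover have "b (k - 1) \<le> b k" using b(2) by (simp add: mono_def)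
        ultimately have "b (k - 1) < \<bar>T (k - 1) \<omega>\<bar> \<or> b k < \<bar>X k \<omega>\<bar>"
          unfolding TR[OF k] by linarith
        then show "\<omega> \<in> D (k - 1) \<union> {\<omega> \<in> space M. b k < \<bar>X k \<omega>\<bar>}"
          using \<omega> by (auto simp: D_def L_def)
      qed
      then have "prob (space M - Q k) \<le> prob (D (k - 1) \<union> {\<omega> \<in> space M. b k < \<bar>X k \<omega>\<bar>})"
        using k by (intro finite_measure_mono) (auto simp: m_def intro!: D_ev)
      also have "\<dots> \<le> prob (D (k - 1)) + prob {\<omega> \<in> space M. b k < \<bar>X k \<omega>\<bar>}"
        using k by (intro measure_Un_le) (auto simp: m_def intro!: D_ev)
      also have "\<dots> \<le> 1 / 4 + 1 / 4"
      proof (intro add_mono less_imp_le[OF m0(1)] less_imp_le[OF m0(2)])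
        show "m0 \<le> k - 1" "m0 \<le> k" using k by (simp_all add: m_def)
      qed
      finally show ?thesis using prob_compl[OF Q_ev[of k]] by simp
    qed
    obtain n where n: "1 / 2 \<le> prob (\<Union>k\<in>{m..n}. F k)"
      using prob_union_independent_ge_half[OF indep _ F div[folded F_def], of m] by (auto simp: m_def)
    have "1 / 2 * prob (\<Union>k\<in>{m..n}. F k) \<le> prob (\<Union>k\<in>{m..n}. F k \<inter> Q k)"
    proof (rule first_passage[OF indep])
      show "F k \<in> sets (history X {1..k})" if "k \<in> {m..n}" for k
        by (rule subsetD[OF sets_history_mono F]) (use that in \<open>auto simp: m_def\<close>)
    qed (use Q Q_half in \<open>auto simp: m_def\<close>)
    also have "\<dots> \<le> prob (D (m - 1))"
    proof (rule finite_measure_mono[OF _ D_ev], rule subsetI)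
      fix \<omega> assume "\<omega> \<in> (\<Union>k\<in>{m..n}. F k \<inter> Q k)"
      then obtain k where k: "m \<le> k" "\<omega> \<in> space M" "3 * b k < \<bar>X k \<omega>\<bar>" "\<bar>R k \<omega>\<bar> \<le> 2 * b k"
        by (auto simp: F_def Q_def)
      have "b (k - 1) \<le> b k" using b(2) by (simp add: mono_def)
      with k have "b (k - 1) < \<bar>T (k - 1) \<omega>\<bar>" unfolding TR[OF k(1)] by linarith
      moreover have "m - 1 \<le> k - 1" using k by simp
      ultimately show "\<omega> \<in> D (m - 1)" using k by (auto simp: D_def L_def)
    qed
    also have "\<dots> < 1 / 4" by (rule m0) (simp add: m_def)
    finally show False using n by simp
  qed
  ultimately have "prob E = 1" by blast
  moreover have "E \<in> events" unfolding E_def using D_ev by (intro sets.countable_INT) auto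
  ultimately have "AE \<omega> in M. \<omega> \<in> E" by (simp add: prob_eq_1)
  then show ?thesis
    by (rule AE_mp) (auto intro!: AE_I2 simp: E_def D_def L_def T)
qed

lemma limsup_window_infinite:
  fixes X :: "nat \<Rightarrow> 'a \<Rightarrow> real" and a :: "nat \<Rightarrow> nat" and b :: "nat \<Rightarrow> real"
  assumes indep: "indep_vars (\<lambda>_. borel) X {1..}"
    and b: "\<And>n. 0 < b n" "mono b" and a: "\<And>n. 1 \<le> n \<Longrightarrow> 0 < a n"
    and small: "\<And>c. 0 < c \<Longrightarrow> (\<lambda>k. prob {\<omega> \<in> space M. c * b k < \<bar>X k \<omega>\<bar>}) \<longlonglongrightarrow> 0"
    and div: "\<And>c. 0 < c \<Longrightarrow> \<not> summable (\<lambda>k. prob {\<omega> \<in> space M. c * b k < \<bar>X k \<omega>\<bar>})"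
  shows "AE \<omega> in M. limsup (\<lambda>n. ereal (\<bar>window X a n \<omega>\<bar> / b n)) = \<infinity>"
proof -
  have "AE \<omega> in M. \<forall>i::nat. \<forall>m. \<exists>n\<ge>m. real (Suc i) * b n < \<bar>window X a n \<omega>\<bar>"
  proof (rule AE_all_countable[THEN iffD2], rule allI)
    fix i :: nat
    show "AE \<omega> in M. \<forall>m. \<exists>n\<ge>m. real (Suc i) * b n < \<bar>window X a n \<omega>\<bar>"
    proof (rule frequently_large_window[OF indep _ _ a])
      show "0 < real (Suc i) * b n" for n using b(1)[of n] by simp
      show "mono (\<lambda>n. real (Suc i) * b n)" using b(2) by (simp add: mono_def mult_left_mono)
      show "(\<lambda>k. prob {\<omega> \<in> space M. real (Suc i) * b k < \<bar>X k \<omega>\<bar>}) \<longlonglongrightarrow> 0" by (rule small) simp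
      show "\<not> summable (\<lambda>k. prob {\<omega> \<in> space M. 3 * (real (Suc i) * b k) < \<bar>X k \<omega>\<bar>})"
        unfolding mult.assoc[symmetric] by (rule div) simp
    qed
  qed
  then show ?thesis
  proof (rule AE_mp, intro AE_I2 impI)
    fix \<omega>
    let ?u = "\<lambda>n. \<bar>window X a n \<omega>\<bar> / b n"
    assume *: "\<forall>i::nat. \<forall>m. \<exists>n\<ge>m. real (Suc i) * b n < \<bar>window X a n \<omega>\<bar>"
    have le: "ereal (real (Suc i)) \<le> limsup (\<lambda>n. ereal (?u n))" for i
      unfolding limsup_INF_SUP
    proof (rule INF_greatest)
      fix m
      obtain n where "m \<le> n" "real (Suc i) * b n < \<bar>window X a n \<omega>\<bar>" using * by blast
      then have "real (Suc i) \<le> ?u n" using b(1)[of n] by (simp add: le_divide_eq)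
      then show "ereal (real (Suc i)) \<le> (SUP n\<in>{m..}. ereal (?u n))"
        using \<open>m \<le> n\<close> by (intro SUP_upper2[of n]) auto
    qed
    then show "limsup (\<lambda>n. ereal (?u n)) = \<infinity>"
    proof (intro ereal_top)
      fix B :: real
      obtain i where "B \<le> real i" using real_arch_simple by blast
      then have "ereal B \<le> ereal (real (Suc i))" by simp
      also have "\<dots> \<le> limsup (\<lambda>n. ereal (?u n))" by (rule le)
      finally show "ereal B \<le> limsup (\<lambda>n. ereal (?u n))" .
    qed
  qed
qed

end

section \<open>Sums along the indices of one type\<close>

text \<open>
  Summation by parts in the form of an invariant: with \<open>Z\<close> the partial sums of \<open>z\<close>, the inequality
  \<open>(Z n + C) * w n - C * w 1 \<le> (\<Sum>k=1..n. z k * w k)\<close> persists from \<open>n\<close> to \<open>n + 1\<close>, because \<open>Z n + C\<close>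
  is nonnegative and \<open>w\<close> decreases.
\<close>
lemma summation_by_parts_ge:
  fixes z w :: "nat \<Rightarrow> real"
  assumes Z: "\<And>n. - C \<le> (\<Sum>k=1..n. z k)" and C: "0 \<le> C"
    and w: "\<And>k. 1 \<le> k \<Longrightarrow> 0 \<le> w k" "\<And>k. 1 \<le> k \<Longrightarrow> w (Suc k) \<le> w k"
  shows "- C * w 1 \<le> (\<Sum>k=1..n. z k * w k)"
proof (cases "n = 0")
  case True
  then show ?thesis using C w(1)[of 1] by simp
next
  case False
  then have "1 \<le> n" by simp
  have "((\<Sum>k=1..n. z k) + C) * w n - C * w 1 \<le> (\<Sum>k=1..n. z k * w k)"
    using \<open>1 \<le> n\<close>
  proof (induction n rule: dec_induct)
    case base
    show ?case by (simp add: algebra_simps)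
  next
    case (step n)
    have "((\<Sum>k=1..n. z k) + C) * w (Suc n) \<le> ((\<Sum>k=1..n. z k) + C) * w n"
      using Z[of n] w(2)[OF step.hyps(1)] by (intro mult_left_mono) auto
    then show ?case using step.IH by (simp add: algebra_simps)
  qed
  moreover have "0 \<le> ((\<Sum>k=1..n. z k) + C) * w n"
    using Z[of n] w(1)[OF \<open>1 \<le> n\<close>] by simp
  ultimately show ?thesis by linarith
qed

lemma summation_by_parts_compare:
  fixes u v w :: "nat \<Rightarrow> real"
  assumes "\<And>n. c * (\<Sum>k=1..n. v k) - C \<le> (\<Sum>k=1..n. u k)" and "0 \<le> C"
    and "\<And>k. 1 \<le> k \<Longrightarrow> 0 \<le> w k" "\<And>k. 1 \<le> k \<Longrightarrow> w (Suc k) \<le> w k"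
  shows "c * (\<Sum>k=1..n. v k * w k) - C * w 1 \<le> (\<Sum>k=1..n. u k * w k)"
proof -
  have "- C \<le> (\<Sum>k=1..n. u k - c * v k)" for n
    using assms(1)[of n] by (simp add: sum_subtractf sum_distrib_left)
  from summation_by_parts_ge[of C "\<lambda>k. u k - c * v k" w n, OF this assms(2-4)]
  show ?thesis by (simp add: sum_subtractf sum_distrib_left algebra_simps)
qed

lemma summable_iff_bounded_sums:
  fixes g :: "nat \<Rightarrow> real"
  assumes "\<And>k. 1 \<le> k \<Longrightarrow> 0 \<le> g k"
  shows "summable g \<longleftrightarrow> (\<exists>B. \<forall>n. (\<Sum>k=1..n. g k) \<le> B)"
proof -
  have e: "(\<Sum>k=1..n. g k) = (\<Sum>k<n. g (Suc k))" for n
    by (rule sum.reindex_bij_witness[where i=Suc and j="\<lambda>k. k - 1"]) auto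
  have "summable g \<longleftrightarrow> summable (\<lambda>k. g (Suc k))" by (rule summable_Suc_iff[symmetric])
  also have "\<dots> \<longleftrightarrow> (\<exists>B. \<forall>n. (\<Sum>k<n. g (Suc k)) \<le> B)"
  proof
    assume s: "summable (\<lambda>k. g (Suc k))"
    show "\<exists>B. \<forall>n. (\<Sum>k<n. g (Suc k)) \<le> B"
      using assms by (intro exI[of _ "\<Sum>k. g (Suc k)"] allI sum_le_suminf[OF s]) auto
  next
    assume "\<exists>B. \<forall>n. (\<Sum>k<n. g (Suc k)) \<le> B"
    then obtain B where "\<And>n. (\<Sum>k<n. g (Suc k)) \<le> B" by blast
    then show "summable (\<lambda>k. g (Suc k))"
      using assms by (intro summableI_nonneg_bounded[where x=B]) auto
  qed
  finally show ?thesis by (simp only: e)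
qed

definition count_upto :: "nat set \<Rightarrow> nat \<Rightarrow> nat" where
  "count_upto K n = card (K \<inter> {1..n})"

lemma count_upto_0 [simp]: "count_upto K 0 = 0"
  by (simp add: count_upto_def)

lemma count_upto_Suc: "count_upto K (Suc n) = (if Suc n \<in> K then Suc (count_upto K n) else count_upto K n)"
proof -
  have "K \<inter> {1..Suc n} = (if Suc n \<in> K then insert (Suc n) (K \<inter> {1..n}) else K \<inter> {1..n})"
    by (auto simp: le_Suc_eq)
  then show ?thesis by (simp add: count_upto_def)
qed

lemma count_upto_mono: "m \<le> n \<Longrightarrow> count_upto K m \<le> count_upto K n"
  unfolding count_upto_def by (intro card_mono) auto

lemma count_upto_le: "count_upto K n \<le> n"
  unfolding count_upto_def using card_mono[of "{1..n}" "K \<inter> {1..n}"] by simp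

lemma count_upto_add_le: "count_upto K (n + m) \<le> count_upto K n + m"
  by (induction m) (auto simp: count_upto_Suc)

lemma count_upto_subset: "K \<subseteq> L \<Longrightarrow> count_upto K n \<le> count_upto L n"
  unfolding count_upto_def by (intro card_mono) auto

text \<open>
  As \<open>k\<close> runs through the elements of \<open>K\<close>, the count takes the values 1, 2, 3 and so on.
\<close>
lemma sum_inverse_count: "(\<Sum>k=1..n. (if k \<in> K then 1 / real (count_upto K k) else 0)) = harm (count_upto K n)"
proof (induction n)
  case (Suc n)
  then show ?case by (simp add: count_upto_Suc harm_Suc inverse_eq_divide)
qed (simp add: harm_def)

text \<open>
  The partial sums of the reciprocal counts are harmonic numbers of \<open>count_upto K n \<le> n\<close>, hence at most
  those of \<open>1 / k\<close>; a decreasing weight preserves this comparison.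
\<close>
lemma summable_over_count:
  fixes w :: "nat \<Rightarrow> real"
  assumes w: "\<And>k. 1 \<le> k \<Longrightarrow> 0 \<le> w k" "\<And>k. 1 \<le> k \<Longrightarrow> w (Suc k) \<le> w k"
    and sum: "summable (\<lambda>k. w k / k)"
  shows "summable (\<lambda>k. if k \<in> K then w k / count_upto K k else 0)"
proof -
  let ?v = "\<lambda>k. if k \<in> K then 1 / real (count_upto K k) else 0"
  obtain B where B: "\<And>n. (\<Sum>k=1..n. w k / k) \<le> B"
    using sum w(1) by (subst (asm) summable_iff_bounded_sums) auto
  have "1 * (\<Sum>k=1..n. ?v k) - 0 \<le> (\<Sum>k=1..n. 1 / real k)" for n
    using harm_mono[OF count_upto_le[of K n], where 'a=real] unfolding sum_inverse_count
    by (simp add: harm_def inverse_eq_divide)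
  note cmp = summation_by_parts_compare[where w=w, OF this order_refl w]
  have cmp: "1 * (\<Sum>k=1..n. ?v k * w k) - 0 * w 1 \<le> (\<Sum>k=1..n. 1 / real k * w k)" for n
    by (rule cmp)
  have "(\<Sum>k=1..n. ?v k * w k) \<le> B" for n
    using cmp[of n] B[of n] by simp
  then have "summable (\<lambda>k. ?v k * w k)"
    using w(1) by (subst summable_iff_bounded_sums) auto
  then show ?thesis by (rule summable_cong[THEN iffD1, rotated]) (auto intro: always_eventually)
qed

text \<open>
  Conversely, if the count grows at least like the power \<open>r\<close> of \<open>n\<close>, its harmonic number is at least
  \<open>r\<close> times that of \<open>n\<close>, up to a constant. It is only the logarithm of the count that matters here, and
  this is why even a sparse set of indices detects the divergence.
\<close>
lemma not_summable_over_count: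
  fixes w :: "nat \<Rightarrow> real"
  assumes w: "\<And>k. 1 \<le> k \<Longrightarrow> 0 \<le> w k" "\<And>k. 1 \<le> k \<Longrightarrow> w (Suc k) \<le> w k"
    and nsum: "\<not> summable (\<lambda>k. w k / k)"
    and cnt: "0 < c" "0 < r" "\<forall>\<^sub>F n in sequentially. c * real n powr r \<le> count_upto K n"
  shows "\<not> summable (\<lambda>k. if k \<in> K then w k / count_upto K k else 0)"
proof
  assume s: "summable (\<lambda>k. if k \<in> K then w k / count_upto K k else 0)"
  let ?v = "\<lambda>k. if k \<in> K then 1 / real (count_upto K k) else 0"
  have "(\<lambda>k. ?v k * w k) = (\<lambda>k. if k \<in> K then w k / count_upto K k else 0)" by auto
  with s have "summable (\<lambda>k. ?v k * w k)" by simp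
  then obtain B where B: "\<And>n. (\<Sum>k=1..n. ?v k * w k) \<le> B"
    using w(1) by (subst (asm) summable_iff_bounded_sums) auto
  obtain N where N: "\<And>n. N \<le> n \<Longrightarrow> c * real n powr r \<le> count_upto K n"
    using cnt(3) by (auto simp: eventually_sequentially)
  \<comment> \<open>The first term takes care of \<open>n < N\<close>, the second of the additive constants for \<open>n \<ge> N\<close>.\<close>
  define C where "C = r * harm N + \<bar>r - ln c\<bar>"
  have C: "0 \<le> C" using cnt by (simp add: C_def harm_nonneg)
  have "r * (\<Sum>k=1..n. 1 / real k) - C \<le> (\<Sum>k=1..n. ?v k)" for n
  proof -
    have h: "(\<Sum>k=1..n. 1 / real k) = harm n" by (simp add: harm_def inverse_eq_divide)
    have "r * harm n - C \<le> harm (count_upto K n)"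
    proof (cases "N \<le> n \<and> 1 \<le> n")
      case True
      have "0 < c * real n powr r" using True cnt by simp
      then have pos: "0 < real (count_upto K n)" using N[of n] True by linarith
      have "harm n \<le> ln (real n) + 1" 
        using euler_mascheroni_sequence_decreasing[of 1 n] True by (simp add: harm_def)
      then have "r * harm n \<le> r * (ln (real n) + 1)" using cnt by (intro mult_left_mono) auto
      also have "\<dots> = ln (c * real n powr r) + (r - ln c)"
        using True cnt by (simp add: ln_mult ln_powr algebra_simps)
      also have "ln (c * real n powr r) \<le> ln (real (count_upto K n))"
        using N[of n] True \<open>0 < c * real n powr r\<close> pos by simp
      also have "\<dots> \<le> ln (real (count_upto K n) + 1)" using pos by simp
      also have "\<dots> \<le> harm (count_upto K n)" by (rule ln_le_harm)
      also have "r - ln c \<le> C" using cnt by (simp add: C_def add_increasing harm_nonneg)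
      finally show ?thesis by simp
    next
      case False
      then have "n \<le> N" by auto
      then have "r * harm n \<le> r * harm N" using cnt by (intro mult_left_mono harm_mono) auto
      also have "\<dots> \<le> C" by (simp add: C_def)
      finally show ?thesis using harm_nonneg[of "count_upto K n", where 'a=real] by linarith
    qed
    then show ?thesis unfolding sum_inverse_count h .
  qed
  note cmp = summation_by_parts_compare[where w=w, OF this C w]
  have cmp: "r * (\<Sum>k=1..n. 1 / real k * w k) - C * w 1 \<le> (\<Sum>k=1..n. ?v k * w k)" for n
    by (rule cmp)
  have "r * (\<Sum>k=1..n. w k / k) \<le> B + C * w 1" for n
    using cmp[of n] B[of n] by simp
  then have "(\<Sum>k=1..n. w k / k) \<le> (B + C * w 1) / r" for n
    using cnt(2) by (simp add: le_divide_eq mult.commute)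
  then have "summable (\<lambda>k. w k / k)"
    using w(1) by (subst summable_iff_bounded_sums) auto
  with nsum show False ..
qed

lemma summable_bertrand:
  assumes p: "1 < p"
  shows "summable (\<lambda>k. ln (real k) powr - p / real k)"
proof -
  \<comment> \<open>At \<open>k = 1\<close> the term is zero, which would spoil monotonicity.\<close>
  let ?g = "\<lambda>k::nat. ln (real (max 2 k)) powr - p / real (max 2 k)"
  have pos: "0 < ln (real (max 2 k))" for k by (simp add: max_def)
  have "summable ?g"
  proof (rule condensation_test[THEN iffD2])
    show "?g (Suc n) \<le> ?g n" for n
    proof -
      have le: "real (max 2 n) \<le> real (max 2 (Suc n))" and gt: "0 < real (max 2 n)" by auto
      have "ln (real (max 2 n)) \<le> ln (real (max 2 (Suc n)))" using le gt by simp
      then have "ln (real (max 2 (Suc n))) powr - p \<le> ln (real (max 2 n)) powr - p"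
        using p pos[of n] by (intro powr_mono2') auto
      then show ?thesis using le gt by (intro frac_le) auto
    qed
    show "0 \<le> ?g n" for n by simp
    have "summable (\<lambda>n. ln 2 powr - p * real n powr - p)"
      using p by (intro summable_mult) (simp add: summable_real_powr_iff)
    then show "summable (\<lambda>n. 2 ^ n * ?g (2 ^ n))"
    proof (rule summable_comparison_test'[where N=1])
      fix n :: nat assume n: "1 \<le> n"
      then have "2 ^ 1 \<le> (2::nat) ^ n" by (intro power_increasing) auto
      then have "max 2 (2 ^ n) = (2::nat) ^ n" by simp
      moreover have "ln ((2::real) ^ n) = real n * ln 2" by (simp add: ln_realpow)
      ultimately show "norm (2 ^ n * ?g (2 ^ n)) \<le> ln 2 powr - p * real n powr - p"
        using n by (simp add: powr_mult)
    qed
  qed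
  then show ?thesis
    by (rule summable_cong[THEN iffD1, rotated])
      (auto intro!: eventually_mono[OF eventually_ge_at_top[of 2]] simp: max_def)
qed

text \<open>
  The sum of \<open>1 / k\<close> over \<open>m < k \<le> n\<close> is at most \<open>f n\<close> times the sum of \<open>1 / (k * f k)\<close> over the same
  range, and the latter is small for large \<open>m\<close>. So \<open>ln n\<close> is negligible compared with \<open>f n\<close>.
\<close>
lemma summable_imp_tendsto_infinity:
  fixes f :: "nat \<Rightarrow> real"
  assumes f: "\<And>n. 1 \<le> n \<Longrightarrow> 0 < f n" "\<And>m n. 1 \<le> m \<Longrightarrow> m \<le> n \<Longrightarrow> f m \<le> f n"
    and sum: "summable (\<lambda>n. 1 / (real n * f n))"
  shows "filterlim f at_top sequentially" and "(\<lambda>n. ln (real n) / f n) \<longlonglongrightarrow> 0"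
proof -
  let ?h = "\<lambda>n. 1 / (real n * f n)"
  have key: "\<exists>m\<ge>1. \<forall>n\<ge>m. harm n - harm m \<le> \<epsilon> * f n" if \<epsilon>: "0 < \<epsilon>" for \<epsilon>
  proof -
    have "(\<lambda>m. \<Sum>i. ?h (i + m)) \<longlonglongrightarrow> 0" by (rule suminf_exist_split2[OF sum])
    then have "\<forall>\<^sub>F m in sequentially. (\<Sum>i. ?h (i + m)) < \<epsilon>" by (rule order_tendstoD) (rule \<epsilon>)
    then obtain m0 where m0: "\<And>m. m0 \<le> m \<Longrightarrow> (\<Sum>i. ?h (i + m)) < \<epsilon>" by (auto simp: eventually_sequentially)
    define m where "m = max 1 m0"
    have hm: "(\<Sum>i. ?h (i + m)) < \<epsilon>" by (rule m0) (simp add: m_def)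
    have m1: "1 \<le> m" by (simp add: m_def)
    have "harm n - harm m \<le> \<epsilon> * f n" if n: "m \<le> n" for n
    proof -
      have fn: "0 < f n" using f(1) n m1 by auto
      have "{1..n} = {1..m} \<union> {m<..n}" using n m1 by auto
      then have "harm n = harm m + (\<Sum>k\<in>{m<..n}. inverse (real k))"
        unfolding harm_def by (simp only:) (rule sum.union_disjoint, auto)
      also have "(\<Sum>k\<in>{m<..n}. inverse (real k)) \<le> (\<Sum>k\<in>{m<..n}. ?h k * f n)"
      proof (rule sum_mono)
        fix k assume k: "k \<in> {m<..n}"
        then have "0 < f k" "f k \<le> f n" "0 < real k" using f m1 by auto
        then show "inverse (real k) \<le> ?h k * f n" by (simp add: field_simps)
      qed
      also have "\<dots> = (\<Sum>k\<in>{m<..n}. ?h k) * f n" by (simp add: sum_distrib_right)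
      also have "\<dots> \<le> \<epsilon> * f n"
      proof (rule mult_right_mono)
        have "(\<Sum>k\<in>{m<..n}. ?h k) \<le> (\<Sum>k\<in>{m..<n + 1 + m}. ?h k)"
          using f(1) m1 by (intro sum_mono2) (auto intro!: mult_nonneg_nonneg simp: less_imp_le)
        also have "\<dots> = (\<Sum>i<n + 1. ?h (i + m))"
          by (rule sum.reindex_bij_witness[where i="\<lambda>i. i + m" and j="\<lambda>j. j - m"]) auto
        also have "\<dots> \<le> (\<Sum>i. ?h (i + m))"
          using sum f(1) m1
          by (intro sum_le_suminf summable_ignore_initial_segment) (auto intro!: mult_nonneg_nonneg simp: less_imp_le)
        finally show "(\<Sum>k\<in>{m<..n}. ?h k) \<le> \<epsilon>" using hm by simp
      qed (use fn in simp)
      finally show ?thesis by simp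
    qed
    then show ?thesis using m1 by blast
  qed
  have harm_top: "filterlim (harm :: nat \<Rightarrow> real) at_top sequentially"
    by (rule harm_at_top)
  show top: "filterlim f at_top sequentially"
  proof -
    obtain m where m: "\<And>n. m \<le> n \<Longrightarrow> harm n - harm m \<le> 1 * f n" using key[of 1] by auto
    have "filterlim (\<lambda>n. - harm m + harm n :: real) at_top sequentially"
      by (rule filterlim_tendsto_add_at_top[OF tendsto_const harm_top])
    then show ?thesis
      by (rule filterlim_at_top_mono) (use m in \<open>auto simp: eventually_sequentially\<close>)
  qed
  show "(\<lambda>n. ln (real n) / f n) \<longlonglongrightarrow> 0"
  proof (rule LIMSEQ_I)
    fix e :: real assume e: "0 < e"
    obtain m where m: "1 \<le> m" "\<And>n. m \<le> n \<Longrightarrow> harm n - harm m \<le> e / 2 * f n" using key[of "e / 2"] e by auto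
    have "\<forall>\<^sub>F n in sequentially. 2 * harm m / e < f n" using top by (auto simp: filterlim_at_top_dense)
    then obtain N where N: "\<And>n. N \<le> n \<Longrightarrow> 2 * harm m / e < f n" by (auto simp: eventually_sequentially)
    have "norm (ln (real n) / f n - 0) < e" if n: "max m N \<le> n" for n
    proof -
      have fn: "0 < f n" using n m f(1)[of n] by auto
      have "ln (real n) \<le> ln (real n + 1)" using n m by simp
      also have "\<dots> \<le> harm n" by (rule ln_le_harm)
      also have "\<dots> \<le> harm m + e / 2 * f n" using m(2)[of n] n by simp
      also have "harm m < e / 2 * f n" using N[of n] n e by (simp add: field_simps)
      finally have "ln (real n) < e * f n" by simp
      moreover have "0 \<le> ln (real n)" using n m by simp
      ultimately show ?thesis using fn by (simp add: divide_less_eq)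
    qed
    then show "\<exists>no. \<forall>n\<ge>no. norm (ln (real n) / f n - 0) < e" by blast
  qed
qed

text \<open>
  The integrand is compared with step functions that are constant between consecutive integers.
\<close>
lemma integral_test:
  fixes f :: "real \<Rightarrow> real"
  assumes f: "\<And>x. 1 \<le> x \<Longrightarrow> 0 < f x" and mono: "mono_on {1..} f"
  shows "(\<integral>\<^sup>+x\<in>{1..}. ennreal (1 / (x * f x)) \<partial>lborel) < \<infinity> \<longleftrightarrow> summable (\<lambda>n. 1 / (real n * f (real n)))"
proof -
  let ?h = "\<lambda>x. 1 / (x * f x)"
  let ?I = "\<integral>\<^sup>+x\<in>{1..}. ennreal (?h x) \<partial>lborel"
  have hpos: "0 < ?h x" if "1 \<le> x" for x using f[OF that] that by simp
  have anti: "?h y \<le> ?h x" if "1 \<le> x" "x \<le> y" for x y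
    using f[OF that(1)] mono_onD[OF mono, of x y] that by (intro divide_left_mono mult_mono mult_pos_pos) (auto intro: f less_imp_le)
  define A where "A = (\<lambda>n::nat. {real n + 1..<real n + 2})"
  have step: "(\<Sum>n. ennreal (c n) * indicator (A n) x) = (if 1 \<le> x then ennreal (c (nat (\<lfloor>x\<rfloor> - 1))) else 0)" for c :: "nat \<Rightarrow> real" and x :: real
  proof (cases "1 \<le> x")
    case True
    define m where "m = nat (\<lfloor>x\<rfloor> - 1)"
    have "1 \<le> \<lfloor>x\<rfloor>" using True by simp
    then have m: "real m = of_int \<lfloor>x\<rfloor> - 1" by (simp add: m_def)
    have "x \<in> A n \<longleftrightarrow> n = m" for n
    proof
      assume "x \<in> A n"
      then have "\<lfloor>x\<rfloor> = int n + 1" unfolding A_def by (intro floor_unique) auto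
      then show "n = m" using m by simp
    next
      assume "n = m"
      then have "real n + 1 \<le> x" "x < real n + 2" using m floor_correct[of x] by linarith+
      then show "x \<in> A n" by (simp add: A_def)
    qed
    then have "(\<lambda>n. ennreal (c n) * indicator (A n) x) = (\<lambda>n. if n = m then ennreal (c m) else 0)"
      by (auto simp: indicator_def)
    moreover have "(\<Sum>n. if n = m then ennreal (c m) else 0) = ennreal (c m)"
      using suminf_finite[of "{m}" "\<lambda>n. if n = m then ennreal (c m) else 0"] by simp
    ultimately show ?thesis using True by (simp add: m_def)
  next
    case False
    then have "x \<notin> A n" for n by (auto simp: A_def)
    then show ?thesis using False by simp
  qed
  have int: "(\<integral>\<^sup>+x. (\<Sum>n. ennreal (c n) * indicator (A n) x) \<partial>lborel) = (\<Sum>n. ennreal (c n))" for c :: "nat \<Rightarrow> real"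
  proof -
    have "emeasure lborel (A n) = 1" for n by (simp add: A_def)
    then show ?thesis
      by (subst nn_integral_suminf) (auto simp: nn_integral_cmult_indicator A_def)
  qed
  have fl: "real (nat (\<lfloor>x\<rfloor> - 1)) + 1 = of_int \<lfloor>x\<rfloor>" if "1 \<le> x" for x :: real
  proof -
    have "1 \<le> \<lfloor>x\<rfloor>" using that by simp
    then show ?thesis by simp
  qed
  have up: "?I \<le> (\<Sum>n. ennreal (?h (real n + 1)))"
    unfolding int[symmetric] step
  proof (intro nn_integral_mono)
    fix x :: real
    show "ennreal (?h x) * indicator {1..} x \<le> (if 1 \<le> x then ennreal (?h (real (nat (\<lfloor>x\<rfloor> - 1)) + 1)) else 0)"
      using anti[of "of_int \<lfloor>x\<rfloor>" x] fl[of x] by (auto intro!: ennreal_leI split: split_indicator)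
  qed
  have low: "(\<Sum>n. ennreal (?h (real n + 2))) \<le> ?I"
    unfolding int[symmetric] step
  proof (intro nn_integral_mono)
    fix x :: real
    have "real (nat (\<lfloor>x\<rfloor> - 1)) + 2 = of_int \<lfloor>x\<rfloor> + 1" if "1 \<le> x" using fl[OF that] by simp
    moreover have "x \<le> 1 + of_int \<lfloor>x\<rfloor>" by linarith
    ultimately show "(if 1 \<le> x then ennreal (?h (real (nat (\<lfloor>x\<rfloor> - 1)) + 2)) else 0) \<le> ennreal (?h x) * indicator {1..} x"
      using anti[of x "1 + of_int \<lfloor>x\<rfloor>"] by (auto intro!: ennreal_leI split: split_indicator)
  qed
  have fin: "(\<Sum>n. ennreal (?h (real (n + i)))) < \<infinity> \<longleftrightarrow> summable (\<lambda>n. ?h (real n))" if i: "1 \<le> i" for i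
  proof -
    define g where "g = (\<lambda>n. ?h (real (n + i)))"
    have nn: "0 \<le> g n" for n using hpos[of "real (n + i)"] i by (simp add: g_def)
    have "summable (\<lambda>n. ?h (real n)) \<longleftrightarrow> summable g"
      unfolding g_def by (rule summable_iff_shift[symmetric])
    also have "\<dots> \<longleftrightarrow> (\<Sum>n. ennreal (g n)) \<noteq> top"
      using summable_suminf_not_top[of g, OF nn] ennreal_suminf_neq_top[of g, OF _ nn] by blast
    finally show ?thesis by (simp only: g_def less_top infinity_ennreal_def)
  qed
  have e1: "(\<Sum>n. ennreal (?h (real n + 1))) = (\<Sum>n. ennreal (?h (real (n + 1))))"
    and e2: "(\<Sum>n. ennreal (?h (real n + 2))) = (\<Sum>n. ennreal (?h (real (n + 2))))"
    by (simp_all only: of_nat_add of_nat_1 of_nat_numeral)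
  show ?thesis
  proof
    assume "?I < \<infinity>"
    with low have "(\<Sum>n. ennreal (?h (real (n + 2)))) < \<infinity>" unfolding e2 by (rule le_less_trans)
    then show "summable (\<lambda>n. ?h (real n))" by (rule iffD1[OF fin[of 2], rotated]) simp
  next
    assume "summable (\<lambda>n. ?h (real n))"
    then have "(\<Sum>n. ennreal (?h (real (n + 1)))) < \<infinity>" by (rule iffD2[OF fin[OF order_refl]])
    with up show "?I < \<infinity>" unfolding e1 by (rule le_less_trans)
  qed
qed

section \<open>Windows of sums with two types of summands\<close>

text \<open>
  The norming sequences that occur may vanish for small \<open>n\<close>, as long as one type has not appeared
  yet. A limit superior does not see the change made here.
\<close>
lemma eventually_norming_extend:
  fixes b :: "nat \<Rightarrow> real"
  assumes pos: "\<And>n. n0 \<le> n \<Longrightarrow> 0 < b n" and mono: "\<And>m n. n0 \<le> m \<Longrightarrow> m \<le> n \<Longrightarrow> b m \<le> b n"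
    and top: "filterlim b at_top sequentially"
  shows "\<exists>b'. (\<forall>n. 0 < b' n) \<and> mono b' \<and> filterlim b' at_top sequentially \<and> (\<forall>\<^sub>F n in sequentially. b' n = b n)"
proof (intro exI conjI allI)
  let ?b = "\<lambda>n. b (max n n0)"
  show "0 < ?b n" for n by (rule pos) simp
  show "mono ?b" by (intro monoI mono) auto
  show ev: "\<forall>\<^sub>F n in sequentially. ?b n = b n"
    by (rule eventually_mono[OF eventually_ge_at_top[of n0]]) (simp add: max_def)
  show "filterlim ?b at_top sequentially" by (rule filterlim_cong[THEN iffD2, OF refl refl ev top])
qed

abbreviation (input) type_series :: "nat set \<Rightarrow> (nat \<Rightarrow> real) \<Rightarrow> real \<Rightarrow> bool" where
  "type_series K b \<alpha> \<equiv> summable (\<lambda>k. if k \<in> K then b k powr - \<alpha> else 0)"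

context prob_space
begin

abbreviation (input) exceeds :: "(nat \<Rightarrow> 'a \<Rightarrow> real) \<Rightarrow> nat \<Rightarrow> real \<Rightarrow> 'a set" where
  "exceeds X k c \<equiv> {\<omega> \<in> space M. c < \<bar>X k \<omega>\<bar>}"

abbreviation (input) cut_mean :: "(nat \<Rightarrow> 'a \<Rightarrow> real) \<Rightarrow> (nat \<Rightarrow> real) \<Rightarrow> nat \<Rightarrow> real" where
  "cut_mean X b k \<equiv> expectation (\<lambda>\<omega>. X k \<omega> * indicator {x. \<bar>x\<bar> \<le> b k} (X k \<omega>))"

abbreviation (input) cut_second_moment :: "(nat \<Rightarrow> 'a \<Rightarrow> real) \<Rightarrow> (nat \<Rightarrow> real) \<Rightarrow> nat \<Rightarrow> real" where
  "cut_second_moment X b k \<equiv> expectation (\<lambda>\<omega>. (X k \<omega>)\<^sup>2 * indicator {x. \<bar>x\<bar> \<le> b k} (X k \<omega>))"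

lemma prob_tail_law:
  fixes Y :: "'a \<Rightarrow> real"
  assumes "random_variable borel Y" and "distr M borel Y = G"
  shows "prob {\<omega> \<in> space M. c < \<bar>Y \<omega>\<bar>} = measure G {y. c < \<bar>y\<bar>}"
    and "prob {\<omega> \<in> space M. c \<le> \<bar>Y \<omega>\<bar>} = abs_tail G c"
proof -
  have "{y::real. c < \<bar>y\<bar>} \<in> sets borel" "{y::real. c \<le> \<bar>y\<bar>} \<in> sets borel" by measurable
  note m = measure_distr[OF assms(1) this(1)] measure_distr[OF assms(1) this(2)]
  show "prob {\<omega> \<in> space M. c < \<bar>Y \<omega>\<bar>} = measure G {y. c < \<bar>y\<bar>}"
    unfolding assms(2)[symmetric] m by (rule arg_cong[where f=prob]) auto
  show "prob {\<omega> \<in> space M. c \<le> \<bar>Y \<omega>\<bar>} = abs_tail G c"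
    unfolding assms(2)[symmetric] m by (rule arg_cong[where f=prob]) auto
qed

text \<open>
  For the indices of one type all three requirements of \<open>sum_over_norming_tendsto_0\<close> reduce to the
  series of \<open>b k powr - \<alpha>\<close>; for the drift, when \<open>\<alpha> \<noteq> 1\<close>, through the Kronecker lemma. For \<open>\<alpha> = 1\<close> the
  truncated means, which are at most a multiple of \<open>ln (b k)\<close>, are summed directly.
\<close>
lemma type_sums:
  fixes X :: "nat \<Rightarrow> 'a \<Rightarrow> real"
  assumes bounds: "stable_type_bounds G \<alpha> C"
    and rv: "\<And>k. k \<in> K \<Longrightarrow> random_variable borel (X k)"
    and law: "\<And>k. k \<in> K \<Longrightarrow> distr M borel (X k) = G"
    and pos: "\<And>n. 0 < b n" and mono: "mono b" and top: "filterlim b at_top sequentially"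
    and sum: "type_series K b \<alpha>"
    and log: "\<alpha> = 1 \<Longrightarrow> (\<lambda>n. count_upto K n * ln (b n) / b n) \<longlonglongrightarrow> 0"
  shows "summable (\<lambda>k. if k \<in> K then prob (exceeds X k (b k)) else 0)"
    and "summable (\<lambda>k. if k \<in> K then cut_second_moment X b k / (b k)\<^sup>2 else 0)"
    and "(\<lambda>n. (\<Sum>k=1..n. if k \<in> K then cut_mean X b k else 0) / b n) \<longlonglongrightarrow> 0"
proof -
  have C: "1 \<le> C" using bounds by (simp add: stable_type_bounds_def)
  have sumC: "summable (\<lambda>k. C * (if k \<in> K then b k powr - \<alpha> else 0))" by (rule summable_mult[OF sum])
  show "summable (\<lambda>k. if k \<in> K then prob (exceeds X k (b k)) else 0)"
  proof (rule summable_comparison_test'[OF sumC])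
    fix k
    show "norm (if k \<in> K then prob (exceeds X k (b k)) else 0) \<le> C * (if k \<in> K then b k powr - \<alpha> else 0)"
    proof (cases "k \<in> K")
      case True
      have "prob (exceeds X k (b k)) \<le> prob {\<omega> \<in> space M. b k \<le> \<bar>X k \<omega>\<bar>}"
        using rv[OF True] by (intro finite_measure_mono) auto
      also have "\<dots> = abs_tail G (b k)" by (rule prob_tail_law[OF rv[OF True] law[OF True]])
      also have "\<dots> \<le> C * b k powr - \<alpha>" using bounds pos by (simp add: stable_type_bounds_def)
      finally show ?thesis using True by simp
    qed simp
  qed
  have second: "cut_second_moment X b k = truncated_second_moment G (b k)"
    and first: "cut_mean X b k = truncated_mean G (b k)"
    if "k \<in> K" for k
    unfolding law[OF that, symmetric] using rv[OF that] by (subst integral_distr; simp)+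
  show "summable (\<lambda>k. if k \<in> K then cut_second_moment X b k / (b k)\<^sup>2 else 0)"
  proof (rule summable_comparison_test'[OF sumC])
    fix k
    show "norm (if k \<in> K then cut_second_moment X b k / (b k)\<^sup>2 else 0) \<le> C * (if k \<in> K then b k powr - \<alpha> else 0)"
    proof (cases "k \<in> K")
      case True
      have "truncated_second_moment G (b k) / (b k)\<^sup>2 \<le> C * b k powr (2 - \<alpha>) / (b k)\<^sup>2"
        using bounds pos[of k] by (intro divide_right_mono) (auto simp: stable_type_bounds_def)
      also have "\<dots> = C * b k powr - \<alpha>"
        using pos[of k] by (simp add: powr_diff powr_minus field_simps)
      finally show ?thesis using True second[OF True] by (simp add: integral_nonneg)
    qed simp
  qed
  let ?E = "\<lambda>k. if k \<in> K then cut_mean X b k else 0"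
  show "(\<lambda>n. (\<Sum>k=1..n. ?E k) / b n) \<longlonglongrightarrow> 0"
  proof (cases "\<alpha> = 1")
    case False
    have "summable (\<lambda>k. ?E k / b k)"
    proof (rule summable_comparison_test'[OF sumC])
      fix k
      show "norm (?E k / b k) \<le> C * (if k \<in> K then b k powr - \<alpha> else 0)"
      proof (cases "k \<in> K")
        case True
        have "\<bar>truncated_mean G (b k)\<bar> / b k \<le> C * b k powr (1 - \<alpha>) / b k"
          using bounds pos[of k] False by (intro divide_right_mono) (auto simp: stable_type_bounds_def)
        also have "\<dots> = C * b k powr - \<alpha>"
          using pos[of k] by (simp add: powr_diff powr_minus field_simps)
        finally show ?thesis using True first[OF True] pos[of k] by simp
      qed simp
    qed
    then have "summable (\<lambda>k. ?E (Suc k) / b (Suc k))" by (subst summable_Suc_iff)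
    then have "convergent (\<lambda>n. \<Sum>k<n. ?E (Suc k) / b (Suc k))" by (simp add: summable_iff_convergent)
    moreover have "(\<Sum>k<n. ?E (Suc k) / b (Suc k)) = (\<Sum>k=1..n. ?E k / b k)" for n
      by (rule sum.reindex_bij_witness[where i="\<lambda>k. k - 1" and j=Suc]) auto
    ultimately have "convergent (\<lambda>n. \<Sum>k=1..n. ?E k / b k)" by simp
    from kronecker_lemma[OF pos mono top this]
    show ?thesis using pos by (simp add: less_imp_neq[THEN not_sym])
  next
    case True
    have e1: "1 \<le> exp (1::real)" by simp
    have Ek: "\<bar>?E k\<bar> \<le> (if k \<in> K then C * exp 1 * ln (max (exp 1) (b n)) else 0)" if kn: "k \<le> n" for k n
    proof (cases "k \<in> K")
      case kK: True
      have bkn: "b k \<le> b n" using mono kn by (simp add: mono_def)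
      have L: "1 \<le> ln (max (exp 1) (b n))" by (subst ln_ge_iff) (auto simp: less_max_iff_disj)
      show ?thesis
      proof (cases "exp 1 \<le> b k")
        case big: True
        have "\<bar>truncated_mean G (b k)\<bar> \<le> C * ln (b k)"
          using bounds big True by (simp add: stable_type_bounds_def)
        also have "\<dots> \<le> C * ln (max (exp 1) (b n))"
          using C bkn pos[of k] by (intro mult_left_mono) (auto intro!: ln_mono simp: max_def)
        also have "\<dots> \<le> C * exp 1 * ln (max (exp 1) (b n))"
          using C L mult_right_mono[OF mult_left_mono[OF e1, of C], of "ln (max (exp 1) (b n))"] by simp
        finally show ?thesis using first[OF kK] kK by simp
      next
        case False
        have "\<bar>?E k\<bar> \<le> expectation (\<lambda>\<omega>. \<bar>X k \<omega> * indicator {x. \<bar>x\<bar> \<le> b k} (X k \<omega>)\<bar>)"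
          using kK by (simp add: integral_abs_bound del: abs_mult)
        also have "\<dots> \<le> expectation (\<lambda>_. b k)"
          using rv[OF kK] pos[of k]
          by (intro integral_mono integrable_const_bound[where B="b k"]) (auto split: split_indicator)
        also have "\<dots> \<le> 1 * exp 1 * 1" using False prob_space by simp
        also have "\<dots> \<le> C * exp 1 * ln (max (exp 1) (b n))"
          using C L by (intro mult_mono) auto
        finally show ?thesis using kK by simp
      qed
    qed simp
    have bound: "\<bar>\<Sum>k=1..n. ?E k\<bar> \<le> C * exp 1 * (count_upto K n * ln (max (exp 1) (b n)))" for n
    proof -
      have "\<bar>\<Sum>k=1..n. ?E k\<bar> \<le> (\<Sum>k=1..n. \<bar>?E k\<bar>)" by (rule sum_abs)
      also have "\<dots> \<le> (\<Sum>k=1..n. if k \<in> K then C * exp 1 * ln (max (exp 1) (b n)) else 0)"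
        by (intro sum_mono Ek) auto
      also have "\<dots> = C * exp 1 * (count_upto K n * ln (max (exp 1) (b n)))"
        by (simp add: sum.If_cases count_upto_def Int_commute)
      finally show ?thesis .
    qed
    have "(\<lambda>n. C * exp 1 * (count_upto K n * ln (b n) / b n)) \<longlonglongrightarrow> C * exp 1 * 0"
      by (intro tendsto_mult_left log[OF True])
    then have lim: "(\<lambda>n. C * exp 1 * (count_upto K n * ln (b n) / b n)) \<longlonglongrightarrow> 0" by simp
    show ?thesis
    proof (rule Lim_null_comparison[OF _ lim])
      have "\<forall>\<^sub>F n in sequentially. exp 1 \<le> b n" using top by (auto simp: filterlim_at_top)
      then show "\<forall>\<^sub>F n in sequentially. norm ((\<Sum>k=1..n. ?E k) / b n) \<le> C * exp 1 * (count_upto K n * ln (b n) / b n)"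
      proof eventually_elim
        case (elim n)
        have "norm ((\<Sum>k=1..n. ?E k) / b n) = \<bar>\<Sum>k=1..n. ?E k\<bar> / b n" using pos[of n] by (simp add: abs_divide)
        also have "\<dots> \<le> C * exp 1 * (count_upto K n * ln (max (exp 1) (b n))) / b n"
          using pos[of n] by (intro divide_right_mono bound) simp
        finally show ?case using elim by (simp add: max_def)
      qed
    qed
  qed
qed

text \<open>
  Each index is assigned to exactly one type, the first one if both laws are admissible, so that
  sums over all indices split into sums over the two types.
\<close>
lemma limsup_window_zero:
  fixes X :: "nat \<Rightarrow> 'a \<Rightarrow> real" and a :: "nat \<Rightarrow> nat" and B :: "nat \<Rightarrow> real"
  assumes indep: "indep_vars (\<lambda>_. borel) X {1..}"
    and bounds: "stable_type_bounds G1 \<alpha>1 C1" "stable_type_bounds G2 \<alpha>2 C2"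
    and laws: "\<And>k. k \<in> K1 \<Longrightarrow> distr M borel (X k) = G1" "\<And>k. k \<in> K2 \<Longrightarrow> distr M borel (X k) = G2"
    and cover: "{1..} \<subseteq> K1 \<union> K2"
    and pos0: "\<And>n. n0 \<le> n \<Longrightarrow> 0 < B n" and mono0: "\<And>m n. n0 \<le> m \<Longrightarrow> m \<le> n \<Longrightarrow> B m \<le> B n"
    and top0: "filterlim B at_top sequentially"
    and sum0: "type_series K1 B \<alpha>1" "type_series K2 B \<alpha>2"
    and log0: "\<alpha>1 = 1 \<Longrightarrow> (\<lambda>n. count_upto K1 n * ln (B n) / B n) \<longlonglongrightarrow> 0"
      "\<alpha>2 = 1 \<Longrightarrow> (\<lambda>n. count_upto K2 n * ln (B n) / B n) \<longlonglongrightarrow> 0"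
    and growth0: "\<forall>\<^sub>F n in sequentially. B (n + a n) \<le> c * B n"
  shows "AE \<omega> in M. limsup (\<lambda>n. ereal (\<bar>window X a n \<omega>\<bar> / B n)) = 0"
proof -
  obtain b where pos: "\<And>n. 0 < b n" and mono: "mono b" and top: "filterlim b at_top sequentially"
    and ev: "\<forall>\<^sub>F n in sequentially. b n = B n"
    using eventually_norming_extend[of n0 B, OF pos0 mono0 top0] by blast
  have s: "type_series K b \<alpha> \<longleftrightarrow> type_series K B \<alpha>" for K \<alpha>
    by (intro summable_cong eventually_mono[OF ev]) simp
  have l: "(\<lambda>n. count_upto K n * ln (b n) / b n) \<longlonglongrightarrow> 0 \<longleftrightarrow> (\<lambda>n. count_upto K n * ln (B n) / B n) \<longlonglongrightarrow> 0" for K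
    by (intro tendsto_cong eventually_mono[OF ev]) simp
  have sh: "filterlim (\<lambda>n. n + a n) at_top sequentially"
    by (rule filterlim_at_top_mono[OF filterlim_ident]) simp
  have growth: "\<forall>\<^sub>F n in sequentially. b (n + a n) \<le> c * b n"
    using growth0 ev eventually_compose_filterlim[OF ev sh] by eventually_elim simp
  note sum = sum0[folded s] and log = log0[folded l]
  have "AE \<omega> in M. limsup (\<lambda>n. ereal (\<bar>window X a n \<omega>\<bar> / b n)) = 0"
  proof -
    define L1 where "L1 = K1 \<inter> {1..}"
    define L2 where "L2 = {1..} - K1"
    have L2: "L2 \<subseteq> K2" using cover by (auto simp: L2_def)
    have rv: "random_variable borel (X k)" if "k \<in> {1..}" for k
      using indep that by (auto simp: indep_vars_def2)
    have cnt1: "count_upto L1 n = count_upto K1 n" for n unfolding count_upto_def L1_def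
      by (rule arg_cong[where f=card]) auto
    have sumL1: "type_series L1 b \<alpha>1"
      by (rule summable_comparison_test'[OF sum(1)]) (auto simp: L1_def)
    have t_rv: "random_variable borel (X k)" if "k \<in> L1 \<or> k \<in> L2" for k
      using rv that by (auto simp: L1_def L2_def)
    have law1: "distr M borel (X k) = G1" if "k \<in> L1" for k using laws(1) that by (auto simp: L1_def)
    have law2: "distr M borel (X k) = G2" if "k \<in> L2" for k using laws(2) L2 that by auto
    note t1 = type_sums[where K=L1 and X=X, OF bounds(1) t_rv[OF disjI1] law1 pos mono top sumL1 log(1)[folded cnt1]]
    have sumL2: "type_series L2 b \<alpha>2"
      by (rule summable_comparison_test'[OF sum(2)]) (use L2 in auto)
    have logL2: "(\<lambda>n. count_upto L2 n * ln (b n) / b n) \<longlonglongrightarrow> 0" if "\<alpha>2 = 1"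
    proof (rule Lim_null_comparison[OF _ log(2)[OF that]])
      have "\<forall>\<^sub>F n in sequentially. 1 \<le> b n" using top by (auto simp: filterlim_at_top)
      then show "\<forall>\<^sub>F n in sequentially. norm (count_upto L2 n * ln (b n) / b n) \<le> count_upto K2 n * ln (b n) / b n"
      proof eventually_elim
        case (elim n)
        then have "0 \<le> ln (b n)" by simp
        then show ?case using elim count_upto_subset[OF L2, of n] by (simp add: divide_right_mono mult_right_mono)
      qed
    qed
    note t2 = type_sums[where K=L2 and X=X, OF bounds(2) t_rv[OF disjI2] law2 pos mono top sumL2 logL2]
    have s1: "summable (\<lambda>k. (if k \<in> L1 then u k else 0) + (if k \<in> L2 then u k else 0)) \<longleftrightarrow> summable u" for u :: "nat \<Rightarrow> real"
      by (intro summable_cong eventually_mono[OF eventually_ge_at_top[of 1]]) (auto simp: L1_def L2_def)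
    have s2: "(\<Sum>k=1..n. if k \<in> L1 then u k else 0) + (\<Sum>k=1..n. if k \<in> L2 then u k else 0) = (\<Sum>k=1..n. u k)" for u :: "nat \<Rightarrow> real" and n
      unfolding sum.distrib[symmetric] by (intro sum.cong) (auto simp: L1_def L2_def)
    have "AE \<omega> in M. (\<lambda>n. partial_sum X n \<omega> / b n) \<longlonglongrightarrow> 0"
    proof (rule sum_over_norming_tendsto_0[OF indep pos mono top])
      show "summable (\<lambda>k. prob (exceeds X k (b k)))"
        using summable_add[OF t1(1) t2(1)] by (simp only: s1)
      show "summable (\<lambda>k. cut_second_moment X b k / (b k)\<^sup>2)"
        using summable_add[OF t1(2) t2(2)] by (simp only: s1)
      show "(\<lambda>n. (\<Sum>k=1..n. cut_mean X b k) / b n) \<longlonglongrightarrow> 0"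
        using tendsto_add[OF t1(3) t2(3)] by (simp only: add_divide_distrib[symmetric] s2 add_0)
    qed
    then show ?thesis
    proof (rule AE_mp, intro AE_I2 impI)
      fix \<omega> assume lim: "(\<lambda>n. partial_sum X n \<omega> / b n) \<longlonglongrightarrow> 0"
      let ?q = "\<lambda>n. partial_sum X n \<omega> / b n"
      have lim': "(\<lambda>n. c * \<bar>?q (n + a n)\<bar> + \<bar>?q n\<bar>) \<longlonglongrightarrow> 0"
        using tendsto_add[OF tendsto_mult_left[OF tendsto_rabs[OF filterlim_compose[OF lim sh]], of c] tendsto_rabs[OF lim]] by simp
      have "(\<lambda>n. \<bar>window X a n \<omega>\<bar> / b n) \<longlonglongrightarrow> 0"
      proof (rule Lim_null_comparison[OF _ lim'])
        show "\<forall>\<^sub>F n in sequentially. norm (\<bar>window X a n \<omega>\<bar> / b n) \<le> c * \<bar>?q (n + a n)\<bar> + \<bar>?q n\<bar>"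
          using growth
        proof eventually_elim
          case (elim n)
          have "\<bar>partial_sum X (n + a n) \<omega>\<bar> = \<bar>?q (n + a n)\<bar> * b (n + a n)"
            using pos[of "n + a n"] by (simp add: abs_divide)
          also have "\<dots> \<le> \<bar>?q (n + a n)\<bar> * (c * b n)" using elim by (intro mult_left_mono) auto
          finally have "\<bar>window X a n \<omega>\<bar> \<le> (c * \<bar>?q (n + a n)\<bar> + \<bar>?q n\<bar>) * b n"
            using pos[of n] abs_triangle_ineq4[of "partial_sum X (n + a n) \<omega>" "partial_sum X n \<omega>"]
            by (simp add: abs_divide algebra_simps)
          then show ?case using pos[of n] by (simp add: divide_le_eq)
        qed
      qed
      then have "(\<lambda>n. ereal (\<bar>window X a n \<omega>\<bar> / b n)) \<longlonglongrightarrow> ereal 0"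
        by (rule tendsto_ereal)
      from lim_imp_Limsup[OF _ this]
      show "limsup (\<lambda>n. ereal (\<bar>window X a n \<omega>\<bar> / b n)) = 0" by simp
    qed
  qed
  moreover have "limsup (\<lambda>n. ereal (\<bar>window X a n \<omega>\<bar> / b n)) = limsup (\<lambda>n. ereal (\<bar>window X a n \<omega>\<bar> / B n))" for \<omega>
    by (intro Limsup_eq eventually_mono[OF ev]) simp
  ultimately show ?thesis by simp
qed

text \<open>
  One type with a divergent series suffices; the bounds on both types serve to make the probability
  of a single large summand tend to zero.
\<close>
lemma limsup_window_top:
  fixes X :: "nat \<Rightarrow> 'a \<Rightarrow> real" and a :: "nat \<Rightarrow> nat" and B :: "nat \<Rightarrow> real"
  assumes indep: "indep_vars (\<lambda>_. borel) X {1..}"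
    and \<alpha>: "0 < \<alpha>1" "0 < \<alpha>2"
    and bounds: "stable_type_bounds G1 \<alpha>1 C1" "stable_type_bounds G2 \<alpha>2 C2"
    and laws: "\<And>k. k \<in> K1 \<Longrightarrow> distr M borel (X k) = G1" "\<And>k. k \<in> K2 \<Longrightarrow> distr M borel (X k) = G2"
    and cover: "{1..} \<subseteq> K1 \<union> K2"
    and pos0: "\<And>n. n0 \<le> n \<Longrightarrow> 0 < B n" and mono0: "\<And>m n. n0 \<le> m \<Longrightarrow> m \<le> n \<Longrightarrow> B m \<le> B n"
    and top0: "filterlim B at_top sequentially"
    and a: "\<And>n. 1 \<le> n \<Longrightarrow> 0 < a n"
    and lower: "0 < c0" "\<And>x. x0 \<le> x \<Longrightarrow> c0 * x powr - \<alpha> \<le> abs_tail G x"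
    and lawK: "\<And>k. k \<in> K \<Longrightarrow> distr M borel (X k) = G"
    and div0: "\<not> type_series K B \<alpha>"
  shows "AE \<omega> in M. limsup (\<lambda>n. ereal (\<bar>window X a n \<omega>\<bar> / B n)) = \<infinity>"
proof -
  obtain b where pos: "\<And>n. 0 < b n" and mono: "mono b" and top: "filterlim b at_top sequentially"
    and ev: "\<forall>\<^sub>F n in sequentially. b n = B n"
    using eventually_norming_extend[of n0 B, OF pos0 mono0 top0] by blast
  have s: "type_series K b \<alpha> \<longleftrightarrow> type_series K B \<alpha>" for K \<alpha>
    by (intro summable_cong eventually_mono[OF ev]) simp
  note div = div0[folded s]
  have "AE \<omega> in M. limsup (\<lambda>n. ereal (\<bar>window X a n \<omega>\<bar> / b n)) = \<infinity>"
  proof (rule limsup_window_infinite[OF indep pos mono a])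
    have rv: "random_variable borel (X k)" if "1 \<le> k" for k
      using indep that by (auto simp: indep_vars_def2)
    fix c :: real assume c: "0 < c"
    have pw: "(\<lambda>k. (c * b k) powr - \<beta>) \<longlonglongrightarrow> 0" if "0 < \<beta>" for \<beta>
      using that c by (intro tendsto_neg_powr filterlim_tendsto_pos_mult_at_top[OF tendsto_const c top]) auto
    have lim: "(\<lambda>k. C1 * (c * b k) powr - \<alpha>1 + C2 * (c * b k) powr - \<alpha>2) \<longlonglongrightarrow> 0"
      using tendsto_add[OF tendsto_mult_left[OF pw[OF \<alpha>(1)], of C1] tendsto_mult_left[OF pw[OF \<alpha>(2)], of C2]] by simp
    show "(\<lambda>k. prob (exceeds X k (c * b k))) \<longlonglongrightarrow> 0"
    proof (rule Lim_null_comparison[OF _ lim], rule eventually_mono[OF eventually_ge_at_top[of 1]])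
      fix k :: nat assume k: "1 \<le> k"
      have cb: "0 < c * b k" using c pos[of k] by simp
      have C: "0 \<le> C1" "0 \<le> C2" using bounds by (auto simp: stable_type_bounds_def)
      have "prob (exceeds X k (c * b k)) \<le> prob {\<omega> \<in> space M. c * b k \<le> \<bar>X k \<omega>\<bar>}"
        using rv[OF k] by (intro finite_measure_mono) auto
      also have "\<dots> \<le> C1 * (c * b k) powr - \<alpha>1 + C2 * (c * b k) powr - \<alpha>2"
      proof -
        have "k \<in> K1 \<or> k \<in> K2" using cover k by auto
        then show ?thesis
        proof
          assume "k \<in> K1"
          then have "prob {\<omega> \<in> space M. c * b k \<le> \<bar>X k \<omega>\<bar>} \<le> C1 * (c * b k) powr - \<alpha>1"
            using bounds(1) cb prob_tail_law(2)[OF rv[OF k] laws(1)] by (simp add: stable_type_bounds_def)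
          then show ?thesis using C by (simp add: add_increasing2)
        next
          assume "k \<in> K2"
          then have "prob {\<omega> \<in> space M. c * b k \<le> \<bar>X k \<omega>\<bar>} \<le> C2 * (c * b k) powr - \<alpha>2"
            using bounds(2) cb prob_tail_law(2)[OF rv[OF k] laws(2)] by (simp add: stable_type_bounds_def)
          then show ?thesis using C by (simp add: add_increasing)
        qed
      qed
      finally show "norm (prob (exceeds X k (c * b k))) \<le> C1 * (c * b k) powr - \<alpha>1 + C2 * (c * b k) powr - \<alpha>2"
        by simp
    qed
    show "\<not> summable (\<lambda>k. prob (exceeds X k (c * b k)))"
    proof
      assume s: "summable (\<lambda>k. prob (exceeds X k (c * b k)))"
      have "\<forall>\<^sub>F k in sequentially. x0 / (2 * c) \<le> b k" using top by (auto simp: filterlim_at_top)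
      then have "\<forall>\<^sub>F k in sequentially. x0 / (2 * c) \<le> b k \<and> 1 \<le> k"
        by (intro eventually_conj eventually_ge_at_top)
      then obtain N where N: "\<And>k. N \<le> k \<Longrightarrow> x0 / (2 * c) \<le> b k \<and> 1 \<le> k" by (auto simp: eventually_sequentially)
      \<comment> \<open>The factor 2 passes from the weak inequality in the tail bound to the strict one in the event.\<close>
    define d where "d = c0 * (2 * c) powr - \<alpha>"
      have d: "0 < d" using lower c by (simp add: d_def)
      have "type_series K b \<alpha>"
      proof (rule summable_comparison_test'[OF summable_mult[OF s, of "1 / d"], of N])
        fix k assume k: "N \<le> k"
        show "norm (if k \<in> K then b k powr - \<alpha> else 0) \<le> 1 / d * prob (exceeds X k (c * b k))"
        proof (cases "k \<in> K")
          case True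
          have cb: "0 < c * b k" using c pos[of k] by simp
          have "x0 \<le> 2 * c * b k" using N[OF k] c by (simp add: field_simps)
          then have "c0 * (2 * c * b k) powr - \<alpha> \<le> abs_tail G (2 * c * b k)" by (rule lower)
          also have "\<dots> = prob {\<omega> \<in> space M. 2 * c * b k \<le> \<bar>X k \<omega>\<bar>}"
            using N[OF k] by (intro prob_tail_law(2)[symmetric] rv lawK[OF True]) auto
          also have "\<dots> \<le> prob (exceeds X k (c * b k))"
            using cb rv[of k] N[OF k] by (intro finite_measure_mono) auto
          also have "c0 * (2 * c * b k) powr - \<alpha> = d * b k powr - \<alpha>"
            using c pos[of k] by (simp add: d_def powr_mult)
          finally show ?thesis using d True by (simp add: field_simps)
        qed (use d in simp)
      qed
      with div show False ..
    qed
  qed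
  moreover have "limsup (\<lambda>n. ereal (\<bar>window X a n \<omega>\<bar> / b n)) = limsup (\<lambda>n. ereal (\<bar>window X a n \<omega>\<bar> / B n))" for \<omega>
    by (intro Limsup_eq eventually_mono[OF ev]) simp
  ultimately show ?thesis by simp
qed

end

section \<open>The norming sequence in the three regimes\<close>

lemma limsup_finite_imp_bounded:
  fixes u :: "nat \<Rightarrow> real"
  assumes "limsup (\<lambda>n. ereal (u n)) < \<infinity>"
  obtains c where "0 < c" "\<forall>\<^sub>F n in sequentially. u n \<le> c"
proof -
  obtain y where y: "limsup (\<lambda>n. ereal (u n)) < y" "y < \<infinity>" using dense[OF assms] by blast
  then obtain c where c: "y = ereal c" by (cases y) auto
  have "\<forall>\<^sub>F n in sequentially. ereal (u n) < ereal c" using Limsup_lessD[OF y(1)] c by simp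
  then have "\<forall>\<^sub>F n in sequentially. u n \<le> max c 1" by eventually_elim simp
  then show ?thesis by (intro that[of "max c 1"]) auto
qed

lemma bounded_imp_limsup_finite:
  fixes u :: "nat \<Rightarrow> real"
  assumes "\<forall>\<^sub>F n in sequentially. u n \<le> c"
  shows "limsup (\<lambda>n. ereal (u n)) < \<infinity>"
proof -
  have "limsup (\<lambda>n. ereal (u n)) \<le> ereal c"
    using assms by (intro Limsup_bounded) (auto elim: eventually_mono)
  then show ?thesis by (rule le_less_trans) simp
qed

text \<open>
  The root of order \<open>a * b\<close> turns a bound on the ratio that defines \<open>lam\<close> into a comparison of the
  norming sequences of the two types.
\<close>
lemma powr_inverse_le:
  fixes x y :: real
  assumes "x powr a \<le> c * y powr b" "0 < x" "0 < y" "0 < a" "0 < b" "0 < c"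
  shows "x powr (1 / b) \<le> c powr (1 / (a * b)) * y powr (1 / a)"
proof -
  have "(x powr a) powr (1 / (a * b)) \<le> (c * y powr b) powr (1 / (a * b))"
    using assms by (intro powr_mono2) auto
  then show ?thesis using assms by (simp add: powr_powr powr_mult)
qed

text \<open>
  The deterministic side of the problem: two sets of indices, possibly overlapping, that cover all
  positive integers, and the growth function \<open>f\<close>. The limit \<open>lam\<close> of the ratio of the counts decides
  which type dominates.
\<close>
locale two_type_norming =
  fixes K1 K2 :: "nat set" and \<alpha>1 \<alpha>2 :: real and lam :: ereal and f :: "real \<Rightarrow> real" and a :: "nat \<Rightarrow> nat"
  assumes alpha: "0 < \<alpha>1" "\<alpha>1 < \<alpha>2"
    and cover: "{1..} \<subseteq> K1 \<union> K2"
    and count_top: "filterlim (count_upto K1) at_top sequentially" "filterlim (count_upto K2) at_top sequentially"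
    and ratio: "(\<lambda>n. ereal (real (count_upto K1 n) powr \<alpha>2 / real (count_upto K2 n) powr \<alpha>1)) \<longlonglongrightarrow> lam"
    and f_pos: "\<And>x. 1 \<le> x \<Longrightarrow> 0 < f x"
    and f_mono: "mono_on {1..} f"
    and f_growth: "\<And>b :: nat \<Rightarrow> real. (\<And>n. b n \<ge> 1) \<Longrightarrow>
          limsup (\<lambda>n. ereal (b n / real n)) < \<infinity> \<Longrightarrow>
          limsup (\<lambda>n. ereal (f (b n) / f (real n))) < \<infinity>"
begin

abbreviation "t1 n \<equiv> real (count_upto K1 n)"
abbreviation "t2 n \<equiv> real (count_upto K2 n)"

definition norming :: "nat \<Rightarrow> real" where
  "norming n = (if lam = \<infinity> then t1 n powr (1 / \<alpha>1) else t2 n powr (1 / \<alpha>2))"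

text \<open>
  For \<open>\<gamma> = 1 / \<alpha>1\<close> and \<open>\<gamma> = 1 / \<alpha>2\<close> this is the denominator in the two parts of the theorem.
\<close>
definition scale :: "real \<Rightarrow> nat \<Rightarrow> real" where
  "scale \<gamma> n = norming n * f (real n) powr \<gamma>"

lemma fn_pos: "1 \<le> n \<Longrightarrow> 0 < f (real n)" for n :: nat
  by (rule f_pos) simp

lemma fn_mono: "1 \<le> m \<Longrightarrow> m \<le> n \<Longrightarrow> f (real m) \<le> f (real n)" for m n :: nat
  by (rule mono_onD[OF f_mono]) auto

lemma count_ge1: "\<forall>\<^sub>F n in sequentially. 1 \<le> t1 n \<and> 1 \<le> t2 n \<and> 1 \<le> n"
proof -
  have "\<forall>\<^sub>F n in sequentially. 1 \<le> count_upto K1 n" "\<forall>\<^sub>F n in sequentially. 1 \<le> count_upto K2 n"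
    using count_top by (auto simp: filterlim_at_top)
  then show ?thesis using eventually_ge_at_top[of 1] by eventually_elim auto
qed

lemma count_total: "real n \<le> t1 n + t2 n"
proof -
  have "{1..n} \<subseteq> (K1 \<inter> {1..n}) \<union> (K2 \<inter> {1..n})" using cover by auto
  then have "card {1..n} \<le> card ((K1 \<inter> {1..n}) \<union> (K2 \<inter> {1..n}))" by (intro card_mono) auto
  also have "\<dots> \<le> count_upto K1 n + count_upto K2 n" unfolding count_upto_def by (rule card_Un_le)
  finally show ?thesis by simp
qed

lemma norming_inf: "lam = \<infinity> \<Longrightarrow> norming n = t1 n powr (1 / \<alpha>1)"
  and norming_fin: "lam \<noteq> \<infinity> \<Longrightarrow> norming n = t2 n powr (1 / \<alpha>2)"
  unfolding norming_def by auto

lemma inverse_f_nonneg: "1 \<le> k \<Longrightarrow> 0 \<le> 1 / f (real k)" for k :: nat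
  using fn_pos[of k] by simp

lemma inverse_f_decreasing: "1 \<le> k \<Longrightarrow> 1 / f (real (Suc k)) \<le> 1 / f (real k)" for k :: nat
  using fn_pos[of k] fn_pos[of "Suc k"] fn_mono[of k "Suc k"] by (intro divide_left_mono mult_pos_pos) auto

lemma norming_mono: "m \<le> n \<Longrightarrow> norming m \<le> norming n"
  using alpha by (auto simp: norming_def intro!: powr_mono2 count_upto_mono)

lemma norming_nonneg: "0 \<le> norming n" by (simp add: norming_def)

lemma norming_top: "filterlim norming at_top sequentially"
proof -
  have *: "filterlim (\<lambda>n. real (count_upto K n) powr p) at_top sequentially"
    if "filterlim (count_upto K) at_top sequentially" "0 < p" for K p
  proof -
    have r: "filterlim (\<lambda>x::real. x powr p) at_top at_top" using that(2) by real_asymp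
    show ?thesis
      by (rule filterlim_compose[OF r filterlim_compose[OF filterlim_real_sequentially that(1)]])
  qed
  show ?thesis
  proof (cases "lam = \<infinity>")
    case True
    show ?thesis unfolding norming_inf[OF True] using alpha by (intro * count_top) simp
  next
    case False
    show ?thesis unfolding norming_fin[OF False] using alpha by (intro * count_top) simp
  qed
qed

lemma norming_upper: "\<forall>\<^sub>F n in sequentially. norming n \<le> real n powr (1 / \<alpha>1)"
  using count_ge1
proof eventually_elim
  case (elim n)
  have "t1 n powr (1 / \<alpha>1) \<le> real n powr (1 / \<alpha>1)"
    using alpha by (intro powr_mono2) (auto simp: count_upto_le)
  moreover have "t2 n powr (1 / \<alpha>2) \<le> real n powr (1 / \<alpha>2)"
    using alpha by (intro powr_mono2) (auto simp: count_upto_le)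
  moreover have "real n powr (1 / \<alpha>2) \<le> real n powr (1 / \<alpha>1)"
    using alpha elim by (intro powr_mono) (auto simp: frac_le)
  ultimately show ?case by (auto simp: norming_def)
qed

text \<open>
  This and the next lemma restate \<open>lam > 0\<close> and \<open>lam < \<infinity>\<close> as comparisons of the two norming
  sequences. For \<open>0 < lam < \<infinity>\<close> they are of the same order.
\<close>
lemma count1_dominates:
  assumes "0 < lam"
  obtains c where "0 < c" "\<forall>\<^sub>F n in sequentially. c * t2 n powr (1 / \<alpha>2) \<le> t1 n powr (1 / \<alpha>1)"
proof -
  obtain y where y: "0 < y" "y < lam" using dense[OF assms] by blast
  then obtain d where d: "y = ereal d" "0 < d" by (cases y) auto
  have "\<forall>\<^sub>F n in sequentially. ereal d < ereal (t1 n powr \<alpha>2 / t2 n powr \<alpha>1)"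
    using order_tendstoD(1)[OF ratio y(2)] d by simp
  then have "\<forall>\<^sub>F n in sequentially. d powr (1 / (\<alpha>1 * \<alpha>2)) * t2 n powr (1 / \<alpha>2) \<le> t1 n powr (1 / \<alpha>1)"
    using count_ge1
  proof eventually_elim
    case (elim n)
    have "t2 n powr \<alpha>1 \<le> (1 / d) * t1 n powr \<alpha>2" using elim d by (simp add: field_simps)
    then have "t2 n powr (1 / \<alpha>2) \<le> (1 / d) powr (1 / (\<alpha>1 * \<alpha>2)) * t1 n powr (1 / \<alpha>1)"
      using elim d alpha by (intro powr_inverse_le) auto
    then show ?case using d by (simp add: powr_divide field_simps)
  qed
  then show ?thesis using d by (intro that[of "d powr (1 / (\<alpha>1 * \<alpha>2))"]) auto
qed

lemma count2_dominates:
  assumes "lam < \<infinity>"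
  obtains c where "0 < c" "\<forall>\<^sub>F n in sequentially. c * t1 n powr (1 / \<alpha>1) \<le> t2 n powr (1 / \<alpha>2)"
proof -
  have lim: "limsup (\<lambda>n. ereal (t1 n powr \<alpha>2 / t2 n powr \<alpha>1)) < \<infinity>"
    using lim_imp_Limsup[OF _ ratio] assms by simp
  obtain d where d: "0 < d" "\<forall>\<^sub>F n in sequentially. t1 n powr \<alpha>2 / t2 n powr \<alpha>1 \<le> d"
    by (rule limsup_finite_imp_bounded[OF lim])
  have "\<forall>\<^sub>F n in sequentially. (1 / d powr (1 / (\<alpha>2 * \<alpha>1))) * t1 n powr (1 / \<alpha>1) \<le> t2 n powr (1 / \<alpha>2)"
    using d(2) count_ge1
  proof eventually_elim
    case (elim n)
    have "t1 n powr \<alpha>2 \<le> d * t2 n powr \<alpha>1" using elim d by (simp add: divide_le_eq)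
    then have "t1 n powr (1 / \<alpha>1) \<le> d powr (1 / (\<alpha>2 * \<alpha>1)) * t2 n powr (1 / \<alpha>2)"
      using elim d alpha by (intro powr_inverse_le) auto
    then show ?case using d by (simp add: field_simps)
  qed
  then show ?thesis using d by (intro that[of "1 / d powr (1 / (\<alpha>2 * \<alpha>1))"]) auto
qed

lemma count2_linear:
  assumes "lam < \<infinity>"
  obtains c where "0 < c" "\<forall>\<^sub>F n in sequentially. c * real n \<le> t2 n"
proof -
  obtain c where c: "0 < c" "\<forall>\<^sub>F n in sequentially. c * t1 n powr (1 / \<alpha>1) \<le> t2 n powr (1 / \<alpha>2)"
    by (rule count2_dominates[OF assms])
  define d where "d = (1 / c) powr \<alpha>1"
  have d: "0 < d" using c by (simp add: d_def)
  have "\<forall>\<^sub>F n in sequentially. 1 / (1 + d) * real n \<le> t2 n"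
    using c(2) count_ge1
  proof eventually_elim
    case (elim n)
    have "t1 n = (t1 n powr (1 / \<alpha>1)) powr \<alpha>1" using elim alpha by (simp add: powr_powr)
    also have "\<dots> \<le> ((1 / c) * t2 n powr (1 / \<alpha>2)) powr \<alpha>1"
      using elim c alpha by (intro powr_mono2) (auto simp: field_simps)
    also have "\<dots> = d * t2 n powr (\<alpha>1 / \<alpha>2)"
      by (subst powr_mult) (use c in \<open>auto simp: d_def powr_powr\<close>)
    also have "\<dots> \<le> d * t2 n powr 1"
      using d elim alpha by (intro mult_left_mono powr_mono) auto
    finally have "t1 n \<le> d * t2 n" using elim by simp
    then have "real n \<le> (1 + d) * t2 n" using count_total[of n] by (simp add: algebra_simps)
    then show ?case using d by (simp add: field_simps)
  qed
  then show ?thesis using d by (intro that[of "1 / (1 + d)"]) auto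
qed

text \<open>
  Both counts are at most a multiple of \<open>t1 n powr (\<alpha>2 / \<alpha>1)\<close>, and they add up to at least \<open>n\<close>.
\<close>
lemma count1_power:
  assumes "0 < lam"
  obtains c where "0 < c" "\<forall>\<^sub>F n in sequentially. c * real n powr (\<alpha>1 / \<alpha>2) \<le> t1 n"
proof -
  obtain c where c: "0 < c" "\<forall>\<^sub>F n in sequentially. c * t2 n powr (1 / \<alpha>2) \<le> t1 n powr (1 / \<alpha>1)"
    by (rule count1_dominates[OF assms])
  define d where "d = (1 / c) powr \<alpha>2"
  have d: "0 < d" using c by (simp add: d_def)
  have "\<forall>\<^sub>F n in sequentially. (1 / (1 + d)) powr (\<alpha>1 / \<alpha>2) * real n powr (\<alpha>1 / \<alpha>2) \<le> t1 n"
    using c(2) count_ge1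
  proof eventually_elim
    case (elim n)
    have "t2 n = (t2 n powr (1 / \<alpha>2)) powr \<alpha>2" using elim alpha by (simp add: powr_powr)
    also have "\<dots> \<le> ((1 / c) * t1 n powr (1 / \<alpha>1)) powr \<alpha>2"
      using elim c alpha by (intro powr_mono2) (auto simp: field_simps)
    also have "\<dots> = d * t1 n powr (\<alpha>2 / \<alpha>1)"
      by (subst powr_mult) (use c in \<open>auto simp: d_def powr_powr\<close>)
    finally have 2: "t2 n \<le> d * t1 n powr (\<alpha>2 / \<alpha>1)" .
    have "t1 n = t1 n powr 1" using elim by simp
    also have "\<dots> \<le> t1 n powr (\<alpha>2 / \<alpha>1)" using elim alpha by (intro powr_mono) auto
    finally have "real n \<le> (1 + d) * t1 n powr (\<alpha>2 / \<alpha>1)"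
      using count_total[of n] 2 by (simp add: algebra_simps)
    then have "1 / (1 + d) * real n \<le> t1 n powr (\<alpha>2 / \<alpha>1)" using d by (simp add: field_simps)
    then have "(1 / (1 + d) * real n) powr (\<alpha>1 / \<alpha>2) \<le> (t1 n powr (\<alpha>2 / \<alpha>1)) powr (\<alpha>1 / \<alpha>2)"
      using d alpha by (intro powr_mono2) auto
    also have "\<dots> = t1 n" using elim alpha by (simp add: powr_powr)
    finally have "(1 / (1 + d) * real n) powr (\<alpha>1 / \<alpha>2) \<le> t1 n" .
    moreover have "(1 / (1 + d) * real n) powr (\<alpha>1 / \<alpha>2) = (1 / (1 + d)) powr (\<alpha>1 / \<alpha>2) * real n powr (\<alpha>1 / \<alpha>2)"
      by (rule powr_mult)
    ultimately show ?case by simp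
  qed
  then show ?thesis using d by (intro that[of "(1 / (1 + d)) powr (\<alpha>1 / \<alpha>2)"]) auto
qed

lemma scale_eventually_pos_mono:
  assumes "0 \<le> \<gamma>"
  obtains n0 where "\<And>n. n0 \<le> n \<Longrightarrow> 0 < scale \<gamma> n" "\<And>m n. n0 \<le> m \<Longrightarrow> m \<le> n \<Longrightarrow> scale \<gamma> m \<le> scale \<gamma> n"
proof -
  obtain n0 where n0: "\<And>n. n0 \<le> n \<Longrightarrow> 1 \<le> t1 n \<and> 1 \<le> t2 n \<and> 1 \<le> n"
    using count_ge1 by (auto simp: eventually_sequentially)
  show ?thesis
  proof
    fix n assume n: "n0 \<le> n"
    have "0 < norming n" using n0[OF n] by (auto simp: norming_def)
    then show "0 < scale \<gamma> n" using fn_pos[of n] n0[OF n] by (auto simp: scale_def)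
  next
    fix m n assume mn: "n0 \<le> m" "m \<le> n"
    have "1 \<le> m" using n0[OF mn(1)] by simp
    then have "f (real m) powr \<gamma> \<le> f (real n) powr \<gamma>"
      using assms fn_pos[of m] fn_mono[of m n] mn by (intro powr_mono2) auto
    then show "scale \<gamma> m \<le> scale \<gamma> n" unfolding scale_def
      using norming_mono[OF mn(2)] norming_nonneg by (intro mult_mono) auto
  qed
qed

lemma scale_top:
  assumes "0 \<le> \<gamma>" shows "filterlim (scale \<gamma>) at_top sequentially"
proof -
  have "0 < f 1 powr \<gamma>" using f_pos[of 1] by auto
  then have "filterlim (\<lambda>n. f 1 powr \<gamma> * norming n) at_top sequentially"
    by (rule filterlim_tendsto_pos_mult_at_top[OF tendsto_const _ norming_top])
  then show ?thesis
  proof (rule filterlim_at_top_mono)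
    show "\<forall>\<^sub>F n in sequentially. f 1 powr \<gamma> * norming n \<le> scale \<gamma> n"
    proof (rule eventually_mono[OF eventually_ge_at_top[of 1]])
      fix n :: nat assume "1 \<le> n"
      then have "f 1 powr \<gamma> \<le> f (real n) powr \<gamma>"
        using assms f_pos[of 1] fn_mono[of 1 n] by (intro powr_mono2) auto
      then show "f 1 powr \<gamma> * norming n \<le> scale \<gamma> n"
        using mult_left_mono[OF _ norming_nonneg[of n]] by (simp add: scale_def mult.commute)
    qed
  qed
qed

text \<open>
  The norming by counts grows at most by a constant factor along a window, because a window adds at
  most \<open>a n\<close> to a count; for \<open>f\<close> this is its growth condition, applied to \<open>b n = max 1 (n + a n)\<close>,
  where the maximum with 1 keeps the sequence in the domain of \<open>f\<close> at \<open>n = 0\<close>.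
\<close>
lemma scale_growth:
  assumes \<gamma>: "0 \<le> \<gamma>"
    and inf: "lam = \<infinity> \<Longrightarrow> limsup (\<lambda>n. ereal (real (a n) / t1 n)) < \<infinity>"
    and fin: "lam < \<infinity> \<Longrightarrow> limsup (\<lambda>n. ereal (real (a n) / real n)) < \<infinity>"
  obtains c where "\<forall>\<^sub>F n in sequentially. scale \<gamma> (n + a n) \<le> c * scale \<gamma> n"
proof -
  obtain ca where ca: "0 < ca" "\<forall>\<^sub>F n in sequentially. real (a n) \<le> ca * real n"
  proof (cases "lam = \<infinity>")
    case True
    obtain ca where ca: "0 < ca" "\<forall>\<^sub>F n in sequentially. real (a n) / t1 n \<le> ca"
      by (rule limsup_finite_imp_bounded[OF inf[OF True]])
    have "\<forall>\<^sub>F n in sequentially. real (a n) \<le> ca * real n"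
      using ca(2) count_ge1
    proof eventually_elim
      case (elim n)
      then have "real (a n) \<le> ca * t1 n" by (simp add: divide_le_eq)
      also have "\<dots> \<le> ca * real n" using ca count_upto_le by (intro mult_left_mono) auto
      finally show ?case .
    qed
    then show ?thesis using ca by (intro that)
  next
    case False
    then have "lam < \<infinity>" by simp
    obtain ca where ca: "0 < ca" "\<forall>\<^sub>F n in sequentially. real (a n) / real n \<le> ca"
      by (rule limsup_finite_imp_bounded[OF fin[OF \<open>lam < \<infinity>\<close>]])
    have "\<forall>\<^sub>F n in sequentially. real (a n) \<le> ca * real n"
      using ca(2) eventually_ge_at_top[of 1] by eventually_elim (simp add: divide_le_eq)
    then show ?thesis using ca by (intro that)
  qed
  have "limsup (\<lambda>n. ereal (max 1 (real (n + a n)) / real n)) < \<infinity>"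
  proof (rule bounded_imp_limsup_finite)
    show "\<forall>\<^sub>F n in sequentially. max 1 (real (n + a n)) / real n \<le> 1 + ca"
      using ca(2) eventually_ge_at_top[of 1] by eventually_elim (simp add: field_simps max_def)
  qed
  then have "limsup (\<lambda>n. ereal (f (max 1 (real (n + a n))) / f (real n))) < \<infinity>"
    by (intro f_growth) auto
  then obtain cf where cf: "0 < cf" "\<forall>\<^sub>F n in sequentially. f (max 1 (real (n + a n))) / f (real n) \<le> cf"
    by (rule limsup_finite_imp_bounded)
  obtain cB where cB: "0 < cB" "\<forall>\<^sub>F n in sequentially. norming (n + a n) \<le> cB * norming n"
  proof (cases "lam = \<infinity>")
    case True
    obtain c where c: "0 < c" "\<forall>\<^sub>F n in sequentially. real (a n) / t1 n \<le> c"
      by (rule limsup_finite_imp_bounded[OF inf[OF True]])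
    have "\<forall>\<^sub>F n in sequentially. norming (n + a n) \<le> (1 + c) powr (1 / \<alpha>1) * norming n"
      using c(2) count_ge1
    proof eventually_elim
      case (elim n)
      have "real (count_upto K1 (n + a n)) \<le> t1 n + real (a n)"
        using count_upto_add_le[of K1 n "a n"] by simp
      also have "\<dots> \<le> (1 + c) * t1 n" using elim by (simp add: divide_le_eq algebra_simps)
      finally have "real (count_upto K1 (n + a n)) powr (1 / \<alpha>1) \<le> ((1 + c) * t1 n) powr (1 / \<alpha>1)"
        using alpha by (intro powr_mono2) auto
      then show ?case using c unfolding norming_inf[OF True] by (simp add: powr_mult)
    qed
    then show ?thesis using c by (intro that[of "(1 + c) powr (1 / \<alpha>1)"]) auto
  next
    case False
    then have "lam < \<infinity>" by simp
    obtain c where c: "0 < c" "\<forall>\<^sub>F n in sequentially. c * real n \<le> t2 n"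
      by (rule count2_linear[OF \<open>lam < \<infinity>\<close>])
    have "\<forall>\<^sub>F n in sequentially. norming (n + a n) \<le> ((1 + ca) / c) powr (1 / \<alpha>2) * norming n"
      using c(2) ca(2)
    proof eventually_elim
      case (elim n)
      have "real (count_upto K2 (n + a n)) \<le> real (n + a n)"
        using count_upto_le[of K2 "n + a n"] by (simp only: of_nat_le_iff)
      also have "\<dots> \<le> (1 + ca) * real n" using elim by (simp add: algebra_simps)
      also have "\<dots> \<le> (1 + ca) * (t2 n / c)"
        using elim c ca by (intro mult_left_mono) (auto simp: field_simps)
      finally have "real (count_upto K2 (n + a n)) powr (1 / \<alpha>2) \<le> ((1 + ca) / c * t2 n) powr (1 / \<alpha>2)"
        using alpha by (intro powr_mono2) auto
      also have "\<dots> = ((1 + ca) / c) powr (1 / \<alpha>2) * t2 n powr (1 / \<alpha>2)"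
        by (rule powr_mult)
      finally show ?case unfolding norming_fin[OF False] .
    qed
    then show ?thesis using c ca by (intro that[of "((1 + ca) / c) powr (1 / \<alpha>2)"]) auto
  qed
  have "\<forall>\<^sub>F n in sequentially. scale \<gamma> (n + a n) \<le> (cB * cf powr \<gamma>) * scale \<gamma> n"
    using cf(2) cB(2) eventually_ge_at_top[of 1]
  proof eventually_elim
    case (elim n)
    have "max 1 (real (n + a n)) = real (n + a n)" using elim by simp
    then have "f (real (n + a n)) \<le> cf * f (real n)" using elim fn_pos[of n] by (simp add: divide_le_eq)
    then have "f (real (n + a n)) powr \<gamma> \<le> (cf * f (real n)) powr \<gamma>"
      using \<gamma> fn_pos[of "n + a n"] elim by (intro powr_mono2) auto
    also have "\<dots> = cf powr \<gamma> * f (real n) powr \<gamma>" using cf fn_pos[of n] elim by (simp add: powr_mult)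
    finally have "scale \<gamma> (n + a n) \<le> (cB * norming n) * (cf powr \<gamma> * f (real n) powr \<gamma>)"
      unfolding scale_def using elim norming_nonneg cB by (intro mult_mono) auto
    then show ?case by (simp add: scale_def ac_simps)
  qed
  then show ?thesis by (rule that)
qed

lemma norming_ge_count1:
  obtains u where "0 < u" "\<forall>\<^sub>F n in sequentially. u * t1 n powr (1 / \<alpha>1) \<le> norming n"
proof (cases "lam = \<infinity>")
  case True
  show ?thesis by (rule that[of 1]) (auto simp: norming_inf[OF True])
next
  case False
  then have "lam < \<infinity>" by simp
  from count2_dominates[OF this] show ?thesis using that unfolding norming_fin[OF False] by blast
qed

lemma norming_ge_count2:
  assumes "0 < lam"
  obtains v where "0 < v" "\<forall>\<^sub>F n in sequentially. v * t2 n powr (1 / \<alpha>2) \<le> norming n"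
proof (cases "lam = \<infinity>")
  case True
  from count1_dominates[OF assms] show ?thesis using that unfolding norming_inf[OF True] by blast
next
  case False
  show ?thesis by (rule that[of 1]) (auto simp: norming_fin[OF False])
qed

lemma norming_le_count1:
  assumes "0 < lam"
  obtains w where "0 < w" "\<forall>\<^sub>F n in sequentially. w * norming n \<le> t1 n powr (1 / \<alpha>1)"
proof (cases "lam = \<infinity>")
  case True
  show ?thesis by (rule that[of 1]) (auto simp: norming_inf[OF True])
next
  case False
  from count1_dominates[OF assms] show ?thesis using that unfolding norming_fin[OF False] by blast
qed

text \<open>
  The term is at most \<open>1 / count_upto K k\<close> times a power of \<open>1 / f k\<close> with exponent at least one, up
  to a constant, and \<open>f\<close> is eventually at least 1 because it tends to infinity.
\<close>
lemma summable_scale_via_count: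
  assumes \<beta>: "0 < \<beta>" "1 \<le> \<beta> * \<gamma>"
    and c: "0 < c" "\<forall>\<^sub>F n in sequentially. c * real (count_upto K n) powr (1 / \<beta>) \<le> norming n"
    and K: "filterlim (count_upto K) at_top sequentially"
    and S: "summable (\<lambda>n. 1 / (real n * f (real n)))"
  shows "type_series K (scale \<gamma>) \<beta>"
proof -
  have "summable (\<lambda>k. (1 / f (real k)) / real k)" using S by (simp add: mult.commute)
  then have "summable (\<lambda>k. if k \<in> K then (1 / f (real k)) / count_upto K k else 0)"
    by (intro summable_over_count inverse_f_nonneg inverse_f_decreasing)
  then have s: "summable (\<lambda>k. c powr - \<beta> * (if k \<in> K then (1 / f (real k)) / count_upto K k else 0))"
    by (rule summable_mult)
  have ftop: "filterlim (\<lambda>n. f (real n)) at_top sequentially"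
    by (rule summable_imp_tendsto_infinity(1)[OF fn_pos fn_mono S])
  have "\<forall>\<^sub>F n in sequentially. 1 \<le> f (real n)" "\<forall>\<^sub>F n in sequentially. 1 \<le> count_upto K n"
    using ftop K by (auto simp: filterlim_at_top)
  then have "\<forall>\<^sub>F k in sequentially. norm (if k \<in> K then scale \<gamma> k powr - \<beta> else 0) \<le> c powr - \<beta> * (if k \<in> K then (1 / f (real k)) / count_upto K k else 0)"
    using c(2)
  proof eventually_elim
    case (elim k)
    let ?t = "real (count_upto K k)"
    have t: "1 \<le> ?t" using elim by simp
    have "0 < c * ?t powr (1 / \<beta>)" using c t by simp
    then have norming_pos: "0 < norming k" using elim by linarith
    have "norming k powr - \<beta> \<le> (c * ?t powr (1 / \<beta>)) powr - \<beta>"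
      using elim \<beta> c t by (intro powr_mono2') auto
    also have "\<dots> = c powr - \<beta> * (1 / ?t)" using c t \<beta> by (simp add: powr_mult powr_powr powr_minus_divide)
    finally have 1: "norming k powr - \<beta> \<le> c powr - \<beta> * (1 / ?t)" .
    have "(f (real k) powr \<gamma>) powr - \<beta> = f (real k) powr - (\<beta> * \<gamma>)" by (simp add: powr_powr mult.commute)
    also have "\<dots> \<le> f (real k) powr - 1" using elim \<beta> by (intro powr_mono) auto
    also have "\<dots> = 1 / f (real k)" using elim by (simp add: powr_minus_divide)
    finally have 2: "(f (real k) powr \<gamma>) powr - \<beta> \<le> 1 / f (real k)" .
    have "scale \<gamma> k powr - \<beta> = norming k powr - \<beta> * (f (real k) powr \<gamma>) powr - \<beta>"
      using norming_pos by (simp add: scale_def powr_mult)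
    also have "\<dots> \<le> (c powr - \<beta> * (1 / ?t)) * (1 / f (real k))"
      using 1 2 c by (intro mult_mono) auto
    finally show ?case by (simp add: mult.commute)
  qed
  then show ?thesis by (rule summable_comparison_test_ev[OF _ s])
qed

lemma ln_scale_le:
  assumes \<gamma>: "0 \<le> \<gamma>" and S: "summable (\<lambda>n. 1 / (real n * f (real n)))"
  shows "\<forall>\<^sub>F n in sequentially. 0 \<le> ln (scale \<gamma> n) \<and> ln (scale \<gamma> n) \<le> 1 / \<alpha>1 * ln (real n) + \<gamma> * ln (f (real n))"
proof -
  have "\<forall>\<^sub>F n in sequentially. 1 \<le> scale \<gamma> n" using scale_top[OF \<gamma>] by (auto simp: filterlim_at_top)
  then show ?thesis using norming_upper eventually_ge_at_top[of 1]
  proof eventually_elim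
    case (elim n)
    have fn: "0 < f (real n)" using elim by (intro fn_pos)
    have "scale \<gamma> n \<le> real n powr (1 / \<alpha>1) * f (real n) powr \<gamma>"
      unfolding scale_def using elim by (intro mult_right_mono) auto
    then have "ln (scale \<gamma> n) \<le> ln (real n powr (1 / \<alpha>1) * f (real n) powr \<gamma>)"
      using elim by (intro ln_mono) auto
    also have "\<dots> = 1 / \<alpha>1 * ln (real n) + \<gamma> * ln (f (real n))"
      using elim fn by (simp add: ln_mult ln_powr)
    finally show ?case using elim by simp
  qed
qed

lemma ln_f_over_f:
  assumes S: "summable (\<lambda>n. 1 / (real n * f (real n)))" and p: "0 < p"
  shows "(\<lambda>n. ln (f (real n)) / f (real n) powr p) \<longlonglongrightarrow> 0"
proof -
  have "((\<lambda>x::real. ln x / x powr p) \<longlongrightarrow> 0) at_top" using p by real_asymp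
  then show ?thesis
    by (rule filterlim_compose[OF _ summable_imp_tendsto_infinity(1)[OF fn_pos fn_mono S]])
qed

text \<open>
  After division by the norming there remains \<open>ln (scale \<gamma> n) / f n\<close>, and \<open>ln (scale \<gamma> n)\<close> is at
  most a multiple of \<open>ln n + ln (f n)\<close>.
\<close>
lemma log_via_count:
  assumes \<gamma>: "1 \<le> \<gamma>"
    and c: "0 < c" "\<forall>\<^sub>F n in sequentially. c * real (count_upto K n) powr 1 \<le> norming n"
    and K: "filterlim (count_upto K) at_top sequentially"
    and S: "summable (\<lambda>n. 1 / (real n * f (real n)))"
  shows "(\<lambda>n. count_upto K n * ln (scale \<gamma> n) / scale \<gamma> n) \<longlonglongrightarrow> 0"
proof -
  have ftop: "filterlim (\<lambda>n. f (real n)) at_top sequentially" and lnf: "(\<lambda>n. ln (real n) / f (real n)) \<longlonglongrightarrow> 0"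
    using summable_imp_tendsto_infinity[OF fn_pos fn_mono S] by auto
  have f1: "\<forall>\<^sub>F n in sequentially. 1 \<le> f (real n)" "\<forall>\<^sub>F n in sequentially. 1 \<le> count_upto K n"
    using ftop K by (auto simp: filterlim_at_top)
  have "(\<lambda>n. ln (f (real n)) / f (real n) powr 1) \<longlonglongrightarrow> 0" by (rule ln_f_over_f[OF S]) simp
  then have "(\<lambda>n. ln (f (real n)) / f (real n)) \<longlonglongrightarrow> 0"
    by (rule Lim_transform_eventually) (use f1(1) in \<open>auto elim: eventually_mono\<close>)
  then have "(\<lambda>n. 1 / c * (1 / \<alpha>1 * (ln (real n) / f (real n)) + \<gamma> * (ln (f (real n)) / f (real n)))) \<longlonglongrightarrow> 1 / c * (1 / \<alpha>1 * 0 + \<gamma> * 0)"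
    by (intro tendsto_intros lnf)
  then have lim: "(\<lambda>n. 1 / c * (1 / \<alpha>1 * (ln (real n) / f (real n)) + \<gamma> * (ln (f (real n)) / f (real n)))) \<longlonglongrightarrow> 0" by simp
  have g0: "0 \<le> \<gamma>" using \<gamma> by simp
  show ?thesis
  proof (rule Lim_null_comparison[OF _ lim])
    show "\<forall>\<^sub>F n in sequentially. norm (count_upto K n * ln (scale \<gamma> n) / scale \<gamma> n) \<le> 1 / c * (1 / \<alpha>1 * (ln (real n) / f (real n)) + \<gamma> * (ln (f (real n)) / f (real n)))"
      using ln_scale_le[OF g0 S] f1 c(2)
    proof eventually_elim
      case (elim n)
      let ?t = "real (count_upto K n)" and ?F = "f (real n)"
      have ct: "0 < c * ?t" using c elim by simp
      have "?F powr 1 \<le> ?F powr \<gamma>" using elim \<gamma> by (intro powr_mono) auto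
      then have cb: "(c * ?t) * ?F \<le> scale \<gamma> n"
        unfolding scale_def using elim ct by (intro mult_mono) auto
      then have scale_pos: "0 < scale \<gamma> n" using ct elim cb c(1) by (intro less_le_trans[of 0 "c * ?t * ?F" "scale \<gamma> n"] mult_pos_pos) auto
      have "?t * ln (scale \<gamma> n) / scale \<gamma> n \<le> ?t * ln (scale \<gamma> n) / ((c * ?t) * ?F)"
        using elim ct c scale_pos cb by (intro divide_left_mono mult_nonneg_nonneg mult_pos_pos) auto
      also have "\<dots> = ln (scale \<gamma> n) / (c * ?F)" using elim c by simp
      also have "\<dots> \<le> (1 / \<alpha>1 * ln (real n) + \<gamma> * ln ?F) / (c * ?F)"
        using elim c by (intro divide_right_mono) auto
      also have "\<dots> = 1 / c * (1 / \<alpha>1 * (ln (real n) / ?F) + \<gamma> * (ln ?F / ?F))"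
        by (simp add: add_divide_distrib divide_divide_eq_left mult.commute distrib_left)
      moreover have "0 \<le> ?t * ln (scale \<gamma> n) / scale \<gamma> n"
        using elim scale_pos by simp
      ultimately show ?case by simp
    qed
  qed
qed

lemma not_summable_scale_via_count:
  assumes \<beta>: "0 < \<beta>"
    and c: "0 < c" "\<forall>\<^sub>F n in sequentially. c * norming n \<le> real (count_upto K n) powr (1 / \<beta>)"
    and r: "0 < r" "0 < d" "\<forall>\<^sub>F n in sequentially. d * real n powr r \<le> count_upto K n"
    and K: "filterlim (count_upto K) at_top sequentially"
    and S: "\<not> summable (\<lambda>n. 1 / (real n * f (real n)))"
  shows "\<not> type_series K (scale (1 / \<beta>)) \<beta>"
proof
  assume s: "type_series K (scale (1 / \<beta>)) \<beta>"
  have S': "\<not> summable (\<lambda>k. (1 / f (real k)) / real k)" using S by (simp add: mult.commute)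
  have ns: "\<not> summable (\<lambda>k. if k \<in> K then (1 / f (real k)) / count_upto K k else 0)"
    by (rule not_summable_over_count[where w="\<lambda>k. 1 / f (real k)" and c=d and r=r])
      (erule inverse_f_nonneg inverse_f_decreasing | rule S' r)+
  have norming1: "\<forall>\<^sub>F n in sequentially. 1 \<le> norming n" using norming_top by (auto simp: filterlim_at_top)
  have "\<forall>\<^sub>F k in sequentially. norm (if k \<in> K then (1 / f (real k)) / count_upto K k else 0) \<le> c powr - \<beta> * (if k \<in> K then scale (1 / \<beta>) k powr - \<beta> else 0)"
    using c(2) norming1 eventually_ge_at_top[of 1]
  proof eventually_elim
    case (elim k)
    let ?t = "real (count_upto K k)" and ?F = "f (real k)"
    have F: "0 < ?F" using elim by (intro fn_pos)
    have cB: "0 < c * norming k" using c elim by simp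
    then have "?t powr (1 / \<beta>) \<noteq> 0" using elim by linarith
    then have t: "0 < ?t" by (cases "?t = 0") auto
    have "1 / ?t = (?t powr (1 / \<beta>)) powr - \<beta>" using t \<beta> by (simp add: powr_powr powr_minus_divide)
    also have "\<dots> \<le> (c * norming k) powr - \<beta>" using elim cB \<beta> by (intro powr_mono2') auto
    also have "\<dots> = c powr - \<beta> * norming k powr - \<beta>" using c elim by (simp add: powr_mult)
    finally have 1: "1 / ?t \<le> c powr - \<beta> * norming k powr - \<beta>" .
    have 2: "(?F powr (1 / \<beta>)) powr - \<beta> = 1 / ?F" using F \<beta> by (simp add: powr_powr powr_minus_divide)
    have "(1 / ?F) / ?t = (1 / ?t) * (1 / ?F)" by simp
    also have "\<dots> \<le> (c powr - \<beta> * norming k powr - \<beta>) * (1 / ?F)" using 1 F by (intro mult_right_mono) auto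
    also have "\<dots> = c powr - \<beta> * scale (1 / \<beta>) k powr - \<beta>"
      using elim F 2 by (simp add: scale_def powr_mult)
    finally show ?case using F t by simp
  qed
  from summable_comparison_test_ev[OF this summable_mult[OF s]] ns show False by blast
qed

text \<open>
  The sparsity of the first type bounds its \<open>k\<close>-th term by a multiple of
  \<open>f k powr - r * ln k powr - \<mu> / t1 k\<close> with \<open>r = \<alpha>1 / \<alpha>2\<close>. Writing \<open>\<mu> = p * (1 - r)\<close>, the two
  powers are a weighted geometric mean of \<open>1 / f k\<close> and \<open>ln k powr - p\<close>, hence at most their maximum,
  and \<open>p > 1\<close> is the threshold for the convergence of the series of \<open>ln k powr - p / k\<close>.
\<close>
lemma sparse_type_sums:
  assumes lam: "lam < \<infinity>" and S: "summable (\<lambda>n. 1 / (real n * f (real n)))"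
    and \<mu>: "(\<alpha>2 - \<alpha>1) / \<alpha>2 < \<mu>"
      "\<forall>\<^sub>F n in sequentially. t1 n < real n powr (\<alpha>1 / \<alpha>2) * ln (real n) powr (- \<mu>)"
  shows "type_series K1 (scale (1 / \<alpha>2)) \<alpha>1"
    and "\<alpha>1 = 1 \<Longrightarrow> (\<lambda>n. count_upto K1 n * ln (scale (1 / \<alpha>2) n) / scale (1 / \<alpha>2) n) \<longlonglongrightarrow> 0"
proof -
  define r where "r = \<alpha>1 / \<alpha>2"
  have r: "0 < r" "r < 1" using alpha by (auto simp: r_def)
  have \<mu>r: "1 - r < \<mu>" using \<mu>(1) alpha by (simp add: r_def diff_divide_distrib)
  obtain c2 where c2: "0 < c2" "\<forall>\<^sub>F n in sequentially. c2 * real n \<le> t2 n"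
    by (rule count2_linear[OF lam])
  define c where "c = c2 powr (1 / \<alpha>2)"
  have c: "0 < c" using c2 by (simp add: c_def)
  have norming_low: "\<forall>\<^sub>F n in sequentially. c * real n powr (1 / \<alpha>2) \<le> norming n"
    using c2(2)
  proof eventually_elim
    case (elim n)
    have "c * real n powr (1 / \<alpha>2) = (c2 * real n) powr (1 / \<alpha>2)" using c2 by (simp add: c_def powr_mult)
    also have "\<dots> \<le> t2 n powr (1 / \<alpha>2)" using elim c2 alpha by (intro powr_mono2) auto
    finally show ?case using lam norming_fin by simp
  qed
  have ftop: "filterlim (\<lambda>n. f (real n)) at_top sequentially" and lnf: "(\<lambda>n. ln (real n) / f (real n)) \<longlonglongrightarrow> 0"
    using summable_imp_tendsto_infinity[OF fn_pos fn_mono S] by auto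
  have f1: "\<forall>\<^sub>F n in sequentially. 1 \<le> f (real n)" using ftop by (auto simp: filterlim_at_top)
  have ln1: "\<forall>\<^sub>F n in sequentially. 1 \<le> ln (real n)"
  proof -
    have "filterlim (\<lambda>n. ln (real n)) at_top sequentially" by real_asymp
    then show ?thesis by (auto simp: filterlim_at_top)
  qed
  show "type_series K1 (scale (1 / \<alpha>2)) \<alpha>1"
  proof -
    define p where "p = \<mu> / (1 - r)"
    have p: "1 < p" using \<mu>r r by (simp add: p_def)
    \<comment> \<open>The maximum with 2 keeps \<open>w\<close> decreasing at \<open>k = 1\<close>, where the logarithm vanishes.\<close>
    define w where "w = (\<lambda>k::nat. 1 / f (real k) + ln (real (max 2 k)) powr - p)"
    have lnpos: "0 < ln (real (max 2 k))" for k by (simp add: max_def)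
    have wpos: "0 \<le> w k" if "1 \<le> k" for k using fn_pos[OF that] by (simp add: w_def)
    have wdec: "w (Suc k) \<le> w k" if "1 \<le> k" for k
    proof -
      have "1 / f (real (Suc k)) \<le> 1 / f (real k)"
        using fn_pos[OF that] fn_pos[of "Suc k"] fn_mono[OF that, of "Suc k"] by (intro divide_left_mono mult_pos_pos) auto
      moreover have "ln (real (max 2 (Suc k))) powr - p \<le> ln (real (max 2 k)) powr - p"
        using p lnpos[of k] by (intro powr_mono2') (auto simp: max_def)
      ultimately show ?thesis by (simp add: w_def)
    qed
    have "summable (\<lambda>k. 1 / (real k * f (real k)) + ln (real k) powr - p / real k)"
      by (intro summable_add S summable_bertrand p)
    then have "summable (\<lambda>k. w k / real k)"
      by (rule summable_cong[THEN iffD1, rotated])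
        (auto intro!: eventually_mono[OF eventually_ge_at_top[of 2]] simp: w_def max_def add_divide_distrib mult.commute)
    from summable_over_count[OF wpos wdec this]
    have s: "summable (\<lambda>k. c powr - \<alpha>1 * (if k \<in> K1 then w k / t1 k else 0))" by (rule summable_mult)
    have ev: "\<forall>\<^sub>F k in sequentially. norm (if k \<in> K1 then scale (1 / \<alpha>2) k powr - \<alpha>1 else 0) \<le> c powr - \<alpha>1 * (if k \<in> K1 then w k / t1 k else 0)"
      using \<mu>(2)[folded r_def] norming_low f1 ln1 count_ge1 eventually_ge_at_top[of 2]
    proof eventually_elim
      case (elim k)
      let ?F = "f (real k)" and ?L = "ln (real k)"
      define m where "m = max (1 / ?F) (?L powr - p)"
      have m: "0 < m" "m \<le> w k" using elim by (auto simp: m_def w_def less_max_iff_disj max_def)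
      have n0: "0 < real k" using elim by simp
      have cn: "0 < c * real k powr (1 / \<alpha>2)" using c n0 by simp
      have norming_pos: "0 < norming k" using cn elim by linarith
      have "norming k powr - \<alpha>1 \<le> (c * real k powr (1 / \<alpha>2)) powr - \<alpha>1"
        using elim cn alpha by (intro powr_mono2') auto
      also have "\<dots> = c powr - \<alpha>1 * real k powr - r"
        using c by (simp add: powr_mult powr_powr r_def)
      also have "real k powr - r \<le> ?L powr - \<mu> / t1 k"
        using elim n0 by (simp add: powr_minus_divide field_simps)
      finally have 1: "norming k powr - \<alpha>1 \<le> c powr - \<alpha>1 * (?L powr - \<mu> / t1 k)" using c by simp
      have "(?F powr (1 / \<alpha>2)) powr - \<alpha>1 = (1 / ?F) powr r"
        using elim by (simp add: powr_powr r_def powr_divide powr_minus_divide)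
      also have "\<dots> \<le> m powr r" using elim r by (intro powr_mono2) (auto simp: m_def)
      finally have 2: "(?F powr (1 / \<alpha>2)) powr - \<alpha>1 \<le> m powr r" .
      have "?L powr - \<mu> = (?L powr - p) powr (1 - r)" using r by (simp add: powr_powr p_def)
      also have "\<dots> \<le> m powr (1 - r)" using r by (intro powr_mono2) (auto simp: m_def)
      finally have 3: "?L powr - \<mu> \<le> m powr (1 - r)" .
      have "scale (1 / \<alpha>2) k powr - \<alpha>1 = norming k powr - \<alpha>1 * (?F powr (1 / \<alpha>2)) powr - \<alpha>1"
        using norming_pos by (simp add: scale_def powr_mult)
      also have "\<dots> \<le> (c powr - \<alpha>1 * (m powr (1 - r) / t1 k)) * m powr r"
      proof (intro mult_mono order_trans[OF 1] 2 mult_left_mono divide_right_mono 3)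
      qed auto
      also have "\<dots> = c powr - \<alpha>1 * (m powr (1 - r) * m powr r / t1 k)" by simp
      also have "m powr (1 - r) * m powr r = m" using m by (simp add: powr_add[symmetric])
      also have "c powr - \<alpha>1 * (m / t1 k) \<le> c powr - \<alpha>1 * (w k / t1 k)"
        using m by (intro mult_left_mono divide_right_mono) auto
      finally show ?case by simp
    qed
    show ?thesis by (rule summable_comparison_test_ev[OF ev s])
  qed
  show "(\<lambda>n. count_upto K1 n * ln (scale (1 / \<alpha>2) n) / scale (1 / \<alpha>2) n) \<longlonglongrightarrow> 0" if one: "\<alpha>1 = 1"
  proof -
    have ra: "1 / \<alpha>2 = r" using one by (simp add: r_def)
    have "\<forall>\<^sub>F n in sequentially. 0 \<le> ln (real n) / f (real n)"
      using ln1 f1 by eventually_elim simp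
    then have "(\<lambda>n. (ln (real n) / f (real n)) powr r) \<longlonglongrightarrow> 0"
      by (rule tendsto_zero_powrI[OF lnf tendsto_const _ r(1)])
    then have "(\<lambda>n. 1 / c * (1 * (ln (real n) / f (real n)) powr r + r * (ln (f (real n)) / f (real n) powr r))) \<longlonglongrightarrow> 1 / c * (1 * 0 + r * 0)"
      by (intro tendsto_intros ln_f_over_f[OF S r(1)])
    then have lim: "(\<lambda>n. 1 / c * (1 * (ln (real n) / f (real n)) powr r + r * (ln (f (real n)) / f (real n) powr r))) \<longlonglongrightarrow> 0" by simp
    have r0: "0 \<le> r" using r by simp
    have one': "1 / \<alpha>1 = 1" using one by simp
    show ?thesis unfolding ra
    proof (rule Lim_null_comparison[OF _ lim])
      show "\<forall>\<^sub>F n in sequentially. norm (count_upto K1 n * ln (scale r n) / scale r n) \<le> 1 / c * (1 * (ln (real n) / f (real n)) powr r + r * (ln (f (real n)) / f (real n) powr r))"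
        using ln_scale_le[OF r0 S, unfolded one'] \<mu>(2)[folded r_def] norming_low[unfolded ra] f1 ln1 eventually_ge_at_top[of 2]
      proof eventually_elim
        case (elim n)
        let ?F = "f (real n)" and ?L = "ln (real n)"
        have n0: "0 < real n powr r" using elim by simp
        have F: "0 < ?F powr r" using elim by simp
        have den: "0 < c * real n powr r * ?F powr r" using c n0 F by simp
        have low: "c * real n powr r * ?F powr r \<le> scale r n"
          unfolding scale_def using elim by (intro mult_right_mono) auto
        have lnF: "0 \<le> ln ?F" using elim by simp
        have num: "t1 n * ln (scale r n) \<le> (real n powr r * ?L powr - \<mu>) * (1 * ?L + r * ln ?F)"
          using elim by (intro mult_mono) auto
        have scale_pos: "0 < scale r n" using den low by linarith
        have "t1 n * ln (scale r n) / scale r n \<le> (real n powr r * ?L powr - \<mu>) * (1 * ?L + r * ln ?F) / scale r n"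
          using num scale_pos by (intro divide_right_mono) auto
        also have "\<dots> \<le> (real n powr r * ?L powr - \<mu>) * (1 * ?L + r * ln ?F) / (c * real n powr r * ?F powr r)"
          using low den scale_pos elim lnF r0 c by (intro divide_left_mono mult_nonneg_nonneg mult_pos_pos add_nonneg_nonneg) auto
        also have "\<dots> = 1 / c * ((?L powr - \<mu> * ?L) / ?F powr r + r * (?L powr - \<mu> * ln ?F) / ?F powr r)"
          using n0 c F by (simp add: field_simps)
        also have "\<dots> \<le> 1 / c * (?L powr r / ?F powr r + r * (1 * ln ?F) / ?F powr r)"
        proof (intro mult_left_mono add_mono divide_right_mono mult_right_mono)
          have "?L powr - \<mu> * ?L = ?L powr (1 - \<mu>)" using elim by (simp add: powr_diff powr_minus field_simps)
          also have "\<dots> \<le> ?L powr r" using elim \<mu>r by (intro powr_mono) auto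
          finally show "?L powr - \<mu> * ?L \<le> ?L powr r" .
          have "?L powr - \<mu> \<le> ?L powr 0" using elim \<mu>r r by (intro powr_mono) auto
          then show "?L powr - \<mu> \<le> 1" using elim by simp
        qed (use c r0 lnF F in auto)
        also have "\<dots> = 1 / c * (1 * (?L / ?F) powr r + r * (ln ?F / ?F powr r))"
          using elim by (simp add: powr_divide)
        finally have "t1 n * ln (scale r n) / scale r n \<le> 1 / c * (1 * (?L / ?F) powr r + r * (ln ?F / ?F powr r))" .
        moreover have "0 \<le> t1 n * ln (scale r n) / scale r n" using elim scale_pos by simp
        ultimately show ?case by simp
      qed
    qed
  qed
qed

end

section \<open>The dichotomy\<close>

theorem theorem3p5:
  fixes M :: "'a measure"
    and X :: "nat \<Rightarrow> 'a \<Rightarrow> real"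
    and G\<^sub>1 G\<^sub>2 :: "real measure"
    and \<alpha>\<^sub>1 \<alpha>\<^sub>2 l\<^sub>1 l\<^sub>2 :: real
    and d\<^sub>1 d\<^sub>2 :: "nat \<Rightarrow> real"
    and lam :: ereal
    and f :: "real \<Rightarrow> real"
    and a :: "nat \<Rightarrow> nat"
    and \<tau>\<^sub>1 \<tau>\<^sub>2 :: "nat \<Rightarrow> nat"
    and B :: "nat \<Rightarrow> real"
    and T :: "nat \<Rightarrow> 'a \<Rightarrow> real"
  defines "\<tau>\<^sub>1 \<equiv> law_count M X G\<^sub>1"
    and "\<tau>\<^sub>2 \<equiv> law_count M X G\<^sub>2"
    and "B \<equiv> (\<lambda>n. if lam = \<infinity> then real (\<tau>\<^sub>1 n) powr (1 / \<alpha>\<^sub>1)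
                   else real (\<tau>\<^sub>2 n) powr (1 / \<alpha>\<^sub>2))"
    and "T \<equiv> (\<lambda>n \<omega>. partial_sum X (n + a n) \<omega> - partial_sum X n \<omega>)"
  assumes alpha: "0 < \<alpha>\<^sub>1" "\<alpha>\<^sub>1 < \<alpha>\<^sub>2" "\<alpha>\<^sub>2 < 2"
    and l_pos: "l\<^sub>1 > 0" "l\<^sub>2 > 0"
    and prob: "prob_space M"
    and indep: "prob_space.indep_vars M (\<lambda>_. borel) X {1..}"
    and laws: "\<And>n. n \<ge> 1 \<Longrightarrow> distr M borel (X n) \<in> {G\<^sub>1, G\<^sub>2}"
    and attraction: "normal_attraction G\<^sub>1 d\<^sub>1 \<alpha>\<^sub>1 l\<^sub>1" "normal_attraction G\<^sub>2 d\<^sub>2 \<alpha>\<^sub>2 l\<^sub>2"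
    and centering: "centering_convention \<alpha>\<^sub>1 d\<^sub>1" "centering_convention \<alpha>\<^sub>2 d\<^sub>2"
    and tau_top: "filterlim \<tau>\<^sub>1 at_top sequentially" "filterlim \<tau>\<^sub>2 at_top sequentially"
    and ratio: "(\<lambda>n. ereal (real (\<tau>\<^sub>1 n) powr \<alpha>\<^sub>2 / real (\<tau>\<^sub>2 n) powr \<alpha>\<^sub>1)) \<longlonglongrightarrow> lam"
    and S_conv: "\<exists>A Z. real_distribution Z \<and>
          weak_conv_m (\<lambda>n. distr M borel (\<lambda>\<omega>. (partial_sum X n \<omega> - A n) / B n)) Z"
    and f_pos: "\<And>x. x \<ge> 1 \<Longrightarrow> f x > 0"
    and f_mono: "mono_on {1..} f"
    and f_growth: "\<And>b :: nat \<Rightarrow> real. (\<And>n. b n \<ge> 1) \<Longrightarrow>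
          limsup (\<lambda>n. ereal (b n / real n)) < \<infinity> \<Longrightarrow>
          limsup (\<lambda>n. ereal (f (b n) / f (real n))) < \<infinity>"
    and a_pos: "\<And>n. n \<ge> 1 \<Longrightarrow> a n > 0"
    and a_top: "filterlim a at_top sequentially"
  shows
    "(0 < lam \<and>
      (lam = \<infinity> \<longrightarrow> limsup (\<lambda>n. ereal (real (a n) / real (\<tau>\<^sub>1 n))) < \<infinity>) \<and>
      (lam < \<infinity> \<longrightarrow> limsup (\<lambda>n. ereal (real (a n) / real n)) < \<infinity>)
      \<longrightarrow> (AE \<omega> in M.
        (limsup (\<lambda>n. ereal (\<bar>T n \<omega>\<bar> / (B n * f (real n) powr (1 / \<alpha>\<^sub>1)))) = 0
           \<longleftrightarrow> (\<integral>\<^sup>+x\<in>{1..}. ennreal (1 / (x * f x)) \<partial>lborel) < \<infinity>) \<and>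
        (limsup (\<lambda>n. ereal (\<bar>T n \<omega>\<bar> / (B n * f (real n) powr (1 / \<alpha>\<^sub>1)))) = \<infinity>
           \<longleftrightarrow> (\<integral>\<^sup>+x\<in>{1..}. ennreal (1 / (x * f x)) \<partial>lborel) = \<infinity>)))
     \<and>
     (lam = 0 \<and>
      limsup (\<lambda>n. ereal (real (a n) / real n)) < \<infinity> \<and>
      (\<exists>\<mu> > (\<alpha>\<^sub>2 - \<alpha>\<^sub>1) / \<alpha>\<^sub>2. \<forall>\<^sub>F n in sequentially.
         real (\<tau>\<^sub>1 n) < real n powr (\<alpha>\<^sub>1 / \<alpha>\<^sub>2) * ln (real n) powr (- \<mu>))
      \<longrightarrow> (AE \<omega> in M.
        (limsup (\<lambda>n. ereal (\<bar>T n \<omega>\<bar> / (B n * f (real n) powr (1 / \<alpha>\<^sub>2)))) = 0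
           \<longleftrightarrow> (\<integral>\<^sup>+x\<in>{1..}. ennreal (1 / (x * f x)) \<partial>lborel) < \<infinity>) \<and>
        (limsup (\<lambda>n. ereal (\<bar>T n \<omega>\<bar> / (B n * f (real n) powr (1 / \<alpha>\<^sub>2)))) = \<infinity>
           \<longleftrightarrow> (\<integral>\<^sup>+x\<in>{1..}. ennreal (1 / (x * f x)) \<partial>lborel) = \<infinity>)))"
proof -
  interpret prob_space M by (rule prob)
  define K1 where "K1 = {k. distr M borel (X k) = G\<^sub>1}"
  define K2 where "K2 = {k. distr M borel (X k) = G\<^sub>2}"
  have \<tau>: "\<tau>\<^sub>1 = count_upto K1" "\<tau>\<^sub>2 = count_upto K2"
    by (auto simp: \<tau>\<^sub>1_def \<tau>\<^sub>2_def law_count_def count_upto_def K1_def K2_def intro!: ext arg_cong[where f=card])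
  have cover: "{1..} \<subseteq> K1 \<union> K2" using laws by (auto simp: K1_def K2_def)
  have law: "\<And>k. k \<in> K1 \<Longrightarrow> distr M borel (X k) = G\<^sub>1" "\<And>k. k \<in> K2 \<Longrightarrow> distr M borel (X k) = G\<^sub>2"
    by (auto simp: K1_def K2_def)
  have N: "two_type_norming K1 K2 \<alpha>\<^sub>1 \<alpha>\<^sub>2 lam f"
    by (rule two_type_norming.intro)
      (use alpha cover tau_top ratio f_pos f_mono f_growth in \<open>simp_all add: \<tau>\<close>)
  have B_eq: "B = two_type_norming.norming K1 K2 \<alpha>\<^sub>1 \<alpha>\<^sub>2 lam"
    unfolding B_def \<tau> by (rule ext) (simp add: two_type_norming.norming_def[OF N])
  have \<alpha>12: "\<alpha>\<^sub>1 < 2" "0 < \<alpha>\<^sub>2" using alpha by auto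
  obtain C1 c1 x1 where bounds1: "stable_type_bounds G\<^sub>1 \<alpha>\<^sub>1 C1" and c1: "0 < c1"
    and low1: "\<And>x. x1 \<le> x \<Longrightarrow> c1 * x powr - \<alpha>\<^sub>1 \<le> abs_tail G\<^sub>1 x"
    by (rule normal_attraction_bounds[OF attraction(1) alpha(1) \<alpha>12(1) l_pos(1) centering(1)]) blast
  obtain C2 c2 x2 where bounds2: "stable_type_bounds G\<^sub>2 \<alpha>\<^sub>2 C2" and c2: "0 < c2"
    and low2: "\<And>x. x2 \<le> x \<Longrightarrow> c2 * x powr - \<alpha>\<^sub>2 \<le> abs_tail G\<^sub>2 x"
    by (rule normal_attraction_bounds[OF attraction(2) \<alpha>12(2) alpha(3) l_pos(2) centering(2)]) blast
  interpret two_type_norming K1 K2 \<alpha>\<^sub>1 \<alpha>\<^sub>2 lam f a by (rule N)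
  let ?S = "summable (\<lambda>n. 1 / (real n * f (real n)))"
  let ?I = "\<integral>\<^sup>+x\<in>{1..}. ennreal (1 / (x * f x)) \<partial>lborel"
  let ?L = "\<lambda>\<gamma> \<omega>. limsup (\<lambda>n. ereal (\<bar>T n \<omega>\<bar> / scale \<gamma> n))"
  have I: "?I < \<infinity> \<longleftrightarrow> ?S" by (rule integral_test[OF f_pos f_mono])
  \<comment> \<open>The two equivalences hold together: the limit superior cannot be both \<open>0\<close> and \<open>\<infinity>\<close>.\<close>
  have dichotomy: "AE \<omega> in M. (?L \<gamma> \<omega> = 0 \<longleftrightarrow> ?I < \<infinity>) \<and> (?L \<gamma> \<omega> = \<infinity> \<longleftrightarrow> ?I = \<infinity>)"
    if "?S \<Longrightarrow> AE \<omega> in M. ?L \<gamma> \<omega> = 0" "\<not> ?S \<Longrightarrow> AE \<omega> in M. ?L \<gamma> \<omega> = \<infinity>" for \<gamma>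
  proof (cases ?S)
    case True
    then have fin: "?I < \<infinity>" using I by blast
    from that(1)[OF True] show ?thesis by eventually_elim (use fin in auto)
  next
    case False
    then have inf: "?I = \<infinity>" using I by (simp add: not_less top_unique)
    from that(2)[OF False] show ?thesis by eventually_elim (use inf in auto)
  qed
  have zero: "AE \<omega> in M. ?L \<gamma> \<omega> = 0"
    if \<gamma>: "0 \<le> \<gamma>"
      and sums: "type_series K1 (scale \<gamma>) \<alpha>\<^sub>1"
        "type_series K2 (scale \<gamma>) \<alpha>\<^sub>2"
      and logs: "\<alpha>\<^sub>1 = 1 \<Longrightarrow> (\<lambda>n. count_upto K1 n * ln (scale \<gamma> n) / scale \<gamma> n) \<longlonglongrightarrow> 0"
        "\<alpha>\<^sub>2 = 1 \<Longrightarrow> (\<lambda>n. count_upto K2 n * ln (scale \<gamma> n) / scale \<gamma> n) \<longlonglongrightarrow> 0"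
      and a_inf: "lam = \<infinity> \<Longrightarrow> limsup (\<lambda>n. ereal (real (a n) / t1 n)) < \<infinity>"
      and a_fin: "lam < \<infinity> \<Longrightarrow> limsup (\<lambda>n. ereal (real (a n) / real n)) < \<infinity>" for \<gamma>
  proof -
    obtain n0 where n0: "\<And>n. n0 \<le> n \<Longrightarrow> 0 < scale \<gamma> n" "\<And>m n. n0 \<le> m \<Longrightarrow> m \<le> n \<Longrightarrow> scale \<gamma> m \<le> scale \<gamma> n"
      by (rule scale_eventually_pos_mono[OF \<gamma>]) blast
    obtain c where "\<forall>\<^sub>F n in sequentially. scale \<gamma> (n + a n) \<le> c * scale \<gamma> n"
      by (rule scale_growth[OF \<gamma> a_inf a_fin])
    from limsup_window_zero[OF indep bounds1 bounds2 law cover n0 scale_top[OF \<gamma>] sums logs this]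
    show ?thesis by (simp add: T_def)
  qed
  have inf: "AE \<omega> in M. ?L \<gamma> \<omega> = \<infinity>"
    if \<gamma>: "0 \<le> \<gamma>" and low: "0 < c0" "\<And>x. x0 \<le> x \<Longrightarrow> c0 * x powr - \<alpha> \<le> abs_tail G x"
      and lawK: "\<And>k. k \<in> K \<Longrightarrow> distr M borel (X k) = G"
      and div: "\<not> type_series K (scale \<gamma>) \<alpha>" for \<gamma> c0 x0 \<alpha> G K
  proof -
    obtain n0 where n0: "\<And>n. n0 \<le> n \<Longrightarrow> 0 < scale \<gamma> n" "\<And>m n. n0 \<le> m \<Longrightarrow> m \<le> n \<Longrightarrow> scale \<gamma> m \<le> scale \<gamma> n"
      by (rule scale_eventually_pos_mono[OF \<gamma>]) blast
    show ?thesis unfolding T_def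
      by (rule limsup_window_top[OF indep alpha(1) \<alpha>12(2) bounds1 bounds2 law cover n0 scale_top[OF \<gamma>] a_pos low lawK div])
  qed
  \<comment> \<open>The first type decides: its series is that of \<open>1 / (\<tau>\<^sub>1 k * f k)\<close> up to constants, and if the integral converges, that of the second type is at most a multiple of that of \<open>1 / (\<tau>\<^sub>2 k * f k)\<close>.\<close>
  have case1: "AE \<omega> in M. (?L (1 / \<alpha>\<^sub>1) \<omega> = 0 \<longleftrightarrow> ?I < \<infinity>) \<and> (?L (1 / \<alpha>\<^sub>1) \<omega> = \<infinity> \<longleftrightarrow> ?I = \<infinity>)"
    if lam: "0 < lam" and a_inf: "lam = \<infinity> \<Longrightarrow> limsup (\<lambda>n. ereal (real (a n) / t1 n)) < \<infinity>"
      and a_fin: "lam < \<infinity> \<Longrightarrow> limsup (\<lambda>n. ereal (real (a n) / real n)) < \<infinity>"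
  proof (rule dichotomy)
    obtain u where u: "0 < u" "\<forall>\<^sub>F n in sequentially. u * t1 n powr (1 / \<alpha>\<^sub>1) \<le> norming n"
      by (rule norming_ge_count1)
    obtain v where v: "0 < v" "\<forall>\<^sub>F n in sequentially. v * t2 n powr (1 / \<alpha>\<^sub>2) \<le> norming n"
      by (rule norming_ge_count2[OF lam])
    have \<gamma>: "0 \<le> 1 / \<alpha>\<^sub>1" "1 \<le> \<alpha>\<^sub>1 * (1 / \<alpha>\<^sub>1)" "1 \<le> \<alpha>\<^sub>2 * (1 / \<alpha>\<^sub>1)" using alpha by auto
    show "AE \<omega> in M. ?L (1 / \<alpha>\<^sub>1) \<omega> = 0" if S: ?S
    proof (rule zero[OF \<gamma>(1)])
      show "type_series K1 (scale (1 / \<alpha>\<^sub>1)) \<alpha>\<^sub>1"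
        by (rule summable_scale_via_count[OF alpha(1) \<gamma>(2) u count_top(1) S])
      show "type_series K2 (scale (1 / \<alpha>\<^sub>1)) \<alpha>\<^sub>2"
        by (rule summable_scale_via_count[OF \<alpha>12(2) \<gamma>(3) v count_top(2) S])
      show "(\<lambda>n. count_upto K1 n * ln (scale (1 / \<alpha>\<^sub>1) n) / scale (1 / \<alpha>\<^sub>1) n) \<longlonglongrightarrow> 0" if "\<alpha>\<^sub>1 = 1"
        using u that by (intro log_via_count[OF _ u(1) _ count_top(1) S]) auto
      show "(\<lambda>n. count_upto K2 n * ln (scale (1 / \<alpha>\<^sub>1) n) / scale (1 / \<alpha>\<^sub>1) n) \<longlonglongrightarrow> 0" if "\<alpha>\<^sub>2 = 1"
        using v that \<gamma>(3) by (intro log_via_count[OF _ v(1) _ count_top(2) S]) auto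
    qed (fact a_inf a_fin)+
    show "AE \<omega> in M. ?L (1 / \<alpha>\<^sub>1) \<omega> = \<infinity>" if S: "\<not> ?S"
    proof (rule inf[OF \<gamma>(1) c1 low1 law(1)])
      obtain w where w: "0 < w" "\<forall>\<^sub>F n in sequentially. w * norming n \<le> t1 n powr (1 / \<alpha>\<^sub>1)"
        by (rule norming_le_count1[OF lam])
      obtain d where d: "0 < d" "\<forall>\<^sub>F n in sequentially. d * real n powr (\<alpha>\<^sub>1 / \<alpha>\<^sub>2) \<le> t1 n"
        by (rule count1_power[OF lam])
      have r: "0 < \<alpha>\<^sub>1 / \<alpha>\<^sub>2" using alpha by simp
      show "\<not> type_series K1 (scale (1 / \<alpha>\<^sub>1)) \<alpha>\<^sub>1"
        by (rule not_summable_scale_via_count[OF alpha(1) w r d count_top(1) S])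
    qed
  qed
  \<comment> \<open>The second type decides, and the count of its indices grows linearly.\<close>
  have case2: "AE \<omega> in M. (?L (1 / \<alpha>\<^sub>2) \<omega> = 0 \<longleftrightarrow> ?I < \<infinity>) \<and> (?L (1 / \<alpha>\<^sub>2) \<omega> = \<infinity> \<longleftrightarrow> ?I = \<infinity>)"
    if lam: "lam = 0" and a_fin: "limsup (\<lambda>n. ereal (real (a n) / real n)) < \<infinity>"
      and \<mu>: "(\<alpha>\<^sub>2 - \<alpha>\<^sub>1) / \<alpha>\<^sub>2 < \<mu>"
        "\<forall>\<^sub>F n in sequentially. t1 n < real n powr (\<alpha>\<^sub>1 / \<alpha>\<^sub>2) * ln (real n) powr (- \<mu>)" for \<mu>
  proof (rule dichotomy)
    have fin: "lam < \<infinity>" using lam by simp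
    have v: "\<forall>\<^sub>F n in sequentially. 1 * t2 n powr (1 / \<alpha>\<^sub>2) \<le> norming n"
      "\<forall>\<^sub>F n in sequentially. 1 * norming n \<le> t2 n powr (1 / \<alpha>\<^sub>2)"
      using norming_fin fin by auto
    have \<gamma>: "0 \<le> 1 / \<alpha>\<^sub>2" "1 \<le> \<alpha>\<^sub>2 * (1 / \<alpha>\<^sub>2)" using alpha by auto
    show "AE \<omega> in M. ?L (1 / \<alpha>\<^sub>2) \<omega> = 0" if S: ?S
    proof (rule zero[OF \<gamma>(1)])
      show "type_series K2 (scale (1 / \<alpha>\<^sub>2)) \<alpha>\<^sub>2"
        by (rule summable_scale_via_count[OF \<alpha>12(2) \<gamma>(2) zero_less_one v(1) count_top(2) S])
      show "(\<lambda>n. count_upto K2 n * ln (scale (1 / \<alpha>\<^sub>2) n) / scale (1 / \<alpha>\<^sub>2) n) \<longlonglongrightarrow> 0" if "\<alpha>\<^sub>2 = 1"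
        using v(1) that by (intro log_via_count[OF _ zero_less_one _ count_top(2) S]) auto
    qed (use sparse_type_sums[OF fin S \<mu>] a_fin fin in auto)
    show "AE \<omega> in M. ?L (1 / \<alpha>\<^sub>2) \<omega> = \<infinity>" if S: "\<not> ?S"
    proof (rule inf[OF \<gamma>(1) c2 low2 law(2)])
      obtain d where d: "0 < d" "\<forall>\<^sub>F n in sequentially. d * real n \<le> t2 n"
        by (rule count2_linear[OF fin])
      then have d': "\<forall>\<^sub>F n in sequentially. d * real n powr 1 \<le> t2 n" by simp
      show "\<not> type_series K2 (scale (1 / \<alpha>\<^sub>2)) \<alpha>\<^sub>2"
        by (rule not_summable_scale_via_count[OF \<alpha>12(2) zero_less_one v(2) zero_less_one d(1) d' count_top(2) S])
    qed
  qed
  show ?thesis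
    unfolding B_eq scale_def[symmetric] \<tau>
    using case1 case2 by blast
qed

end
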